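(* Let $X_{ij}$, $1\le i\le j<\infty$, be a triangular array of real random variables with $\mathbb{E}X_{ij}=0$ and $\mathbb{E}X_{ij}^2=\sigma_{ij}^2$, let $X_{ji}=X_{ij}$ (and $\sigma_{ji}=\sigma_{ij}$) for $i<j$, and let $\mathbf{X}_n=\{X_{ij}\}_{i,j=1}^n$. Assume that for each $n$ the elements $X_{ij}$, $1\le i\le j\le n$, are independent, and that the following conditions hold: (a) for every fixed $\tau>0$, $\displaystyle L_n(\tau):=\frac{1}{n^2}\sum_{i,j=1}^n \mathbb{E}|X_{ij}|^2\,\mathbf{1}(|X_{ij}|\ge \tau\sqrt{n})\to 0$ as $n\to\infty$; (b) $\displaystyle \frac1n\sum_{i=1}^n |B_i^2-1|\to 0$ as $n\to\infty$, where $B_i^2:=\frac1n\sum_{j=1}^n\sigma_{ij}^2$; (c) there is an absolute constant $C$ (independent of $n$) such that $\max_{1\le i\le n}B_i\le C$ for all $n$. Then $$\sup_{x\in\mathbb{R}}|F^{\mathbf{X}_n}(x)-G(x)|\to 0\quad\text{as } n\to\infty.$$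
   Context: All random variables are defined on a common probability space. $\mathbf{1}(B)$ denotes the indicator of an event $B$. The quantity $B_i\ge 0$ depends on $n$. For a real symmetric random $n\times n$ matrix $\mathbf{X}_n$, let $\lambda_1\le\dots\le\lambda_n$ be the eigenvalues of $n^{-1/2}\mathbf{X}_n$, let $\mathcal{F}^{\mathbf{X}_n}(x)=\frac1n\sum_{i=1}^n\mathbf{1}(\lambda_i\le x)$, and let $F^{\mathbf{X}_n}(x):=\mathbb{E}\,\mathcal{F}^{\mathbf{X}_n}(x)$. $G$ is the distribution function of the standard semicircle law: $G(x)=\int_{-\infty}^x g(u)\,du$ with $g(x)=\frac{1}{2\pi}\sqrt{4-x^2}\,\mathbf{1}(|x|\le 2)$. *)

theory Defs
  imports
    "HOL-Probability.Probability"
    "Jordan_Normal_Form.Char_Poly"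
begin

hide_const (open) Finite_Cartesian_Product.mat

text \<open>
  Matrix rows and columns are numbered from 0 in the matrix library, whereas the random
  variables \<open>X i j\<close> and the eigenvalues are numbered from 1.
\<close>

definition eig_val :: "real Matrix.mat \<Rightarrow> nat \<Rightarrow> real" where
  \<comment> \<open>the roots of the characteristic polynomial, with multiplicity, in increasing order;
      a real symmetric matrix of size \<open>n\<close> has exactly \<open>n\<close> of them\<close>
  "eig_val A i = sorted_list_of_multiset (proots (char_poly A)) ! (i - 1)"

definition random_matrix :: "(nat \<Rightarrow> nat \<Rightarrow> 'a \<Rightarrow> real) \<Rightarrow> nat \<Rightarrow> 'a \<Rightarrow> real Matrix.mat" where
  "random_matrix X n \<omega> = Matrix.mat n n (\<lambda>(i, j). X (Suc i) (Suc j) \<omega>)"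

definition empirical_spectral_cdf ::
    "(nat \<Rightarrow> nat \<Rightarrow> 'a \<Rightarrow> real) \<Rightarrow> nat \<Rightarrow> 'a \<Rightarrow> real \<Rightarrow> real" where
  "empirical_spectral_cdf X n \<omega> x =
     (1 / real n) *
     (\<Sum>i = 1..n. of_bool (eig_val ((1 / sqrt (real n)) \<cdot>\<^sub>m random_matrix X n \<omega>) i \<le> x))"

definition expected_spectral_cdf ::
    "'a measure \<Rightarrow> (nat \<Rightarrow> nat \<Rightarrow> 'a \<Rightarrow> real) \<Rightarrow> nat \<Rightarrow> real \<Rightarrow> real" where
  "expected_spectral_cdf M X n x = (LINT \<omega>|M. empirical_spectral_cdf X n \<omega> x)"

definition semicircle_density :: "real \<Rightarrow> real" where
  "semicircle_density u = 1 / (2 * pi) * sqrt (4 - u\<^sup>2) * of_bool (\<bar>u\<bar> \<le> 2)"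

definition semicircle_cdf :: "real \<Rightarrow> real" where
  "semicircle_cdf x = (LINT u:{..x}|lborel. semicircle_density u)"

definition lindeberg_sum ::
    "'a measure \<Rightarrow> (nat \<Rightarrow> nat \<Rightarrow> 'a \<Rightarrow> real) \<Rightarrow> nat \<Rightarrow> real \<Rightarrow> real" where
  "lindeberg_sum M X n \<tau> =
     (1 / (real n)\<^sup>2) *
     (\<Sum>i = 1..n. \<Sum>j = 1..n.
        (LINT \<omega>|M. \<bar>X i j \<omega>\<bar>\<^sup>2 * of_bool (\<bar>X i j \<omega>\<bar> \<ge> \<tau> * sqrt (real n))))"

definition row_scale :: "(nat \<Rightarrow> nat \<Rightarrow> real) \<Rightarrow> nat \<Rightarrow> nat \<Rightarrow> real" where
  \<comment> \<open>the nonnegative number \<open>B\<^sub>i\<close>, for matrices of size \<open>n\<close>\<close>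
  "row_scale \<sigma> n i = sqrt ((1 / real n) * (\<Sum>j = 1..n. (\<sigma> i j)\<^sup>2))"

end

theory Submission
  imports Defs "Jordan_Normal_Form.Schur_Decomposition"
begin

text \<open>
  Let \<open>R = (A - z)\<^sup>-\<^sup>1\<close> be the resolvent of the normalized matrix \<open>A\<close>, and let \<open>m\<close> be the Stieltjes
  transform of the semicircle law, so that \<open>m (- z - m) = 1\<close>. By the Schur complement formula
  \<open>R\<^sub>i\<^sub>i (A\<^sub>i\<^sub>i - z - Q\<^sub>i) = 1\<close>, where \<open>Q\<^sub>i\<close> is the quadratic form of the resolvent of the \<open>i\<close>-th minor
  at the \<open>i\<close>-th row. That row is independent of the minor, so after truncation at level
  \<open>\<tau>\<close>, at a cost controlled by the Lindeberg condition, \<open>Q\<^sub>i\<close> concentrates around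
  \<open>\<Sum>\<^sub>j s\<^sub>i\<^sub>j R\<^sub>j\<^sub>j\<close> with \<open>s\<^sub>i\<^sub>j\<close> the variances of the truncated entries. Hence
  \<open>R\<^sub>i\<^sub>i - m = R\<^sub>i\<^sub>i m (Q\<^sub>i - m - A\<^sub>i\<^sub>i)\<close> bounds the errors \<open>E \<bar>R\<^sub>i\<^sub>i - m\<bar>\<close> by weighted averages of
  themselves. Row sums of variances are bounded, so for large \<open>Im z\<close> the average over \<open>i\<close> is a
  contraction and the Stieltjes transforms of the mean spectral measures converge there.

  Stieltjes transforms on a half plane \<open>Im z > c\<close> already determine a probability measure: difference
  quotients in \<open>z\<close> give the integrals of \<open>(x - z)\<^sup>-\<^sup>k\<close>, and \<open>(1 + itx/k)\<^sup>-\<^sup>k\<close> tends to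
  \<open>e\<^sup>-\<^sup>i\<^sup>t\<^sup>x\<close>, which recovers the characteristic function. With tightness from second
  moments this gives weak convergence, which is uniform on distribution functions because the
  limit is continuous.
\<close>

section \<open>The Stieltjes transform of the semicircle law\<close>

text \<open>Truncating the whole matrix would force a comparison of two spectra. Here only the row
  that enters a quadratic form is truncated, while every resolvent keeps the original entries: its
  norm is at most \<open>1 / Im z\<close> for any entries, and the minor stays independent of the
  row. The truncation error is then a difference of bilinear forms, controlled by the second moments
  in the Lindeberg sum. The variances need not be close to \<open>1 / n\<close> one by one, so no
  scalar equation for the trace closes. Each diagonal entry is therefore compared with
  \<open>m\<close> separately, and the symmetry of the variance matrix turns the bound on row sums
  into one on column sums when the errors are added up. Returning from the minor to the full
  resolvent costs at most a bound on the truncated variances divided by \<open>Im z\<close>, because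
  the discarded terms are \<open>(R j i)^2 / R i i\<close> and the Ward identity sums them. All
  estimates are explicit in \<tau>, of order \<open>\<tau> + L / \<tau>\<close> with
  \<open>L\<close> the Lindeberg sum, plus the deviation of the row sums from 1; \<tau> is chosen
  from the target accuracy before \<open>n\<close> tends to infinity.\<close>

lemma joukowski_inverse:
  assumes z: "Im z > 0"
  obtains w :: complex where "w \<noteq> 0" "cmod w < 1" "z = - (w + 1 / w)"
proof -
  define w1 where "w1 = (- z + csqrt (z\<^sup>2 - 4)) / 2"
  define w2 where "w2 = (- z - csqrt (z\<^sup>2 - 4)) / 2"
  have prod: "w1 * w2 = 1"
    by (simp add: w1_def w2_def field_simps power2_eq_square[symmetric])
  have sum: "w1 + w2 = - z" by (simp add: w1_def w2_def field_simps)
  have ne: "w1 \<noteq> 0" "w2 \<noteq> 0" using prod by auto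
  have inv: "w2 = 1 / w1" "w1 = 1 / w2" using prod ne by (simp_all add: field_simps)
  \<comment> \<open>On the unit circle the reciprocal is the conjugate, so
    \<open>- z = w1 + w2\<close> would be real.\<close>
  have "cmod w1 \<noteq> 1"
  proof
    assume "cmod w1 = 1"
    then have "w1 * cnj w1 = 1" by (simp add: complex_norm_square[symmetric])
    then have "w2 = cnj w1" using prod ne by (metis mult_left_cancel)
    then have "Im (w1 + w2) = 0" by simp
    with sum z show False by simp
  qed
  moreover have "cmod w1 * cmod w2 = 1" using prod by (metis norm_mult norm_one)
  ultimately have "cmod w1 < 1 \<or> cmod w2 < 1"
    using mult_less_le_imp_less[of 1 "cmod w1" 1 "cmod w2"] by force
  moreover have "z = - (w1 + 1 / w1)" "z = - (w2 + 1 / w2)"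
    using sum inv by (metis add.commute minus_equation_iff)+
  ultimately show thesis using that ne by blast
qed

text \<open>The denominator times \<open>w\<close> factors as \<open>(1 + w e) (1 + w / e)\<close>
  with \<open>e = exp (\<i> t)\<close>, so partial fractions give an explicit antiderivative. As
  \<open>cmod w < 1\<close>, both factors stay in the right half plane, where \<open>Ln\<close> is
  differentiable along the whole path. At \<open>0\<close> and at \<open>pi\<close> the two
  logarithms cancel, and only the linear term contributes.\<close>

lemma integral_cos_kernel:
  assumes w: "w \<noteq> 0" "cmod w < 1"
  shows "((\<lambda>t. 1 / (2 * cos (of_real t) + (w + 1 / w))) has_integral (of_real pi * w / (1 - w\<^sup>2))) {0..pi}"
proof -
  let ?F = "\<lambda>t. (w / (1 - w\<^sup>2)) * (of_real t + \<i> * Ln (1 + w * exp (\<i> * of_real t)) - \<i> * Ln (1 + w * exp (- \<i> * of_real t)))"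
  have w2: "1 - w\<^sup>2 \<noteq> 0"
  proof
    assume "1 - w\<^sup>2 = 0"
    then have "(cmod w)\<^sup>2 = 1" by (metis eq_iff_diff_eq_0 norm_one norm_power)
    moreover have "(cmod w)\<^sup>2 < 1" using w by (simp add: abs_square_less_1)
    ultimately show False by simp
  qed
  have pos: "Re (1 + w * e) > 0" if "cmod e = 1" for e
  proof -
    have "\<bar>Re (w * e)\<bar> \<le> cmod (w * e)" by (rule abs_Re_le_cmod)
    also have "\<dots> < 1" using w that by (simp add: norm_mult)
    finally show ?thesis by simp
  qed
  have e1: "cmod (exp (\<i> * of_real t)) = 1" "cmod (exp (- \<i> * of_real t)) = 1" for t by (simp_all add: norm_exp_eq_Re)
  have np: "1 + w * e \<notin> \<real>\<^sub>\<le>\<^sub>0" if "cmod e = 1" for e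
    using pos[OF that] by (auto simp: complex_nonpos_Reals_iff)
  have I: "((\<lambda>t. 1 / (2 * cos (of_real t) + (w + 1 / w))) has_integral (?F pi - ?F 0)) {0..pi}"
  proof (rule fundamental_theorem_of_calculus)
    fix t :: real assume "t \<in> {0..pi}"
    let ?e = "exp (\<i> * of_real t)" and ?f = "exp (- \<i> * of_real t)"
    have ef: "?e * ?f = 1" by (simp add: exp_minus_inverse exp_minus)
    have n1: "1 + w * ?e \<noteq> 0" "1 + w * ?f \<noteq> 0" using pos[OF e1(1)[of t]] pos[OF e1(2)[of t]] by (metis less_irrefl zero_complex.sel(1))+
    have c: "2 * cos (complex_of_real t) = ?e + ?f" by (simp add: cos_exp_eq)
    have key: "w * (2 * cos (of_real t) + (w + 1 / w)) = (1 + w * ?e) * (1 + w * ?f)"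
    proof -
      have "(1 + w * ?e) * (1 + w * ?f) = 1 + w * (?e + ?f) + w\<^sup>2 * (?e * ?f)"
        by (simp add: algebra_simps power2_eq_square)
      then show ?thesis unfolding ef c using w by (simp add: field_simps power2_eq_square)
    qed
    have D: "((\<lambda>z. (w / (1 - w\<^sup>2)) * (z + \<i> * Ln (1 + w * exp (\<i> * z)) - \<i> * Ln (1 + w * exp (- \<i> * z))))
       has_field_derivative ((w / (1 - w\<^sup>2)) * (1 + \<i> * (w * (?e * \<i>) / (1 + w * ?e)) - \<i> * (w * (?f * (- \<i>)) / (1 + w * ?f))))) (at (of_real t))"
    proof -
      have g: "((\<lambda>z. 1 + w * exp (\<i> * z)) has_field_derivative w * (?e * \<i>)) (at (of_real t))"
        "((\<lambda>z. 1 + w * exp (- \<i> * z)) has_field_derivative w * (?f * (- \<i>))) (at (of_real t))"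
        by (auto intro!: derivative_eq_intros)
      note L = DERIV_chain2[OF has_field_derivative_Ln[OF np[OF e1(1)[of t]]] g(1)]
        DERIV_chain2[OF has_field_derivative_Ln[OF np[OF e1(2)[of t]]] g(2)]
      show ?thesis
        using DERIV_cmult[OF DERIV_diff[OF DERIV_add[OF DERIV_ident DERIV_cmult[OF L(1), of \<i>]] DERIV_cmult[OF L(2), of \<i>]], of "w / (1 - w\<^sup>2)"]
        by (simp only: divide_inverse mult_ac)
    qed
    have "(w / (1 - w\<^sup>2)) * (1 + \<i> * (w * (?e * \<i>) / (1 + w * ?e)) - \<i> * (w * (?f * (- \<i>)) / (1 + w * ?f)))
       = (w / (1 - w\<^sup>2)) * (1 - w * ?e / (1 + w * ?e) - w * ?f / (1 + w * ?f))"
      by (simp add: algebra_simps)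
    also have "1 - w * ?e / (1 + w * ?e) - w * ?f / (1 + w * ?f)
       = (1 - w\<^sup>2 * (?e * ?f)) / ((1 + w * ?e) * (1 + w * ?f))"
      using n1 by (simp add: divide_simps) (simp add: algebra_simps power2_eq_square)
    also have "(w / (1 - w\<^sup>2)) * \<dots> = 1 / (2 * cos (of_real t) + (w + 1 / w))"
      unfolding ef key[symmetric] using w w2 by simp
    finally have eq: "(w / (1 - w\<^sup>2)) * (1 + \<i> * (w * (?e * \<i>) / (1 + w * ?e)) - \<i> * (w * (?f * (- \<i>)) / (1 + w * ?f)))
       = 1 / (2 * cos (of_real t) + (w + 1 / w))" .
    show "(?F has_vector_derivative 1 / (2 * cos (of_real t) + (w + 1 / w))) (at t within {0..pi})"
      using has_vector_derivative_real_field[OF D[unfolded eq]] by simp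
  qed simp
  have eq: "?F pi - ?F 0 = of_real pi * w / (1 - w\<^sup>2)"
  proof -
    have "exp (- (\<i> * complex_of_real pi)) = - 1" by (simp add: exp_minus)
    then show ?thesis by simp
  qed
  show ?thesis by (rule has_integral_eq_rhs[OF I eq[symmetric]])
qed

text \<open>Polynomial division in \<open>c = 2 cos t\<close> gives
  \<open>(4 - c^2) / (c - z) = (4 - z^2) / (c - z) - (c + z)\<close>, which leaves the kernel
  already integrated. In the parameter \<open>w\<close>, the factor \<open>4 - z^2\<close> is minus
  the square of \<open>(1 - w^2) / w\<close> and cancels the denominator.\<close>

lemma integral_sin_squared_kernel:
  assumes z: "z = - (w + 1 / w)" and w: "w \<noteq> 0" "cmod w < 1"
  shows "((\<lambda>t. 4 * (sin (of_real t))\<^sup>2 / (2 * cos (of_real t) - z)) has_integral (2 * of_real pi * w)) {0..pi}"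
proof -
  have w2: "1 - w\<^sup>2 \<noteq> 0"
  proof
    assume "1 - w\<^sup>2 = 0"
    then have "(cmod w)\<^sup>2 = 1" by (metis eq_iff_diff_eq_0 norm_one norm_power)
    moreover have "(cmod w)\<^sup>2 < 1" using w by (simp add: abs_square_less_1)
    ultimately show False by simp
  qed
  have K: "((\<lambda>t. 1 / (2 * cos (of_real t) - z)) has_integral (of_real pi * w / (1 - w\<^sup>2))) {0..pi}"
  proof -
    have "2 * cos (complex_of_real t) + (w + 1 / w) = 2 * cos (of_real t) - z" for t
      by (simp add: z)
    with integral_cos_kernel[OF w] show ?thesis by (simp only:)
  qed
  have S: "((\<lambda>t. 2 * cos (complex_of_real t) + z) has_integral (z * of_real pi)) {0..pi}"
  proof -
    have "((\<lambda>t. 2 * cos (complex_of_real t) + z) has_integral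
        ((2 * sin (complex_of_real pi) + z * of_real pi) - (2 * sin (complex_of_real 0) + z * of_real 0))) {0..pi}"
    proof (rule fundamental_theorem_of_calculus)
      fix t :: real
      have "((\<lambda>u. 2 * sin u + z * u) has_field_derivative 2 * cos (of_real t) + z) (at (of_real t))"
        by (auto intro!: derivative_eq_intros)
      from has_vector_derivative_real_field[OF this]
      show "((\<lambda>t. 2 * sin (complex_of_real t) + z * of_real t) has_vector_derivative 2 * cos (of_real t) + z) (at t within {0..pi})"
        by simp
    qed simp
    then show ?thesis by (simp flip: sin_of_real cos_of_real)
  qed
  have ne: "2 * cos (complex_of_real t) - z \<noteq> 0" for t
  proof
    let ?e = "exp (\<i> * of_real t)" and ?f = "exp (- \<i> * of_real t)"
    assume "2 * cos (complex_of_real t) - z = 0"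
    moreover have "2 * cos (complex_of_real t) = ?e + ?f" by (simp add: cos_exp_eq)
    ultimately have "w * (?e + ?f + w + 1 / w) = 0" by (simp add: z algebra_simps)
    moreover have "?e * ?f = 1" by (simp add: exp_minus_inverse exp_minus)
    moreover have "(1 + w * ?e) * (1 + w * ?f) = w * (?e + ?f + w + 1 / w) + w\<^sup>2 * (?e * ?f - 1)"
      using w by (simp add: field_simps power2_eq_square)
    ultimately have "(1 + w * ?e) * (1 + w * ?f) = 0" by simp
    moreover have "cmod (w * ?e) < 1" "cmod (w * ?f) < 1" using w by (simp_all add: norm_mult norm_exp_eq_Re)
    moreover have "1 + x \<noteq> 0" if "cmod x < 1" for x :: complex
      using that by (metis add.inverse_inverse add_eq_0_iff less_irrefl norm_minus_cancel norm_one)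
    ultimately show False by auto
  qed
  have "((\<lambda>t. (4 - z\<^sup>2) * (1 / (2 * cos (of_real t) - z)) - (2 * cos (complex_of_real t) + z)) has_integral
      ((4 - z\<^sup>2) * (of_real pi * w / (1 - w\<^sup>2)) - z * of_real pi)) {0..pi}"
    by (intro has_integral_diff has_integral_mult_right K S)
  moreover have "(4 - z\<^sup>2) * (1 / (2 * cos (of_real t) - z)) - (2 * cos (complex_of_real t) + z)
      = 4 * (sin (of_real t))\<^sup>2 / (2 * cos (of_real t) - z)" for t
  proof -
    have s: "4 * (sin (complex_of_real t))\<^sup>2 = 4 - (2 * cos (of_real t))\<^sup>2"
      by (simp add: sin_squared_eq power_mult_distrib)
    show ?thesis unfolding s using ne[of t] by (simp add: field_simps power2_eq_square)
  qed
  moreover have "(4 - z\<^sup>2) * (of_real pi * w / (1 - w\<^sup>2)) - z * of_real pi = 2 * of_real pi * w"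
  proof -
    have "(4 - z\<^sup>2) = - ((1 - w\<^sup>2)\<^sup>2 / w\<^sup>2)"
      using w unfolding z by (simp add: field_simps power2_eq_square)
    moreover have "- (d\<^sup>2 / w\<^sup>2) * (p * w / d) = - (p * d / w)" if "d \<noteq> 0" for d p
      using that w(1) by (simp add: power2_eq_square)
    ultimately have "(4 - z\<^sup>2) * (of_real pi * w / (1 - w\<^sup>2)) = - (of_real pi * (1 - w\<^sup>2) / w)"
      using w2 by presburger
    then show ?thesis using w unfolding z by (simp add: field_simps power2_eq_square)
  qed
  ultimately show ?thesis by simp
qed

text \<open>The substitution \<open>x = 2 cos t\<close> removes the square root, because
  \<open>sin\<close> is nonnegative on \<open>{0..pi}\<close>. Values in a Euclidean space are
  allowed since the total mass is a real integral and the Stieltjes transform a complex one.\<close>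

lemma semicircle_substitution:
  fixes f :: "real \<Rightarrow> 'b::euclidean_space"
  assumes f: "continuous_on {-2..2} f"
    and I: "((\<lambda>t. (4 * (sin t)\<^sup>2 / (2 * pi)) *\<^sub>R f (2 * cos t)) has_integral I) {0..pi}"
  shows "integrable lborel (\<lambda>x. semicircle_density x *\<^sub>R f x)" (is ?A)
    and "(LINT x|lborel. semicircle_density x *\<^sub>R f x) = I" (is ?B)
proof -
  let ?h = "\<lambda>x. (1 / (2 * pi) * sqrt (4 - x\<^sup>2)) *\<^sub>R f x"
  have cont: "continuous_on {-2..2} ?h" by (intro continuous_intros f)
  have eq: "semicircle_density x *\<^sub>R f x = indicator {-2..2} x *\<^sub>R ?h x" for x
    by (auto simp: semicircle_density_def indicator_def)
  have int: "set_integrable lborel {-2..2} ?h" by (rule borel_integrable_atLeastAtMost'[OF cont])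
  then show ?A unfolding set_integrable_def eq[symmetric] .
  have "((\<lambda>t. (- 2 * sin t) *\<^sub>R ?h (2 * cos t)) has_integral
      (integral {2 * cos 0..2 * cos pi} ?h - integral {2 * cos pi..2 * cos 0} ?h)) {0..pi}"
  proof (rule has_integral_substitution_general[of "{}" 0 pi "\<lambda>t. 2 * cos t" "-2" 2 ?h "\<lambda>t. - 2 * sin t"])
    show "(\<lambda>t. 2 * cos t) ` {0..pi} \<subseteq> {- 2..2}"
    proof (rule image_subsetI)
      fix t :: real show "2 * cos t \<in> {-2..2}" using cos_ge_minus_one[of t] cos_le_one[of t] by simp
    qed
  qed (auto intro!: f continuous_intros derivative_eq_intros)
  then have "((\<lambda>t. - ((- 2 * sin t) *\<^sub>R ?h (2 * cos t))) has_integral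
      - (integral {2 * cos 0..2 * cos pi} ?h - integral {2 * cos pi..2 * cos 0} ?h)) {0..pi}"
    by (rule has_integral_neg)
  \<comment> \<open>Since \<open>cos\<close> decreases from \<open>0\<close> to \<open>pi\<close>,
    the first interval is empty and the sign turns the second integral into the one over
    \<open>{-2..2}\<close>.\<close>
  moreover have "- (integral {2 * cos 0..2 * cos pi} ?h - integral {2 * cos pi..2 * cos 0} ?h) = integral {-2..2} ?h"
    by simp
  ultimately have 1: "((\<lambda>t. - ((- 2 * sin t) *\<^sub>R ?h (2 * cos t))) has_integral integral {-2..2} ?h) {0..pi}"
    by simp
  have "- ((- 2 * sin t) *\<^sub>R ?h (2 * cos t)) = (4 * (sin t)\<^sup>2 / (2 * pi)) *\<^sub>R f (2 * cos t)"
    if "t \<in> {0..pi}" for t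
  proof -
    have "sin t \<ge> 0" using that by (auto intro: sin_ge_zero)
    have "4 - (2 * cos t)\<^sup>2 = (2 * sin t)\<^sup>2" by (simp add: power_mult_distrib cos_squared_eq)
    then have "sqrt (4 - (2 * cos t)\<^sup>2) = \<bar>2 * sin t\<bar>" by (simp only: real_sqrt_abs)
    then have "sqrt (4 - (2 * cos t)\<^sup>2) = 2 * sin t" using \<open>sin t \<ge> 0\<close> by simp
    then show ?thesis by (simp add: power2_eq_square)
  qed
  with 1 have "((\<lambda>t. (4 * (sin t)\<^sup>2 / (2 * pi)) *\<^sub>R f (2 * cos t)) has_integral integral {-2..2} ?h) {0..pi}"
    by (rule has_integral_eq[rotated])
  with I have "integral {-2..2} ?h = I" by (rule has_integral_unique[rotated])
  moreover have "(LINT x|lborel. semicircle_density x *\<^sub>R f x) = integral {-2..2} ?h"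
    using set_borel_integral_eq_integral(2)[OF int] unfolding set_lebesgue_integral_def eq by simp
  ultimately show ?B by simp
qed

section \<open>The semicircle law as a probability measure\<close>

definition semicircle_measure :: "real measure" where
  "semicircle_measure = density lborel (\<lambda>x. ennreal (semicircle_density x))"

lemma semicircle_density_nonneg: "semicircle_density x \<ge> 0"
  by (auto simp: semicircle_density_def abs_le_square_iff[of x 2, simplified] )

lemma measurable_semicircle_density [measurable]: "semicircle_density \<in> borel_measurable borel"
  unfolding semicircle_density_def by measurable

lemma semicircle_density_integral:
  "integrable lborel semicircle_density" "(LINT x|lborel. semicircle_density x) = 1"
proof -
  have "((\<lambda>t. 4 * (sin t)\<^sup>2 / (2 * pi)) has_integral
     ((pi - sin pi * cos pi) / pi - (0 - sin 0 * cos 0) / pi)) {0..pi}"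
  proof (rule fundamental_theorem_of_calculus)
    fix t :: real
    have "((\<lambda>t. (t - sin t * cos t) / pi) has_field_derivative 4 * (sin t)\<^sup>2 / (2 * pi)) (at t within {0..pi})"
      by (auto intro!: derivative_eq_intros simp: cos_squared_eq power2_eq_square field_simps)
         (simp add: cos_squared_eq[unfolded power2_eq_square] algebra_simps)
    then show "((\<lambda>t. (t - sin t * cos t) / pi) has_vector_derivative 4 * (sin t)\<^sup>2 / (2 * pi)) (at t within {0..pi})"
      by (simp add: has_real_derivative_iff_has_vector_derivative)
  qed simp
  then have "((\<lambda>t. (4 * (sin t)\<^sup>2 / (2 * pi)) *\<^sub>R (1::real)) has_integral 1) {0..pi}" by simp
  from semicircle_substitution[OF _ this]
  show "integrable lborel semicircle_density" "(LINT x|lborel. semicircle_density x) = 1"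
    by simp_all
qed

lemma real_distribution_semicircle: "real_distribution semicircle_measure"
proof -
  have "emeasure semicircle_measure UNIV = (\<integral>\<^sup>+x. ennreal (semicircle_density x) \<partial>lborel)"
    by (simp add: semicircle_measure_def emeasure_density)
  also have "\<dots> = 1"
    using nn_integral_eq_integral[OF semicircle_density_integral(1)] semicircle_density_integral(2)
    by (simp add: semicircle_density_nonneg)
  finally have "prob_space semicircle_measure"
    by (intro prob_spaceI) (simp add: semicircle_measure_def)
  then show ?thesis
    by (auto simp: real_distribution_def real_distribution_axioms_def semicircle_measure_def)
qed

lemma cdf_semicircle: "cdf semicircle_measure = semicircle_cdf"
proof
  fix x
  have int: "integrable lborel (\<lambda>u. indicator {..x} u *\<^sub>R semicircle_density u)"
    by (rule integrable_mult_indicator[OF _ semicircle_density_integral(1)]) simp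
  have "emeasure semicircle_measure {..x} = (\<integral>\<^sup>+u. ennreal (indicator {..x} u *\<^sub>R semicircle_density u) \<partial>lborel)"
    by (simp add: semicircle_measure_def emeasure_density)
       (intro nn_integral_cong, auto simp: indicator_def)
  also have "\<dots> = ennreal (semicircle_cdf x)"
    unfolding semicircle_cdf_def set_lebesgue_integral_def
    by (rule nn_integral_eq_integral[OF int]) (auto simp: semicircle_density_nonneg)
  finally show "cdf semicircle_measure x = semicircle_cdf x"
    unfolding cdf_def measure_def
    by (simp add: semicircle_cdf_def set_lebesgue_integral_def integral_nonneg_AE semicircle_density_nonneg)
qed

text \<open>The transform equals the Joukowski parameter \<open>w\<close> of \<open>z\<close> inside
  the unit disc, and the claim is the relation \<open>w + 1 / w = - z\<close> in disguise.\<close>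

lemma stieltjes_semicircle:
  assumes z: "Im z > 0"
  defines "m \<equiv> (LINT x|semicircle_measure. 1 / (of_real x - z))"
  shows "m * (- z - m) = 1"
proof -
  obtain w where w: "w \<noteq> 0" "cmod w < 1" "z = - (w + 1 / w)" using joukowski_inverse[OF z] by blast
  have ne: "complex_of_real x - z \<noteq> 0" for x using z by (auto simp: complex_eq_iff)
  have "((\<lambda>t. (1 / (2 * of_real pi)) * (4 * (sin (of_real t))\<^sup>2 / (2 * cos (of_real t) - z))) has_integral
      ((1 / (2 * of_real pi)) * (2 * of_real pi * w))) {0..pi}"
    by (intro has_integral_mult_right integral_sin_squared_kernel w)
  then have I: "((\<lambda>t. (4 * (sin t)\<^sup>2 / (2 * pi)) *\<^sub>R (1 / (of_real (2 * cos t) - z))) has_integral w) {0..pi}"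
    by (simp add: scaleR_conv_of_real sin_of_real cos_of_real)
  have "m = (LINT x|lborel. semicircle_density x *\<^sub>R (1 / (of_real x - z)))"
    unfolding m_def semicircle_measure_def
    by (subst integral_density) (auto simp: semicircle_density_nonneg)
  also have "\<dots> = w"
    by (rule semicircle_substitution(2)[OF _ I]) (intro continuous_intros ballI ne)
  finally have "m = w" .
  moreover have "- z - w = 1 / w" by (subst w(3)) simp
  ultimately show ?thesis using w(1) by simp
qed

section \<open>Stieltjes transforms and weak convergence\<close>

text \<open>The logarithm of the left side is \<open>w\<close> times a difference quotient of
  \<open>Ln\<close> at 1, whose limit is the derivative 1. For small \<open>n\<close> the base may
  vanish, so the passage through \<open>Ln\<close> is valid only eventually.\<close>

lemma tendsto_complex_exp_limit:
  fixes w :: complex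
  shows "(\<lambda>n. (1 + w / of_nat (Suc n)) ^ Suc n) \<longlonglongrightarrow> exp w"
proof (cases "w = 0")
  case False
  have h: "(\<lambda>n. w / of_nat (Suc n)) \<longlonglongrightarrow> 0"
    using tendsto_mult_right[OF LIMSEQ_Suc[OF lim_inverse_n], of w] by (simp add: divide_inverse mult.commute)
  have "((\<lambda>h. (Ln (1 + h) - Ln 1) / h) \<longlongrightarrow> 1) (at (0::complex))"
    using has_field_derivative_Ln[of 1] by (simp add: DERIV_def)
  then have "(\<lambda>n. (Ln (1 + w / of_nat (Suc n)) - Ln 1) / (w / of_nat (Suc n))) \<longlonglongrightarrow> 1"
    unfolding tendsto_at_iff_sequentially using h False
    by (auto simp: o_def simp del: of_nat_Suc dest!: spec[of _ "\<lambda>n. w / of_nat (Suc n)"])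
  then have "(\<lambda>n. w * ((Ln (1 + w / of_nat (Suc n)) - Ln 1) / (w / of_nat (Suc n)))) \<longlonglongrightarrow> w * 1"
    by (intro tendsto_intros)
  then have "(\<lambda>n. of_nat (Suc n) * Ln (1 + w / of_nat (Suc n))) \<longlonglongrightarrow> w"
    using False by (simp add: mult.commute del: of_nat_Suc)
  then have "(\<lambda>n. exp (of_nat (Suc n) * Ln (1 + w / of_nat (Suc n)))) \<longlonglongrightarrow> exp w"
    by (rule tendsto_exp)
  moreover have "\<forall>\<^sub>F n in sequentially. exp (of_nat (Suc n) * Ln (1 + w / of_nat (Suc n))) = (1 + w / of_nat (Suc n)) ^ Suc n"
  proof -
    have "\<forall>\<^sub>F n in sequentially. cmod (w / of_nat (Suc n)) < 1"
      using order_tendstoD(2)[OF tendsto_norm[OF h], of 1] by simp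
    then show ?thesis
    proof eventually_elim
      case (elim n)
      have ne: "1 + w / of_nat (Suc n) \<noteq> 0"
        using elim by (metis add.inverse_inverse add_eq_0_iff less_irrefl norm_minus_cancel norm_one)
      show ?case unfolding exp_of_nat_mult exp_Ln[OF ne] ..
    qed
  qed
  ultimately show ?thesis by (rule Lim_transform_eventually)
qed simp

lemma cauchy_kernel_bound:
  assumes "Im z > 0"
  shows "cmod (1 / (of_real x - z)) \<le> 1 / Im z" "of_real x - z \<noteq> 0"
proof -
  have "Im z \<le> \<bar>Im (of_real x - z)\<bar>" by simp
  also have "\<dots> \<le> cmod (of_real x - z)" by (rule abs_Im_le_cmod)
  finally show "cmod (1 / (of_real x - z)) \<le> 1 / Im z"
    using assms by (simp add: norm_divide frac_le)
  show "of_real x - z \<noteq> 0" using assms by (auto simp: complex_eq_iff)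
qed

text \<open>The increments \<open>h n\<close> are real, so \<open>z + h n\<close> keeps its
  imaginary part: it stays where the transforms agree, and all kernels share the bound
  \<open>1 / Im z\<close>. Because \<open>a - b = h * a * b\<close>, the difference quotient of the
  powers is the finite sum \<open>q\<close>, which is bounded uniformly in \<open>n\<close> and
  \<open>x\<close>; dominated convergence then does the work of differentiating under the
  integral.\<close>

lemma stieltjes_powers_determined:
  assumes "prob_space \<mu>" "prob_space \<nu>" and sets: "sets \<mu> = sets borel" "sets \<nu> = sets borel"
    and c: "c > 0"
    and eq: "\<And>z. Im z > c \<Longrightarrow> (LINT x|\<mu>. 1 / (of_real x - z)) = (LINT x|\<nu>. 1 / (of_real x - z))"
    and z: "Im z > c"
  shows "(LINT x|\<mu>. (1 / (of_real x - z)) ^ Suc k) = (LINT x|\<nu>. (1 / (of_real x - z)) ^ Suc k)"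
  using z
proof (induction k arbitrary: z)
  case 0
  then show ?case using eq by simp
next
  case (Suc k)
  define h where "h n = inverse (real (Suc n))" for n
  define a where "a n x = 1 / (complex_of_real x - (z + of_real (h n)))" for n x
  define b where "b x = 1 / (complex_of_real x - z)" for x
  define q where "q n x = a n x * b x * (\<Sum>i<Suc k. b x ^ (Suc k - Suc i) * a n x ^ i)" for n x
  have h0: "h n \<noteq> 0" for n by (simp add: h_def)
  have hlim: "h \<longlonglongrightarrow> 0" unfolding h_def by (rule LIMSEQ_inverse_real_of_nat)
  have zp: "Im z > 0" "\<And>n. Im (z + of_real (h n)) = Im z" using Suc.prems c by auto
  have ne: "complex_of_real x - z \<noteq> 0" "complex_of_real x - (z + of_real (h n)) \<noteq> 0" for n x
    using cauchy_kernel_bound(2)[of z x] cauchy_kernel_bound(2)[of "z + of_real (h n)" x] zp by auto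
  have bd: "cmod (a n x) \<le> 1 / Im z" "cmod (b x) \<le> 1 / Im z" for n x
    using cauchy_kernel_bound(1)[of z x] cauchy_kernel_bound(1)[of "z + of_real (h n)" x] zp
    by (auto simp: a_def b_def)
  have q: "q n x = (a n x ^ Suc k - b x ^ Suc k) / of_real (h n)" for n x
  proof -
    have "a n x - b x = of_real (h n) * (a n x * b x)"
      using ne by (simp add: a_def b_def field_simps)
    then show ?thesis
      unfolding q_def power_diff_sumr2[of "a n x" "Suc k" "b x"] using h0 by simp
  qed
  have qbd: "cmod (q n x) \<le> (1 / Im z) * (1 / Im z) * (real (Suc k) * (1 / Im z) ^ k)" for n x
  proof -
    have "cmod (\<Sum>i<Suc k. b x ^ (Suc k - Suc i) * a n x ^ i) \<le> (\<Sum>i<Suc k. (1 / Im z) ^ k)"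
    proof (rule order.trans[OF norm_sum sum_mono])
      fix i assume "i \<in> {..<Suc k}"
      then have "(1 / Im z) ^ k = (1 / Im z) ^ (Suc k - Suc i) * (1 / Im z) ^ i"
        by (simp add: power_add[symmetric])
      then show "cmod (b x ^ (Suc k - Suc i) * a n x ^ i) \<le> (1 / Im z) ^ k"
        using zp by (simp only: norm_mult norm_power) (intro mult_mono power_mono bd, auto)
    qed
    then show ?thesis
      using zp unfolding q_def norm_mult by (intro mult_mono bd) (auto intro!: mult_nonneg_nonneg)
  qed
  have qlim: "(\<lambda>n. q n x) \<longlonglongrightarrow> of_nat (Suc k) * b x ^ Suc (Suc k)" for x
  proof -
    have "(\<lambda>n. a n x) \<longlonglongrightarrow> 1 / (complex_of_real x - (z + of_real 0))"
      unfolding a_def using ne[of x] by (intro tendsto_intros hlim) auto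
    then have "(\<lambda>n. a n x) \<longlonglongrightarrow> b x" by (simp add: b_def)
    then have "(\<lambda>n. q n x) \<longlonglongrightarrow> b x * b x * (\<Sum>i<Suc k. b x ^ (Suc k - Suc i) * b x ^ i)"
      unfolding q_def by (intro tendsto_intros)
    also have "(\<Sum>i<Suc k. b x ^ (Suc k - Suc i) * b x ^ i) = (\<Sum>i<Suc k. b x ^ k)"
      by (intro sum.cong) (auto simp: power_add[symmetric])
    finally show ?thesis by (simp add: mult_ac)
  qed
  have main: "(\<lambda>n. ((LINT x|\<rho>. a n x ^ Suc k) - (LINT x|\<rho>. b x ^ Suc k)) / of_real (h n))
      \<longlonglongrightarrow> of_nat (Suc k) * (LINT x|\<rho>. b x ^ Suc (Suc k))"
    if P: "prob_space \<rho>" and S[measurable_cong]: "sets \<rho> = sets borel" for \<rho> :: "real measure"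
  proof -
    interpret P: prob_space \<rho> by fact
    have [measurable]: "b \<in> borel_measurable \<rho>" "\<And>n. a n \<in> borel_measurable \<rho>"
      unfolding a_def b_def by measurable
    have int: "integrable \<rho> (\<lambda>x. a n x ^ Suc k)" "integrable \<rho> (\<lambda>x. b x ^ Suc k)" for n
    proof -
      have pb: "cmod (a n x ^ Suc k) \<le> (1 / Im z) ^ Suc k" "cmod (b x ^ Suc k) \<le> (1 / Im z) ^ Suc k" for n x
        unfolding norm_power by (rule power_mono[OF bd(1) norm_ge_zero], rule power_mono[OF bd(2) norm_ge_zero])
      show "integrable \<rho> (\<lambda>x. a n x ^ Suc k)" for n
        by (rule P.integrable_const_bound[OF AE_I2[OF pb(1)]]) measurable
      show "integrable \<rho> (\<lambda>x. b x ^ Suc k)"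
        by (rule P.integrable_const_bound[OF AE_I2[OF pb(2)]]) measurable
    qed
    have "(\<lambda>n. LINT x|\<rho>. q n x) \<longlonglongrightarrow> (LINT x|\<rho>. of_nat (Suc k) * b x ^ Suc (Suc k))"
      by (rule integral_dominated_convergence[where w="\<lambda>_. (1 / Im z) * (1 / Im z) * (real (Suc k) * (1 / Im z) ^ k)"])
         (use qlim qbd in \<open>auto simp: q_def simp del: power_Suc of_nat_Suc\<close>)
    moreover have "(LINT x|\<rho>. q n x) = ((LINT x|\<rho>. a n x ^ Suc k) - (LINT x|\<rho>. b x ^ Suc k)) / of_real (h n)" for n
      unfolding q using int by (simp del: power_Suc)
    ultimately show ?thesis by (simp del: power_Suc of_nat_Suc)
  qed
  have "(LINT x|\<mu>. a n x ^ Suc k) = (LINT x|\<nu>. a n x ^ Suc k)" "(LINT x|\<mu>. b x ^ Suc k) = (LINT x|\<nu>. b x ^ Suc k)" for n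
    using Suc.IH[of "z + of_real (h n)"] Suc.IH[of z] Suc.prems zp(2) by (simp_all add: a_def b_def del: power_Suc)
  with main[OF assms(1) sets(1)] main[OF assms(2) sets(2)]
  have "of_nat (Suc k) * (LINT x|\<mu>. b x ^ Suc (Suc k)) = of_nat (Suc k) * (LINT x|\<nu>. b x ^ Suc (Suc k))"
    by (intro LIMSEQ_unique) auto
  then show ?case unfolding b_def by (simp del: power_Suc of_nat_Suc)
qed

lemma stieltjes_unique:
  assumes \<mu>: "real_distribution \<mu>" and \<nu>: "real_distribution \<nu>" and c: "c > 0"
    and eq: "\<And>z. Im z > c \<Longrightarrow> (LINT x|\<mu>. 1 / (of_real x - z)) = (LINT x|\<nu>. 1 / (of_real x - z))"
  shows "\<mu> = \<nu>"
proof (rule Levy_uniqueness[OF \<mu> \<nu>])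
  interpret \<mu>: real_distribution \<mu> by fact
  interpret \<nu>: real_distribution \<nu> by fact
  \<comment> \<open>For positive \<open>t\<close> the pole \<open>\<i> * k / t\<close> of
    \<open>1 / (1 + \<i> * t * x / k)\<close> lies in the upper half plane, at a height that
    eventually exceeds \<open>c\<close>. The other sign would put it below the real axis, so that
    case is recovered by conjugation.\<close>
  have neg: "char \<mu> (- t) = char \<nu> (- t)" if t: "t > 0" for t
  proof -
    define f where "f n x = (1 / (1 + (\<i> * of_real t * of_real x) / of_nat (Suc n))) ^ Suc n" for n x
    have "Re (1 + (\<i> * of_real t * of_real x) / of_nat (Suc n)) = 1" for x n
      by (simp del: of_nat_Suc)
    then have ge1: "cmod (1 + (\<i> * of_real t * of_real x) / of_nat (Suc n)) \<ge> 1" for x n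
      using complex_Re_le_cmod by metis
    have fbd: "cmod (f n x) \<le> 1" for n x
      unfolding f_def norm_power norm_divide using ge1[of x n]
      by (intro power_le_one) (auto simp: divide_le_eq_1 simp del: of_nat_Suc)
    have flim: "(\<lambda>n. f n x) \<longlonglongrightarrow> exp (\<i> * of_real (- t * x))" for x
    proof -
      have "(\<lambda>n. 1 / (1 + (\<i> * of_real t * of_real x) / of_nat (Suc n)) ^ Suc n) \<longlonglongrightarrow> 1 / exp (\<i> * of_real t * of_real x)"
        by (intro tendsto_intros tendsto_complex_exp_limit) auto
      then show ?thesis by (simp add: f_def power_divide exp_minus divide_inverse power_inverse mult.assoc del: power_Suc of_nat_Suc)
    qed
    have conv: "(\<lambda>n. LINT x|\<rho>. f n x) \<longlonglongrightarrow> char \<rho> (- t)" if "real_distribution \<rho>" for \<rho>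
    proof -
      interpret L: real_distribution \<rho> by fact
      have [measurable]: "f n \<in> borel_measurable borel" for n unfolding f_def by measurable
      have "(\<lambda>n. LINT x|\<rho>. f n x) \<longlonglongrightarrow> (LINT x|\<rho>. exp (\<i> * of_real (- t * x)))"
        by (rule integral_dominated_convergence[where w="\<lambda>_. 1"]) (use flim fbd in \<open>auto\<close>)
      then show ?thesis by (simp add: char_def)
    qed
    have "\<forall>\<^sub>F n in sequentially. (LINT x|\<mu>. f n x) = (LINT x|\<nu>. f n x)"
    proof -
      obtain N where N: "c * t < real N" using reals_Archimedean2 by blast
      show ?thesis
      proof (rule eventually_sequentiallyI[of N])
        fix n assume "N \<le> n"
        then have n: "c < real (Suc n) / t" using N t by (simp add: field_simps)
        let ?z = "\<i> * of_real (real (Suc n) / t)"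
        have f: "f n x = (of_nat (Suc n) / (\<i> * of_real t)) ^ Suc n * (1 / (of_real x - ?z)) ^ Suc n" for x
        proof -
          have "Im ?z > 0" using t by simp
          from cauchy_kernel_bound(2)[OF this, of x]
          have "1 + (\<i> * of_real t * of_real x) / of_nat (Suc n) = (of_real x - ?z) * (\<i> * of_real t / of_nat (Suc n))"
            using t by (simp add: field_simps del: of_nat_Suc)
          then have "1 / (1 + (\<i> * of_real t * of_real x) / of_nat (Suc n)) = of_nat (Suc n) / (\<i> * of_real t) * (1 / (of_real x - ?z))"
            by (simp add: divide_simps mult_ac del: of_nat_Suc)
          then show ?thesis
            unfolding f_def power_mult_distrib[symmetric] by (simp only:)
        qed
        have "(LINT x|\<mu>. (1 / (of_real x - ?z)) ^ Suc n) = (LINT x|\<nu>. (1 / (of_real x - ?z)) ^ Suc n)"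
          by (rule stieltjes_powers_determined[OF _ _ _ _ c eq]) (use n in \<open>auto intro: \<mu>.prob_space_axioms \<nu>.prob_space_axioms\<close>)
        then show "(LINT x|\<mu>. f n x) = (LINT x|\<nu>. f n x)"
          unfolding f integral_mult_right_zero by (simp only:)
      qed
    qed
    then have "\<forall>\<^sub>F n in sequentially. (LINT x|\<nu>. f n x) = (LINT x|\<mu>. f n x)"
      by (rule eventually_mono) simp
    then have "(\<lambda>n. LINT x|\<mu>. f n x) \<longlonglongrightarrow> char \<nu> (- t)"
      by (rule Lim_transform_eventually[OF conv[OF \<nu>]])
    then show ?thesis by (rule LIMSEQ_unique[OF conv[OF \<mu>]])
  qed
  have cnj: "char \<rho> t = cnj (char \<rho> (- t))" for \<rho> :: "real measure" and t
  proof -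
    have "cnj (char \<rho> (- t)) = (LINT x|\<rho>. cnj (iexp (- t * x)))"
      unfolding char_def by (rule Bochner_Integration.integral_cnj[symmetric])
    then show ?thesis by (simp add: char_def exp_cnj)
  qed
  show "char \<mu> = char \<nu>"
  proof
    fix t :: real
    consider "t < 0" | "t = 0" | "t > 0" by linarith
    then show "char \<mu> t = char \<nu> t"
      using neg[of t] neg[of "- t"] cnj[of \<mu> t] cnj[of \<nu> t] \<mu>.char_zero \<nu>.char_zero by cases auto
  qed
qed

section \<open>Tightness, the convergence criterion and uniform convergence\<close>

lemma tight_of_second_moment:
  assumes \<mu>: "\<And>n. real_distribution (\<mu> n)"
    and int: "\<And>n. integrable (\<mu> n) (\<lambda>x. x\<^sup>2)" and C: "\<And>n. (LINT x|\<mu> n. x\<^sup>2) \<le> C"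
  shows "tight \<mu>"
  unfolding tight_def
proof (intro conjI allI impI \<mu>)
  fix \<epsilon> :: real assume e: "\<epsilon> > 0"
  \<comment> \<open>Chosen for the Markov bound \<open>\<bar>C\<bar> / T^2 < \<epsilon>\<close>; the
    added 1 makes it strict and keeps \<open>T\<close> positive even for
    \<open>C = 0\<close>.\<close>
  define T where "T = sqrt ((\<bar>C\<bar> + 1) / \<epsilon>)"
  have T: "T > 0" "T\<^sup>2 = (\<bar>C\<bar> + 1) / \<epsilon>" using e by (auto simp: T_def)
  show "\<exists>a b. a < b \<and> (\<forall>n. measure (\<mu> n) {a<..b} > 1 - \<epsilon>)"
  proof (rule exI[of _ "- T"], rule exI[of _ T], intro conjI allI)
    fix n
    interpret real_distribution "\<mu> n" by (rule \<mu>)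
    have sub: "T\<^sup>2 \<le> x\<^sup>2" if "x \<notin> {-T<..T}" for x
      using that T(1) abs_le_square_iff[of T x] by auto
    have "measure (\<mu> n) (UNIV - {-T<..T}) \<le> measure (\<mu> n) {x \<in> space (\<mu> n). x\<^sup>2 \<ge> T\<^sup>2}"
      using sub by (intro finite_measure_mono) auto
    also have "\<dots> \<le> (LINT x|\<mu> n. x\<^sup>2) / T\<^sup>2"
      using T(1) by (intro integral_Markov_inequality_measure[where A="{}"] int) auto
    also have "\<dots> \<le> \<bar>C\<bar> / T\<^sup>2" using C[of n] T(1) by (intro divide_right_mono) auto
    also have "\<dots> < \<epsilon>" using e unfolding T(2) by (simp add: field_simps)
    finally show "measure (\<mu> n) {- T<..T} > 1 - \<epsilon>"
      using prob_compl[of "{-T<..T}"] by simp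
  qed (use T in auto)
qed

text \<open>Tightness reduces the claim to subsequential weak limits. The kernel is bounded and
  continuous, so each such limit has the transform of \<open>\<nu>\<close> on the half plane and is
  therefore \<open>\<nu>\<close>.\<close>

lemma stieltjes_criterion:
  assumes \<mu>: "\<And>n. real_distribution (\<mu> n)" and \<nu>: "real_distribution \<nu>"
    and int: "\<And>n. integrable (\<mu> n) (\<lambda>x. x\<^sup>2)" and C: "\<And>n. (LINT x|\<mu> n. x\<^sup>2) \<le> C"
    and c: "c > 0"
    and lim: "\<And>z. Im z > c \<Longrightarrow> (\<lambda>n. LINT x|\<mu> n. 1 / (of_real x - z)) \<longlonglongrightarrow> (LINT x|\<nu>. 1 / (of_real x - z))"
  shows "weak_conv_m \<mu> \<nu>"
proof (rule tight_subseq_weak_converge[OF \<mu> \<nu> tight_of_second_moment[OF \<mu> int C]])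
  fix s :: "nat \<Rightarrow> nat" and \<rho>
  assume s: "strict_mono s" and \<rho>: "real_distribution \<rho>" and conv: "weak_conv_m (\<mu> \<circ> s) \<rho>"
  have "\<rho> = \<nu>"
  proof (rule stieltjes_unique[OF \<rho> \<nu> c])
    fix z assume z: "Im z > c"
    have "(\<lambda>n. LINT x|(\<mu> \<circ> s) n. 1 / (of_real x - z)) \<longlonglongrightarrow> (LINT x|\<rho>. 1 / (of_real x - z))"
      using cauchy_kernel_bound[of z] z c
      by (intro weak_conv_imp_integral_bdd_continuous_conv[OF _ \<rho> conv, of _ "1 / Im z"])
         (auto intro!: \<mu> continuous_intros)
    moreover have "(\<lambda>n. LINT x|(\<mu> \<circ> s) n. 1 / (of_real x - z)) \<longlonglongrightarrow> (LINT x|\<nu>. 1 / (of_real x - z))"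
      using LIMSEQ_subseq_LIMSEQ[OF lim[OF z] s] by (simp add: o_def)
    ultimately show "(LINT x|\<rho>. 1 / (of_real x - z)) = (LINT x|\<nu>. 1 / (of_real x - z))"
      by (rule LIMSEQ_unique)
  qed
  with conv show "weak_conv_m (\<mu> \<circ> s) \<nu>" by simp
qed

text \<open>Polya's argument: continuity of the limit provides points \<open>q j\<close> at the
  levels \<open>j / K\<close>, pointwise convergence is uniform over these finitely many points, and
  monotonicity transfers it to every \<open>x\<close> at the price of one level
  \<open>1 / K\<close>. Quantiles are guaranteed only for levels strictly between 0 and 1; in the
  outer slabs the bounds 0 and 1 on distribution functions suffice.\<close>

lemma Polya_uniform_cdf:
  assumes \<mu>: "\<And>n. real_distribution (\<mu> n)" and \<nu>: "real_distribution \<nu>"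
    and conv: "weak_conv_m \<mu> \<nu>" and cont: "\<And>x. isCont (cdf \<nu>) x"
  shows "(\<lambda>n. SUP x. \<bar>cdf (\<mu> n) x - cdf \<nu> x\<bar>) \<longlonglongrightarrow> 0"
proof -
  interpret \<nu>: real_distribution \<nu> by fact
  interpret \<mu>: real_distribution "\<mu> n" for n by (rule \<mu>)
  let ?G = "cdf \<nu>"
  have pt: "(\<lambda>n. cdf (\<mu> n) x) \<longlonglongrightarrow> ?G x" for x
    using conv cont unfolding weak_conv_m_def weak_conv_def by blast
  have quantile: "\<exists>x. ?G x = p" if p: "0 < p" "p < 1" for p
  proof -
    obtain a where a: "?G a < p"
      using order_tendstoD(2)[OF \<nu>.cdf_lim_at_bot p(1)] by (auto simp: eventually_at_bot_linorder)
    obtain b where b: "?G b > p"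
      using order_tendstoD(1)[OF \<nu>.cdf_lim_at_top_prob p(2)] by (auto simp: eventually_at_top_linorder)
    have "a \<le> b" using \<nu>.cdf_nondecreasing[of b a] a b by (cases "a \<le> b") auto
    then show ?thesis using IVT[of ?G a p b] a b cont by auto
  qed
  show ?thesis
  proof (rule LIMSEQ_I)
    fix \<epsilon> :: real assume e: "\<epsilon> > 0"
    \<comment> \<open>Half of \<epsilon> pays for the spacing \<open>1 / K\<close> and a quarter for
      the error at the quantiles; the remaining quarter keeps the supremum strictly below
      \<epsilon>.\<close>
    obtain K :: nat where K: "2 / \<epsilon> < real K" using reals_Archimedean2 by blast
    then have K0: "K > 0" using e by (cases "K = 0") (auto simp: field_simps)
    have Ke: "1 / real K < \<epsilon> / 2" using K e K0 by (simp add: field_simps)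
    define q where "q j = (SOME x. ?G x = real j / real K)" for j
    have q: "?G (q j) = real j / real K" if "0 < j" "j < K" for j
      unfolding q_def by (rule someI_ex[OF quantile]) (use that in auto)
    have "\<forall>\<^sub>F n in sequentially. \<forall>j\<in>{1..<K}. \<bar>cdf (\<mu> n) (q j) - ?G (q j)\<bar> < \<epsilon> / 4"
      by (intro eventually_ball_finite ballI tendstoD[OF pt, unfolded dist_real_def]) (use e in auto)
    then obtain N where N: "\<And>n j. n \<ge> N \<Longrightarrow> 0 < j \<Longrightarrow> j < K \<Longrightarrow> \<bar>cdf (\<mu> n) (q j) - ?G (q j)\<bar> < \<epsilon> / 4"
      unfolding eventually_sequentially by fastforce
    have bound: "\<bar>cdf (\<mu> n) x - ?G x\<bar> \<le> 3 * \<epsilon> / 4" if n: "n \<ge> N" for n x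
    proof -
      have G01: "0 \<le> ?G x" "?G x \<le> 1" "0 \<le> cdf (\<mu> n) x" "cdf (\<mu> n) x \<le> 1"
        using \<nu>.cdf_nonneg \<nu>.cdf_bounded_prob \<mu>.cdf_nonneg \<mu>.cdf_bounded_prob by auto
      have lower: "cdf (\<mu> n) x \<ge> ?G x - 1 / K - \<epsilon> / 4"
      proof (cases "?G x \<le> 1 / K")
        case True
        then show ?thesis using G01 e by linarith
      next
        case False
        \<comment> \<open>The last level strictly below \<open>?G x\<close>. Ceiling minus one,
          instead of the floor, makes the inequality strict, so that monotonicity alone yields
          \<open>q j \<le> x\<close>.\<close>
        define j where "j = nat (\<lceil>real K * ?G x\<rceil> - 1)"
        have "1 < real K * ?G x" using False K0 by (simp add: field_simps)
        then have j1: "real j = real_of_int \<lceil>real K * ?G x\<rceil> - 1" "0 < j" unfolding j_def by linarith+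
        then have j2: "real j < real K * ?G x" "real K * ?G x \<le> real j + 1" by linarith+
        moreover have "real K * ?G x \<le> real K" using G01 by (simp add: mult_left_le)
        ultimately have jK: "j < K" by linarith
        have lt: "?G (q j) < ?G x" unfolding q[OF j1(2) jK] using j2(1) K0 by (simp add: field_simps)
        have "q j \<le> x" using \<nu>.cdf_nondecreasing[of x "q j"] lt by (cases "q j \<le> x") auto
        then have "cdf (\<mu> n) x \<ge> cdf (\<mu> n) (q j)" by (rule \<mu>.cdf_nondecreasing)
        moreover have "?G x \<le> ?G (q j) + 1 / K"
          unfolding q[OF j1(2) jK] using j2(2) K0 by (simp add: field_simps)
        ultimately show ?thesis using N[OF n j1(2) jK] by linarith
      qed
      have upper: "cdf (\<mu> n) x \<le> ?G x + 1 / K + \<epsilon> / 4"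
      proof (cases "?G x \<ge> 1 - 1 / K")
        case True
        then show ?thesis using G01 e by linarith
      next
        case False
        define j where "j = nat (\<lfloor>real K * ?G x\<rfloor> + 1)"
        have "0 \<le> real K * ?G x" using G01 by simp
        then have j1: "real j = real_of_int \<lfloor>real K * ?G x\<rfloor> + 1" "0 < j" unfolding j_def by linarith+
        then have j2: "real j > real K * ?G x" "real K * ?G x \<ge> real j - 1" by linarith+
        moreover have "real K * ?G x < real K - 1" using False K0 by (simp add: field_simps)
        ultimately have jK: "j < K" by linarith
        have lt: "?G (q j) > ?G x" unfolding q[OF j1(2) jK] using j2(1) K0 by (simp add: field_simps)
        have "x \<le> q j" using \<nu>.cdf_nondecreasing[of "q j" x] lt by (cases "x \<le> q j") auto
        then have "cdf (\<mu> n) x \<le> cdf (\<mu> n) (q j)" by (rule \<mu>.cdf_nondecreasing)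
        moreover have "?G x \<ge> ?G (q j) - 1 / K"
          unfolding q[OF j1(2) jK] using j2(2) K0 by (simp add: field_simps)
        ultimately show ?thesis using N[OF n j1(2) jK] by linarith
      qed
      show ?thesis using lower upper Ke by linarith
    qed
    show "\<exists>no. \<forall>n\<ge>no. norm ((SUP x. \<bar>cdf (\<mu> n) x - ?G x\<bar>) - 0) < \<epsilon>"
    proof (intro exI allI impI)
      fix n assume n: "n \<ge> N"
      have "(SUP x. \<bar>cdf (\<mu> n) x - ?G x\<bar>) \<le> 3 * \<epsilon> / 4"
        by (rule cSUP_least) (use bound[OF n] in auto)
      moreover have "bdd_above (range (\<lambda>x. \<bar>cdf (\<mu> n) x - ?G x\<bar>))"
        by (rule bdd_aboveI2[OF bound[OF n]])
      then have "(SUP x. \<bar>cdf (\<mu> n) x - ?G x\<bar>) \<ge> \<bar>cdf (\<mu> n) 0 - ?G 0\<bar>"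
        by (intro cSUP_upper) auto
      ultimately show "norm ((SUP x. \<bar>cdf (\<mu> n) x - ?G x\<bar>) - 0) < \<epsilon>" using e by simp
    qed
  qed
qed

section \<open>Resolvents of real symmetric matrices\<close>

text \<open>The equation \<open>(A - z) G = 1\<close> is stated entrywise on an index set, so that
  minors are subsets of one array and keep their indices. Values outside \<open>I\<close> are
  unconstrained.\<close>

definition resolvent_on ::
    "'i set \<Rightarrow> ('i \<Rightarrow> 'i \<Rightarrow> real) \<Rightarrow> complex \<Rightarrow> ('i \<Rightarrow> 'i \<Rightarrow> complex) \<Rightarrow> bool" where
  "resolvent_on I A z G \<longleftrightarrow>
     (\<forall>i\<in>I. \<forall>k\<in>I. (\<Sum>j\<in>I. of_real (A i j) * G j k) = z * G i k + of_bool (i = k))"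

lemma resolvent_onD:
  assumes "resolvent_on I A z G" "i \<in> I" "k \<in> I"
  shows "(\<Sum>j\<in>I. of_real (A i j) * G j k) = z * G i k + of_bool (i = k)"
  using assms unfolding resolvent_on_def by blast

lemma sum_mult_of_bool:
  fixes f :: "'i \<Rightarrow> 'b::semiring_1"
  assumes "finite I" "k \<in> I"
  shows "(\<Sum>i\<in>I. f i * of_bool (i = k)) = f k" "(\<Sum>i\<in>I. of_bool (i = k) * f i) = f k"
    "(\<Sum>i\<in>I. f i * of_bool (k = i)) = f k"
  using assms by (simp_all add: of_bool_def if_distrib[of "\<lambda>x. _ * x"] if_distrib[of "\<lambda>x. x * _"] cong: if_cong)

lemma resolvent_on_cnj:
  assumes "resolvent_on I A z G"
  shows "resolvent_on I A (cnj z) (\<lambda>i j. cnj (G i j))"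
  unfolding resolvent_on_def
proof (intro ballI)
  fix i k assume "i \<in> I" "k \<in> I"
  from arg_cong[OF resolvent_onD[OF assms this], of cnj]
  show "(\<Sum>j\<in>I. of_real (A i j) * cnj (G j k)) = cnj z * cnj (G i k) + of_bool (i = k)"
    by (simp add: cnj_sum)
qed

text \<open>A transposed resolvent identity, from evaluating
  \<open>\<Sum> G i a * A i j * H j k\<close> in both orders. Its three uses are
  \<open>H = G\<close> for symmetry, equal parameters for uniqueness, and \<open>w = cnj z\<close>
  for the imaginary part.\<close>

lemma resolvent_on_product:
  assumes fin: "finite I" and sym: "\<And>i j. A i j = A j i"
    and G: "resolvent_on I A z G" and H: "resolvent_on I A w H"
    and a: "a \<in> I" and k: "k \<in> I"
  shows "(w - z) * (\<Sum>i\<in>I. G i a * H i k) = H a k - G k a"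
proof -
  let ?S = "\<Sum>i\<in>I. \<Sum>j\<in>I. G i a * of_real (A i j) * H j k"
  have "?S = (\<Sum>i\<in>I. G i a * (\<Sum>j\<in>I. of_real (A i j) * H j k))"
    by (simp add: sum_distrib_left mult.assoc)
  also have "\<dots> = (\<Sum>i\<in>I. G i a * (w * H i k + of_bool (i = k)))"
    using resolvent_onD[OF H _ k] by (intro sum.cong) auto
  also have "\<dots> = w * (\<Sum>i\<in>I. G i a * H i k) + G k a"
    using fin k by (simp add: distrib_left sum.distrib sum_distrib_left sum_mult_of_bool mult.left_commute)
  finally have 1: "?S = w * (\<Sum>i\<in>I. G i a * H i k) + G k a" .
  have "?S = (\<Sum>j\<in>I. \<Sum>i\<in>I. G i a * of_real (A i j) * H j k)"
    by (rule sum.swap)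
  also have "\<dots> = (\<Sum>j\<in>I. (\<Sum>i\<in>I. of_real (A j i) * G i a) * H j k)"
    by (simp add: sum_distrib_left sum_distrib_right mult_ac sym)
  also have "\<dots> = (\<Sum>j\<in>I. (z * G j a + of_bool (j = a)) * H j k)"
    using resolvent_onD[OF G _ a] by (intro sum.cong) auto
  also have "\<dots> = z * (\<Sum>i\<in>I. G i a * H i k) + H a k"
    using fin a by (simp add: distrib_right sum.distrib sum_distrib_left sum_mult_of_bool mult.assoc)
  finally show ?thesis using 1 by (simp add: algebra_simps)
qed

lemma resolvent_on_sym:
  assumes "finite I" "\<And>i j. A i j = A j i" "resolvent_on I A z G" "a \<in> I" "k \<in> I"
  shows "G a k = G k a"
  using resolvent_on_product[OF assms(1,2,3,3,4,5)] by simp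

lemma resolvent_on_unique:
  assumes "finite I" "\<And>i j. A i j = A j i" "resolvent_on I A z G" "resolvent_on I A z H"
    "a \<in> I" "k \<in> I"
  shows "G a k = H a k"
  using resolvent_on_product[OF assms(1-6)] resolvent_on_sym[OF assms(1,2,3,5,6)] by simp

lemma resolvent_on_imaginary_part:
  assumes "finite I" "\<And>i j. A i j = A j i" "resolvent_on I A z G" "a \<in> I" "k \<in> I"
  shows "G a k - cnj (G a k) = 2 * \<i> * Im z * (\<Sum>i\<in>I. G i a * cnj (G i k))"
proof -
  have "(cnj z - z) * (\<Sum>i\<in>I. G i a * cnj (G i k)) = cnj (G a k) - G k a"
    by (rule resolvent_on_product[OF assms(1-3) resolvent_on_cnj[OF assms(3)] assms(4,5)])
  moreover have "cnj z - z = - (2 * \<i> * Im z)" by (simp add: complex_eq_iff)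
  ultimately show ?thesis
    using resolvent_on_sym[OF assms] by (simp add: algebra_simps)
qed

lemma Ward_identity:
  assumes "finite I" "\<And>i j. A i j = A j i" "resolvent_on I A z G" "a \<in> I"
  shows "Im (G a a) = Im z * (\<Sum>i\<in>I. (cmod (G i a))\<^sup>2)"
proof -
  have "G a a - cnj (G a a) = 2 * \<i> * Im (G a a)" by (simp add: complex_eq_iff)
  moreover have "(\<Sum>i\<in>I. G i a * cnj (G i a)) = of_real (\<Sum>i\<in>I. (cmod (G i a))\<^sup>2)"
    by (simp only: of_real_sum complex_norm_square)
  ultimately have "2 * \<i> * Im (G a a) = 2 * \<i> * of_real (Im z * (\<Sum>i\<in>I. (cmod (G i a))\<^sup>2))"
    using resolvent_on_imaginary_part[OF assms assms(4)] by simp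
  then have "complex_of_real (Im (G a a)) = of_real (Im z * (\<Sum>i\<in>I. (cmod (G i a))\<^sup>2))"
    by (metis (no_types, lifting) complex_i_not_zero mult_eq_0_iff mult_cancel_left zero_neq_numeral)
  then show ?thesis using of_real_eq_iff by blast
qed

text \<open>The factor \<open>cmod (G a a)\<close> is kept rather than bounded by
  \<open>1 / Im z\<close>: in the comparison of a resolvent with that of a minor it cancels a
  division by the same entry.\<close>

lemma resolvent_on_column_bound:
  assumes "finite I" "\<And>i j. A i j = A j i" "resolvent_on I A z G" "a \<in> I" and z: "Im z > 0"
  shows "(\<Sum>i\<in>I. (cmod (G i a))\<^sup>2) \<le> cmod (G a a) / Im z"
  using Ward_identity[OF assms(1-4)] abs_Im_le_cmod[of "G a a"] z
  by (simp add: field_simps)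

lemma resolvent_on_diag_bound:
  assumes "finite I" "\<And>i j. A i j = A j i" "resolvent_on I A z G" "a \<in> I" and z: "Im z > 0"
  shows "cmod (G a a) \<le> 1 / Im z"
proof -
  have "(cmod (G a a))\<^sup>2 \<le> (\<Sum>i\<in>I. (cmod (G i a))\<^sup>2)"
    using assms(1,4) by (intro member_le_sum) auto
  also have "\<dots> \<le> cmod (G a a) / Im z" by (rule resolvent_on_column_bound[OF assms])
  finally have "cmod (G a a) * cmod (G a a) \<le> cmod (G a a) * (1 / Im z)"
    by (simp add: power2_eq_square)
  then show ?thesis
    using z by (cases "G a a = 0") (simp_all add: mult_le_cancel_left del: times_divide_eq_right mult_1_right)
qed

lemma resolvent_on_column_bound':
  assumes "finite I" "\<And>i j. A i j = A j i" "resolvent_on I A z G" "a \<in> I" and z: "Im z > 0"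
  shows "(\<Sum>i\<in>I. (cmod (G i a))\<^sup>2) \<le> 1 / (Im z)\<^sup>2"
proof -
  have "(\<Sum>i\<in>I. (cmod (G i a))\<^sup>2) \<le> cmod (G a a) / Im z" by (rule resolvent_on_column_bound[OF assms])
  also have "\<dots> \<le> (1 / Im z) / Im z"
    using z by (intro divide_right_mono resolvent_on_diag_bound[OF assms]) auto
  finally show ?thesis by (simp add: power2_eq_square)
qed

lemma resolvent_on_entry_bound:
  assumes "finite I" "\<And>i j. A i j = A j i" "resolvent_on I A z G" "a \<in> I" "i \<in> I" and z: "Im z > 0"
  shows "cmod (G i a) \<le> 1 / Im z"
proof -
  have "(cmod (G i a))\<^sup>2 \<le> (\<Sum>i\<in>I. (cmod (G i a))\<^sup>2)"
    using assms(1,5) by (intro member_le_sum) auto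
  also have "\<dots> \<le> (1 / Im z)\<^sup>2"
    using resolvent_on_column_bound'[OF assms(1-4,6)] by (simp add: power_divide)
  finally show ?thesis using z by (rule_tac power2_le_imp_le) auto
qed

text \<open>The imaginary part of the resolvent is \<open>Im z\<close> times a Gram matrix, so on
  real vectors the quadratic form becomes a sum of squares. Its sign keeps Schur complements away
  from zero, and its size gives the operator norm.\<close>

lemma resolvent_on_Im_quadratic:
  assumes fin: "finite I" and sym: "\<And>i j. A i j = A j i" and G: "resolvent_on I A z G"
  shows "Im (\<Sum>j\<in>I. \<Sum>k\<in>I. of_real (v j) * of_real (v k) * G j k) =
         Im z * (\<Sum>i\<in>I. (cmod (\<Sum>j\<in>I. of_real (v j) * G i j))\<^sup>2)" (is "Im ?Q = Im z * ?S")
proof -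
  have "?Q - cnj ?Q = (\<Sum>j\<in>I. \<Sum>k\<in>I. of_real (v j) * of_real (v k) * (G j k - cnj (G j k)))"
    by (simp add: cnj_sum sum_subtractf[symmetric] algebra_simps)
  also have "\<dots> = (\<Sum>j\<in>I. \<Sum>k\<in>I. of_real (v j) * of_real (v k) *
       (2 * \<i> * Im z * (\<Sum>i\<in>I. G i j * cnj (G i k))))"
    by (intro sum.cong refl) (subst resolvent_on_imaginary_part[OF fin sym G], auto)
  also have "\<dots> = 2 * \<i> * Im z * (\<Sum>j\<in>I. \<Sum>k\<in>I. \<Sum>i\<in>I. (of_real (v j) * G i j) * (of_real (v k) * cnj (G i k)))"
    by (simp add: sum_distrib_left mult_ac)
  also have "(\<Sum>j\<in>I. \<Sum>k\<in>I. \<Sum>i\<in>I. (of_real (v j) * G i j) * (of_real (v k) * cnj (G i k)))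
      = (\<Sum>j\<in>I. \<Sum>i\<in>I. \<Sum>k\<in>I. (of_real (v j) * G i j) * (of_real (v k) * cnj (G i k)))"
    by (intro sum.cong refl sum.swap)
  also have "\<dots> = (\<Sum>i\<in>I. \<Sum>j\<in>I. \<Sum>k\<in>I. (of_real (v j) * G i j) * (of_real (v k) * cnj (G i k)))"
    by (rule sum.swap)
  also have "\<dots> = (\<Sum>i\<in>I. (\<Sum>j\<in>I. of_real (v j) * G i j) * cnj (\<Sum>j\<in>I. of_real (v j) * G i j))"
    by (simp add: sum_product cnj_sum)
  also have "\<dots> = of_real ?S" by (simp only: of_real_sum complex_norm_square)
  finally have "?Q - cnj ?Q = 2 * \<i> * Im z * of_real ?S" .
  from arg_cong[OF this, of Im] show ?thesis by (simp add: sum_negf)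
qed

text \<open>The operator norm bound \<open>1 / Im z\<close>, squared. \<open>Im z * ?S\<close> is
  the imaginary part of a quadratic form; Cauchy-Schwarz bounds it by \<open>sqrt (?V * ?S)\<close>,
  after which \<open>?S\<close> cancels.\<close>

lemma resolvent_on_vector_bound:
  assumes fin: "finite I" and sym: "\<And>i j. A i j = A j i" and G: "resolvent_on I A z G" and z: "Im z > 0"
  shows "(\<Sum>i\<in>I. (cmod (\<Sum>j\<in>I. of_real (v j) * G i j))\<^sup>2) \<le> (\<Sum>j\<in>I. (v j)\<^sup>2) / (Im z)\<^sup>2"
proof -
  let ?u = "\<lambda>i. \<Sum>j\<in>I. of_real (v j) * G i j"
  let ?S = "\<Sum>i\<in>I. (cmod (?u i))\<^sup>2" and ?V = "\<Sum>j\<in>I. (v j)\<^sup>2"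
  have S0: "?S \<ge> 0" "?V \<ge> 0" by (auto intro: sum_nonneg)
  have "Im z * ?S = Im (\<Sum>j\<in>I. \<Sum>k\<in>I. of_real (v j) * of_real (v k) * G j k)"
    by (rule resolvent_on_Im_quadratic[OF fin sym G, symmetric])
  also have "\<dots> = Im (\<Sum>j\<in>I. of_real (v j) * ?u j)"
    by (simp only: sum_distrib_left mult.assoc)
  also have "\<dots> \<le> cmod (\<Sum>j\<in>I. of_real (v j) * ?u j)"
    using abs_Im_le_cmod by (rule order.trans[OF abs_ge_self])
  also have "\<dots> \<le> (\<Sum>j\<in>I. \<bar>v j\<bar> * cmod (?u j))"
    by (rule order.trans[OF norm_sum]) (simp add: norm_mult)
  finally have "(Im z * ?S)\<^sup>2 \<le> (\<Sum>j\<in>I. \<bar>v j\<bar> * cmod (?u j))\<^sup>2"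
    using z S0 by (intro power_mono) auto
  also have "\<dots> \<le> ?V * ?S"
    using Cauchy_Schwarz_ineq_sum[of "\<lambda>j. \<bar>v j\<bar>" "\<lambda>j. cmod (?u j)" I] by simp
  finally have *: "(Im z)\<^sup>2 * ?S * ?S \<le> ?V * ?S" by (simp add: power2_eq_square mult_ac)
  show ?thesis
  proof (cases "?S = 0")
    case True
    then show ?thesis using S0 by simp
  next
    case False
    then have "?S > 0" using S0 by simp
    then have "(Im z)\<^sup>2 * ?S \<le> ?V" using * by (simp only: mult_le_cancel_right)
    then show ?thesis using z by (simp add: field_simps)
  qed
qed

lemma resolvent_on_bilinear_bound:
  assumes fin: "finite I" and sym: "\<And>i j. A i j = A j i" and G: "resolvent_on I A z G" and z: "Im z > 0"
  shows "cmod (\<Sum>j\<in>I. \<Sum>k\<in>I. of_real (v j) * of_real (w k) * G j k) \<le>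
         sqrt (\<Sum>j\<in>I. (v j)\<^sup>2) * sqrt (\<Sum>j\<in>I. (w j)\<^sup>2) / Im z"
proof -
  let ?u = "\<lambda>i. \<Sum>j\<in>I. of_real (w j) * G i j"
  have "cmod (\<Sum>j\<in>I. \<Sum>k\<in>I. of_real (v j) * of_real (w k) * G j k) = cmod (\<Sum>j\<in>I. of_real (v j) * ?u j)"
    by (simp only: sum_distrib_left mult.assoc)
  also have "\<dots> \<le> (\<Sum>j\<in>I. \<bar>v j\<bar> * cmod (?u j))"
    by (rule order.trans[OF norm_sum]) (simp add: norm_mult)
  also have "\<dots> \<le> sqrt ((\<Sum>j\<in>I. (v j)\<^sup>2) * (\<Sum>j\<in>I. (cmod (?u j))\<^sup>2))"
    using Cauchy_Schwarz_ineq_sum[of "\<lambda>j. \<bar>v j\<bar>" "\<lambda>j. cmod (?u j)" I] by (intro real_le_rsqrt) simp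
  also have "\<dots> \<le> sqrt ((\<Sum>j\<in>I. (v j)\<^sup>2) * ((\<Sum>j\<in>I. (w j)\<^sup>2) / (Im z)\<^sup>2))"
    by (intro real_sqrt_le_mono mult_left_mono resolvent_on_vector_bound[OF fin sym G z] sum_nonneg) auto
  also have "\<dots> = sqrt (\<Sum>j\<in>I. (v j)\<^sup>2) * sqrt (\<Sum>j\<in>I. (w j)\<^sup>2) / Im z"
    using z by (simp add: real_sqrt_mult real_sqrt_divide)
  finally show ?thesis .
qed

text \<open>
  Block inversion when row and column \<open>i\<close> are added to the index set \<open>J\<close>; \<open>d\<close> is the Schur
  complement. Iterating it makes the resolvent an explicit, hence measurable, function of the entries.
\<close>

definition bordered_resolvent ::
    "('i \<Rightarrow> 'i \<Rightarrow> real) \<Rightarrow> complex \<Rightarrow> 'i \<Rightarrow> 'i set \<Rightarrow> ('i \<Rightarrow> 'i \<Rightarrow> complex) \<Rightarrow> 'i \<Rightarrow> 'i \<Rightarrow> complex" where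
  "bordered_resolvent A z i J G j k =
     (let u = (\<lambda>j. \<Sum>k\<in>J. of_real (A i k) * G j k);
          d = of_real (A i i) - z - (\<Sum>j\<in>J. of_real (A i j) * u j)
      in if j = i then (if k = i then 1 / d else - u k / d)
         else if k = i then - u j / d else G j k + u j * u k / d)"

lemma schur_complement_Im:
  assumes fin: "finite J" and sym: "\<And>i j. A i j = A j i" and G: "resolvent_on J A z G" and z: "Im z > 0"
  shows "Im (of_real a - z - (\<Sum>j\<in>J. \<Sum>k\<in>J. of_real (v j) * of_real (v k) * G j k)) \<le> - Im z"
  using resolvent_on_Im_quadratic[OF fin sym G, of v] z
  by (simp add: sum_nonneg)

lemma resolvent_on_bordered:
  fixes i :: 'i
  assumes fin: "finite J" and sym: "\<And>i j. A i j = A j i" and i: "i \<notin> J"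
    and G: "resolvent_on J A z G" and z: "Im z > 0"
  shows "resolvent_on (insert i J) A z (bordered_resolvent A z i J G)"
proof -
  define u where "u j = (\<Sum>k\<in>J. of_real (A i k) * G j k)" for j
  define d where "d = of_real (A i i) - z - (\<Sum>j\<in>J. of_real (A i j) * u j)"
  let ?H = "bordered_resolvent A z i J G"
  have "(\<Sum>j\<in>J. of_real (A i j) * u j) = (\<Sum>j\<in>J. \<Sum>k\<in>J. of_real (A i j) * of_real (A i k) * G j k)"
    by (simp add: u_def sum_distrib_left mult.assoc)
  with schur_complement_Im[OF fin sym G z, of "A i i" "\<lambda>j. A i j"] have "Im d \<le> - Im z"
    unfolding d_def by metis
  then have d0: "d \<noteq> 0" using z by auto
  have H: "?H i i = 1 / d" "\<And>k. k \<in> J \<Longrightarrow> ?H i k = - u k / d" "\<And>k. k \<in> J \<Longrightarrow> ?H k i = - u k / d"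
    "\<And>j k. j \<in> J \<Longrightarrow> k \<in> J \<Longrightarrow> ?H j k = G j k + u j * u k / d"
    using i by (auto simp: bordered_resolvent_def Let_def u_def d_def)
  have dz: "(\<Sum>j\<in>J. of_real (A i j) * u j) = of_real (A i i) - z - d" by (simp add: d_def)
  have uJ: "(\<Sum>j\<in>J. of_real (A i j) * G j k) = u k" if "k \<in> J" for k
    unfolding u_def using resolvent_on_sym[OF fin sym G _ that] by (intro sum.cong) auto
  \<comment> \<open>\<open>u\<close> is \<open>G\<close> applied to the new row, so
    \<open>A - z\<close> maps it back to that row.\<close>
  have Au: "(\<Sum>l\<in>J. of_real (A j l) * u l) = z * u j + of_real (A j i)" if j: "j \<in> J" for j
  proof -
    have "(\<Sum>l\<in>J. of_real (A j l) * u l) = (\<Sum>l\<in>J. \<Sum>k\<in>J. of_real (A i k) * (of_real (A j l) * G l k))"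
      by (simp add: u_def sum_distrib_left mult_ac)
    also have "\<dots> = (\<Sum>k\<in>J. \<Sum>l\<in>J. of_real (A i k) * (of_real (A j l) * G l k))"
      by (rule sum.swap)
    also have "\<dots> = (\<Sum>k\<in>J. of_real (A i k) * (z * G j k + of_bool (j = k)))"
      by (simp add: sum_distrib_left[symmetric] resolvent_onD[OF G j])
    also have "\<dots> = z * u j + of_real (A j i)"
      using fin j sym[of j i]
      by (simp add: u_def distrib_left sum.distrib sum_distrib_left sum_mult_of_bool mult.left_commute)
    finally show ?thesis .
  qed
  show ?thesis unfolding resolvent_on_def
  proof (intro ballI)
    fix j k assume jk: "j \<in> insert i J" "k \<in> insert i J"
    have split: "(\<Sum>l\<in>insert i J. of_real (A j l) * ?H l k)
      = of_real (A j i) * ?H i k + (\<Sum>l\<in>J. of_real (A j l) * ?H l k)"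
      using fin i by simp
    show "(\<Sum>l\<in>insert i J. of_real (A j l) * ?H l k) = z * ?H j k + of_bool (j = k)"
    proof (cases "k = i")
      case k: True
      have s: "(\<Sum>l\<in>J. of_real (A j l) * ?H l i) = - (\<Sum>l\<in>J. of_real (A j l) * u l) / d"
        by (simp add: H sum_negf sum_divide_distrib)
      show ?thesis
      proof (cases "j = i")
        case True
        show ?thesis unfolding split unfolding k s unfolding True dz using d0 by (simp add: H field_simps)
      next
        case False
        then have j: "j \<in> J" using jk by auto
        show ?thesis unfolding split unfolding k s Au[OF j] using d0 False j by (simp add: H field_simps)
      qed
    next
      case False
      then have k: "k \<in> J" using jk by auto
      have s: "(\<Sum>l\<in>J. of_real (A j l) * ?H l k)
         = (\<Sum>l\<in>J. of_real (A j l) * G l k) + (\<Sum>l\<in>J. of_real (A j l) * u l) * (u k / d)"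
        using k by (simp add: H sum.distrib algebra_simps sum_distrib_left)
      show ?thesis
      proof (cases "j = i")
        case True
        then show ?thesis unfolding split s unfolding True dz uJ[OF k] using d0 False k
          by (simp add: H field_simps)
      next
        case j': False
        then have j: "j \<in> J" using jk by auto
        show ?thesis unfolding split s Au[OF j] resolvent_onD[OF G j k] using d0 False k j
          by (simp add: H field_simps)
      qed
    qed
  qed
qed

text \<open>By uniqueness \<open>R\<close> is the bordered resolvent of the minor, so both
  identities are read off its blocks. The second is the rank one correction
  \<open>u j ^ 2 / d\<close>, rewritten through entries of \<open>R\<close>.\<close>

lemma schur_complement:
  fixes R G :: "'i \<Rightarrow> 'i \<Rightarrow> complex"
  assumes fin: "finite I" and sym: "\<And>i j. A i j = A j i" and i: "i \<in> I"
    and R: "resolvent_on I A z R" and G: "resolvent_on (I - {i}) A z G" and z: "Im z > 0"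
  shows "R i i * (of_real (A i i) - z -
           (\<Sum>j\<in>I - {i}. \<Sum>k\<in>I - {i}. of_real (A i j) * of_real (A i k) * G j k)) = 1"
    and "j \<in> I - {i} \<Longrightarrow> (R j j - G j j) * R i i = (R j i)\<^sup>2"
proof -
  let ?J = "I - {i}"
  define u where "u j = (\<Sum>k\<in>?J. of_real (A i k) * G j k)" for j
  define d where "d = of_real (A i i) - z - (\<Sum>j\<in>?J. of_real (A i j) * u j)"
  have ins: "insert i ?J = I" using i by auto
  have H: "resolvent_on I A z (bordered_resolvent A z i ?J G)"
    using resolvent_on_bordered[OF _ sym _ G z, of i] fin ins by auto
  have eq: "R j k = bordered_resolvent A z i ?J G j k" if "j \<in> I" "k \<in> I" for j k
    by (rule resolvent_on_unique[OF fin sym R H that])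
  have dQ: "(\<Sum>j\<in>?J. of_real (A i j) * u j) = (\<Sum>j\<in>?J. \<Sum>k\<in>?J. of_real (A i j) * of_real (A i k) * G j k)"
    by (simp add: u_def sum_distrib_left mult.assoc)
  with schur_complement_Im[OF _ sym G z, of "A i i" "\<lambda>j. A i j"] fin have "Im d \<le> - Im z"
    unfolding d_def by (metis finite_Diff)
  then have d0: "d \<noteq> 0" using z by auto
  have Rii: "R i i = 1 / d" using eq[OF i i] by (simp add: bordered_resolvent_def Let_def u_def d_def)
  show "R i i * (of_real (A i i) - z -
           (\<Sum>j\<in>I - {i}. \<Sum>k\<in>I - {i}. of_real (A i j) * of_real (A i k) * G j k)) = 1"
    unfolding dQ[symmetric] Rii using d0 by (simp add: d_def)
  show "(R j j - G j j) * R i i = (R j i)\<^sup>2" if "j \<in> I - {i}"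
    using that i eq[of j j] eq[of j i] d0 unfolding Rii
    by (auto simp: bordered_resolvent_def Let_def u_def[symmetric] d_def[symmetric] power2_eq_square)
qed

primrec resolvent_list :: "('i \<Rightarrow> 'i \<Rightarrow> real) \<Rightarrow> complex \<Rightarrow> 'i list \<Rightarrow> 'i \<Rightarrow> 'i \<Rightarrow> complex" where
  "resolvent_list A z [] = (\<lambda>_ _. 0)"
| "resolvent_list A z (i # is) = bordered_resolvent A z i (set is) (resolvent_list A z is)"

lemma resolvent_on_list:
  assumes "\<And>i j. A i j = A j i" "Im z > 0" "distinct is"
  shows "resolvent_on (set is) A z (resolvent_list A z is)"
  using assms(3)
proof (induction "is")
  case (Cons i "is")
  then show ?case using resolvent_on_bordered[OF _ assms(1) _ _ assms(2), of "set is" i] by simp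
qed (simp add: resolvent_on_def)

lemma measurable_resolvent_list:
  assumes "\<And>i j. i \<in> set is \<Longrightarrow> j \<in> set is \<Longrightarrow> (\<lambda>x. A x i j) \<in> borel_measurable N"
    and "j \<in> set is" "k \<in> set is"
  shows "(\<lambda>x. resolvent_list (A x) z is j k) \<in> borel_measurable N"
  using assms
proof (induction "is" arbitrary: j k)
  case (Cons i "is")
  have [measurable]: "(\<lambda>x. A x i j) \<in> borel_measurable N" if "j = i \<or> j \<in> set is" for j
    using Cons.prems(1)[of i j] that by auto
  have G[measurable]: "(\<lambda>x. resolvent_list (A x) z is j k) \<in> borel_measurable N" if "j \<in> set is" "k \<in> set is" for j k
    using that by (intro Cons.IH Cons.prems) auto
  have u[measurable]: "(\<lambda>x. \<Sum>k\<in>set is. complex_of_real (A x i k) * resolvent_list (A x) z is j k) \<in> borel_measurable N"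
    if "j \<in> set is" for j
    using that by measurable
  have d[measurable]: "(\<lambda>x. of_real (A x i i) - z - (\<Sum>j\<in>set is. complex_of_real (A x i j) *
      (\<Sum>k\<in>set is. of_real (A x i k) * resolvent_list (A x) z is j k))) \<in> borel_measurable N"
    by measurable
  show ?case using Cons.prems(2,3)
    by (cases "j = i"; cases "k = i") (simp_all add: bordered_resolvent_def Let_def)
qed simp

definition resolvent :: "'i::linorder set \<Rightarrow> ('i \<Rightarrow> 'i \<Rightarrow> real) \<Rightarrow> complex \<Rightarrow> 'i \<Rightarrow> 'i \<Rightarrow> complex" where
  "resolvent I A z = resolvent_list A z (sorted_list_of_set I)"

lemma resolvent_on_resolvent:
  assumes "finite I" "\<And>i j. A i j = A j i" "Im z > 0"
  shows "resolvent_on I A z (resolvent I A z)"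
  using resolvent_on_list[OF assms(2,3), of "sorted_list_of_set I"] assms(1)
  by (simp add: resolvent_def)

text \<open>\<open>N\<close> is left free: the same lemma serves the full sigma-algebra and the one
  generated by all entries but one.\<close>

lemma measurable_resolvent:
  assumes "finite I" "\<And>i j. i \<in> I \<Longrightarrow> j \<in> I \<Longrightarrow> (\<lambda>x. A x i j) \<in> borel_measurable N"
    and "j \<in> I" "k \<in> I"
  shows "(\<lambda>x. resolvent I (A x) z j k) \<in> borel_measurable N"
  using measurable_resolvent_list[of "sorted_list_of_set I" A N j k z] assms
  by (simp add: resolvent_def)

section \<open>Spectral traces\<close>

text \<open>At a nonreal \<open>e\<close> a resolvent of \<open>A\<close> exists, by conjugation
  also below the real axis. Hence \<open>A - e\<close> is injective and has no eigenvector.\<close>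

lemma eigenvalue_symmetric_real:
  fixes A :: "nat \<Rightarrow> nat \<Rightarrow> real"
  assumes sym: "\<And>i j. A i j = A j i"
    and ev: "eigenvalue (Matrix.mat n n (\<lambda>(i, j). complex_of_real (A i j))) e"
  shows "Im e = 0"
proof (rule ccontr)
  assume ne: "Im e \<noteq> 0"
  let ?M = "Matrix.mat n n (\<lambda>(i, j). complex_of_real (A i j))"
  obtain G where G: "resolvent_on {..<n} A e G"
  proof (cases "Im e > 0")
    case True
    then show ?thesis using resolvent_on_resolvent[of "{..<n}" A e] sym that by blast
  next
    case False
    then have "resolvent_on {..<n} A (cnj e) (resolvent {..<n} A (cnj e))"
      using resolvent_on_resolvent[of "{..<n}" A "cnj e"] sym ne by simp
    from resolvent_on_cnj[OF this] show ?thesis using that by simp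
  qed
  obtain v where v: "v \<in> carrier_vec n" "v \<noteq> 0\<^sub>v n" "?M *\<^sub>v v = e \<cdot>\<^sub>v v"
    using ev unfolding eigenvalue_def eigenvector_def by auto
  have row: "(\<Sum>j<n. of_real (A i j) * v $ j) = e * v $ i" if "i < n" for i
    using arg_cong[OF v(3), of "\<lambda>w. w $ i"] that v(1)
    by (simp add: scalar_prod_def row_def atLeast0LessThan)
  have "v $ a = 0" if a: "a < n" for a
  proof -
    have "(\<Sum>i<n. v $ i * (e * G i a + of_bool (i = a))) = (\<Sum>i<n. \<Sum>j<n. v $ i * (of_real (A i j) * G j a))"
      using resolvent_onD[OF G] a by (simp add: sum_distrib_left[symmetric])
    also have "\<dots> = (\<Sum>j<n. \<Sum>i<n. v $ i * (of_real (A i j) * G j a))"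
      by (rule sum.swap)
    also have "\<dots> = (\<Sum>j<n. (\<Sum>i<n. of_real (A j i) * v $ i) * G j a)"
      by (simp add: sum_distrib_left sum_distrib_right sym mult_ac)
    also have "\<dots> = (\<Sum>j<n. v $ j * (e * G j a))" using row by (simp add: mult_ac)
    finally show ?thesis using a by (simp add: distrib_left sum.distrib sum_mult_of_bool)
  qed
  then have "v = 0\<^sub>v n" using v(1) by (intro eq_vecI) auto
  with v(2) show False by simp
qed

lemma char_poly_symmetric_real:
  fixes A :: "nat \<Rightarrow> nat \<Rightarrow> real"
  assumes sym: "\<And>i j. A i j = A j i"
  obtains rs where "length rs = n"
    "char_poly (Matrix.mat n n (\<lambda>(i, j). A i j)) = (\<Prod>r\<leftarrow>rs. [:- r, 1:])"
proof -
  let ?M = "Matrix.mat n n (\<lambda>(i, j). A i j)" and ?C = "Matrix.mat n n (\<lambda>(i, j). complex_of_real (A i j))"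
  interpret of_real_poly: map_poly_inj_idom_hom complex_of_real ..
  have C: "?C \<in> carrier_mat n n" and M: "?M \<in> carrier_mat n n" by auto
  have CM: "?C = map_mat complex_of_real ?M" by (rule eq_matI) auto
  obtain as where as: "char_poly ?C = (\<Prod>a\<leftarrow>as. [:- a, 1:])" "length as = n"
    using char_poly_factorized[OF C] by blast
  have real: "complex_of_real (Re a) = a" if "a \<in> set as" for a
  proof -
    have "poly (char_poly ?C) a = 0"
      unfolding as(1) using that by (auto simp: poly_prod_list prod_list_zero_iff image_iff o_def intro!: bexI[of _ a])
    then have "eigenvalue ?C a" using eigenvalue_root_char_poly[OF C] by blast
    then have "Im a = 0" by (rule eigenvalue_symmetric_real[OF sym])
    then show ?thesis by (simp add: complex_eq_iff)
  qed
  define rs where "rs = map Re as"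
  have as_rs: "as = map complex_of_real rs" unfolding rs_def using real by (simp add: map_idI)
  have "map_poly complex_of_real (char_poly ?M) = (\<Prod>a\<leftarrow>as. [:- a, 1:])"
  proof -
    have "char_poly ?C = map_poly complex_of_real (char_poly ?M)"
      unfolding CM by (rule of_real_hom.char_poly_hom[OF M])
    then show ?thesis using as(1) by simp
  qed
  also have "\<dots> = map_poly complex_of_real (\<Prod>r\<leftarrow>rs. [:- r, 1:])"
    unfolding as_rs by (induction rs) (simp_all add: of_real_poly.hom_mult o_def del: mult_pCons_left)
  finally have "char_poly ?M = (\<Prod>r\<leftarrow>rs. [:- r, 1:])" by (simp only: of_real_poly.eq_iff)
  then show thesis using that[of rs] as(2) by (simp add: rs_def)
qed

lemma proots_prod_linear_factors:
  "proots (\<Prod>r\<leftarrow>rs. [:- r, 1:]) = mset (rs :: 'a::idom list)"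
proof (induction rs)
  case (Cons r rs)
  have "(\<Prod>r\<leftarrow>rs. [:- r, 1:]) \<noteq> 0" by (auto simp: prod_list_zero_iff)
  then show ?case using Cons by (simp add: proots_mult del: mult_pCons_left)
qed simp

section \<open>Traces, similarity and triangular matrices\<close>

definition mat_trace :: "'a::comm_ring_1 Matrix.mat \<Rightarrow> 'a" where
  "mat_trace M = (\<Sum>i<dim_row M. M $$ (i, i))"

lemma index_mult_mat_sum:
  assumes "A \<in> carrier_mat n n" "B \<in> carrier_mat n n" "i < n" "j < n"
  shows "(A * B) $$ (i, j) = (\<Sum>k<n. A $$ (i, k) * B $$ (k, j))"
  using assms by (auto simp: scalar_prod_def atLeast0LessThan intro!: sum.cong)

lemma mat_trace_commute:
  assumes "A \<in> carrier_mat n n" "B \<in> carrier_mat n n"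
  shows "mat_trace (A * B) = mat_trace (B * A)"
proof -
  have "mat_trace (A * B) = (\<Sum>i<n. \<Sum>k<n. A $$ (i, k) * B $$ (k, i))"
    using assms by (simp add: mat_trace_def index_mult_mat_sum[OF assms] del: index_mult_mat(1))
  also have "\<dots> = (\<Sum>k<n. \<Sum>i<n. A $$ (i, k) * B $$ (k, i))" by (rule sum.swap)
  also have "\<dots> = mat_trace (B * A)"
    using assms by (simp add: mat_trace_def index_mult_mat_sum[OF assms(2,1)] mult.commute del: index_mult_mat(1))
  finally show ?thesis .
qed

lemma mat_trace_conjugate:
  assumes "P \<in> carrier_mat n n" "X \<in> carrier_mat n n" "Q \<in> carrier_mat n n" "Q * P = 1\<^sub>m n"
  shows "mat_trace (P * X * Q) = mat_trace X"
proof -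
  have "mat_trace (P * X * Q) = mat_trace (Q * (P * X))"
    using assms by (intro mat_trace_commute[of _ n]) auto
  also have "Q * (P * X) = X" using assms by (simp add: assoc_mult_mat[symmetric, of _ n n _ n _ n])
  finally show ?thesis .
qed

lemma upper_triangular_pow_diag:
  fixes B :: "'a::comm_ring_1 Matrix.mat"
  assumes B: "B \<in> carrier_mat n n" "upper_triangular B"
  shows "upper_triangular (B ^\<^sub>m k) \<and> (\<forall>i<n. (B ^\<^sub>m k) $$ (i, i) = (B $$ (i, i)) ^ k)"
proof (induction k)
  case 0
  then show ?case using B by auto
next
  case (Suc k)
  have C: "B ^\<^sub>m k \<in> carrier_mat n n" using B by auto
  have *: "(B ^\<^sub>m k) $$ (i, l) * B $$ (l, j) = 0" if "i < n" "j < n" "l < n" "l < i \<or> j < l" for i j l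
    using that Suc B C upper_triangularD by (metis carrier_matD(1) mult_zero_left mult_zero_right)
  have "(B ^\<^sub>m Suc k) $$ (i, j) = 0" if "i < n" "j < i" for i j
  proof -
    from that have "i < n" "j < n" by auto
    then show ?thesis unfolding pow_mat.simps index_mult_mat_sum[OF C B(1) \<open>i < n\<close> \<open>j < n\<close>]
      using that by (intro sum.neutral ballI *) auto
  qed
  moreover have "(B ^\<^sub>m Suc k) $$ (i, i) = (B $$ (i, i)) ^ Suc k" if "i < n" for i
  proof -
    have "(B ^\<^sub>m Suc k) $$ (i, i) = (\<Sum>l\<in>{i}. (B ^\<^sub>m k) $$ (i, l) * B $$ (l, i))"
      using that unfolding pow_mat.simps index_mult_mat_sum[OF C B(1) that that]
      by (intro sum.mono_neutral_right) (auto intro!: *)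
    then show ?thesis using Suc that by (simp add: mult.commute)
  qed
  moreover have "dim_row (B ^\<^sub>m Suc k) = n" using C B by auto
  ultimately show ?case by auto
qed

text \<open>Back substitution from the last row upwards. Once column \<open>k\<close> vanishes below
  row \<open>i\<close>, the equation of row \<open>i\<close> retains only its diagonal term; this
  gives zeros below the diagonal and then the diagonal itself.\<close>

lemma upper_triangular_resolvent_diag:
  fixes B Y :: "complex Matrix.mat"
  assumes B: "B \<in> carrier_mat n n" "upper_triangular B" and Y: "Y \<in> carrier_mat n n"
    and eq: "\<And>i k. i < n \<Longrightarrow> k < n \<Longrightarrow> (\<Sum>j<n. B $$ (i, j) * Y $$ (j, k)) = z * Y $$ (i, k) + of_bool (i = k)"
    and ne: "\<And>i. i < n \<Longrightarrow> B $$ (i, i) \<noteq> z"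
    and i: "i < n"
  shows "Y $$ (i, i) = 1 / (B $$ (i, i) - z)"
proof -
  have step: "(B $$ (i, i) - z) * Y $$ (i, k) = of_bool (i = k)"
    if "i < n" "k < n" "\<And>j. i < j \<Longrightarrow> j < n \<Longrightarrow> Y $$ (j, k) = 0" for i k
  proof -
    have "(\<Sum>j<n. B $$ (i, j) * Y $$ (j, k)) = (\<Sum>j\<in>{i}. B $$ (i, j) * Y $$ (j, k))"
    proof (intro sum.mono_neutral_right ballI)
      fix j assume "j \<in> {..<n} - {i}"
      then show "B $$ (i, j) * Y $$ (j, k) = 0"
        using that upper_triangularD[OF B(2), of j i] B(1) by (cases "i < j") auto
    qed (use that in auto)
    with eq[OF that(1,2)] show ?thesis by (simp add: algebra_simps)
  qed
  have low: "Y $$ (i, k) = 0" if "k < i" "i < n" for i k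
    using that
  proof (induction "n - i" arbitrary: i rule: less_induct)
    case less
    have "(B $$ (i, i) - z) * Y $$ (i, k) = of_bool (i = k)"
      using less.prems by (intro step less.hyps) auto
    then show ?case using less.prems ne[of i] by auto
  qed
  have "(B $$ (i, i) - z) * Y $$ (i, i) = 1"
    using step[OF i i] low by auto
  then show ?thesis using ne[OF i] by (simp add: field_simps)
qed

text \<open>A real Schur form has the roots on its diagonal, and traces do not change under
  similarity, so powers and resolvents need only be known on the diagonal of triangular matrices.
  The power traces later give measurability and second moments, the resolvent trace gives the
  Stieltjes transform.\<close>

lemma spectral_traces:
  fixes A :: "nat \<Rightarrow> nat \<Rightarrow> real" and n :: nat
  assumes sym: "\<And>i j. A i j = A j i"
  defines "M \<equiv> Matrix.mat n n (\<lambda>(i, j). A i j)"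
  obtains rs where "length rs = n" "proots (char_poly M) = mset rs"
    "\<And>k. mat_trace (M ^\<^sub>m k) = (\<Sum>r\<leftarrow>rs. r ^ k)"
    "\<And>z G. resolvent_on {..<n} A z G \<Longrightarrow> Im z \<noteq> 0 \<Longrightarrow>
       (\<Sum>i<n. G i i) = (\<Sum>r\<leftarrow>rs. 1 / (of_real r - z))"
proof -
  have M: "M \<in> carrier_mat n n" by (simp add: M_def)
  obtain rs where rs: "length rs = n" "char_poly M = (\<Prod>r\<leftarrow>rs. [:- r, 1:])"
    unfolding M_def by (rule char_poly_symmetric_real[of A n, OF sym])
  obtain B P Q where sch: "schur_decomposition M rs = (B, P, Q)" by (cases "schur_decomposition M rs")
  from schur_decomposition[OF M rs(2) sch] have wit: "similar_mat_wit M B P Q"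
    and ut: "upper_triangular B" and diag: "diag_mat B = rs" by auto
  note w = similar_mat_witD2[OF M wit]
  have sum_diag: "(\<Sum>i<n. f (B $$ (i, i))) = (\<Sum>r\<leftarrow>rs. f r)" for f :: "real \<Rightarrow> 'c::comm_monoid_add"
    unfolding diag[symmetric] diag_mat_def using w(5)
    by (simp add: o_def atLeast0LessThan[symmetric] interv_sum_list_conv_sum_set_nat)
  show thesis
  proof (rule that[OF rs(1)])
    show "proots (char_poly M) = mset rs" unfolding rs(2) by (rule proots_prod_linear_factors)
    fix k
    have "M ^\<^sub>m k = P * B ^\<^sub>m k * Q" by (rule similar_mat_wit_pow_id[OF wit])
    then have "mat_trace (M ^\<^sub>m k) = mat_trace (B ^\<^sub>m k)"
      using w by (simp add: mat_trace_conjugate[of _ n])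
    also have "\<dots> = (\<Sum>i<n. (B $$ (i, i)) ^ k)"
      using upper_triangular_pow_diag[OF w(5) ut, of k] w(5) by (simp add: mat_trace_def)
    finally show "mat_trace (M ^\<^sub>m k) = (\<Sum>r\<leftarrow>rs. r ^ k)" by (simp add: sum_diag[of "\<lambda>r. r ^ k"])
  next
    fix z G assume G: "resolvent_on {..<n} A z G" and z: "Im z \<noteq> 0"
      let ?h = "map_mat complex_of_real"
    have c: "?h B \<in> carrier_mat n n" "?h P \<in> carrier_mat n n" "?h Q \<in> carrier_mat n n" "?h M \<in> carrier_mat n n"
      using w by auto
    have PQ: "?h P * ?h Q = 1\<^sub>m n" "?h Q * ?h P = 1\<^sub>m n" "?h M = ?h P * ?h B * ?h Q"
      using w by (simp_all add: of_real_hom.mat_hom_mult[symmetric, of _ n n _ n] of_real_hom.mat_hom_one)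
    define X where "X = Matrix.mat n n (\<lambda>(i, j). G i j)"
    have X: "X \<in> carrier_mat n n" by (simp add: X_def)
    have MX: "?h M * X = z \<cdot>\<^sub>m X + 1\<^sub>m n"
    proof (rule eq_matI)
      fix i j assume "i < dim_row (z \<cdot>\<^sub>m X + 1\<^sub>m n)" "j < dim_col (z \<cdot>\<^sub>m X + 1\<^sub>m n)"
      then have ij: "i < n" "j < n" by auto
      have "(?h M * X) $$ (i, j) = (\<Sum>k<n. of_real (A i k) * G k j)"
        unfolding index_mult_mat_sum[OF c(4) X ij] using ij by (intro sum.cong) (auto simp: M_def X_def)
      also have "\<dots> = z * G i j + of_bool (i = j)" using resolvent_onD[OF G] ij by auto
      finally show "(?h M * X) $$ (i, j) = (z \<cdot>\<^sub>m X + 1\<^sub>m n) $$ (i, j)" using ij by (simp add: X_def)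
    qed (use c X in auto)
    define Y where "Y = ?h Q * X * ?h P"
    have Y: "Y \<in> carrier_mat n n" using c X by (auto simp: Y_def)
    note as = assoc_mult_mat[of _ n n _ n _ n]
    have QM: "?h B * ?h Q = ?h Q * ?h M"
    proof -
      have "?h Q * ?h M = (?h Q * ?h P) * (?h B * ?h Q)" unfolding PQ(3) using c by (simp add: as)
      then show ?thesis using c unfolding PQ(2) by simp
    qed
    have "?h B * Y = (?h B * ?h Q) * X * ?h P" using c X by (simp add: Y_def as)
    also have "\<dots> = ?h Q * (?h M * X) * ?h P" using c X by (simp add: QM as)
    also have "\<dots> = z \<cdot>\<^sub>m Y + 1\<^sub>m n"
      unfolding MX using c X PQ(2)
      by (simp add: Y_def mult_add_distrib_mat[of _ n n _ n] add_mult_distrib_mat[of _ n n]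
          mult_smult_distrib[of _ n n _ n] mult_smult_assoc_mat[of _ n n _ n])
    finally have BY: "?h B * Y = z \<cdot>\<^sub>m Y + 1\<^sub>m n" .
    have "Y $$ (i, i) = 1 / (?h B $$ (i, i) - z)" if i: "i < n" for i
    proof (rule upper_triangular_resolvent_diag[OF c(1) _ Y _ _ i])
      show "upper_triangular (?h B)"
      proof (rule upper_triangularI)
        fix i j assume "j < i" "i < dim_row (?h B)"
        then show "?h B $$ (i, j) = 0" using upper_triangularD[OF ut, of j i] w(5) by simp
      qed
      show "(\<Sum>j<n. ?h B $$ (i, j) * Y $$ (j, k)) = z * Y $$ (i, k) + of_bool (i = k)"
        if "i < n" "k < n" for i k
      proof -
        have "(\<Sum>j<n. ?h B $$ (i, j) * Y $$ (j, k)) = (?h B * Y) $$ (i, k)"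
          by (rule index_mult_mat_sum[OF c(1) Y that, symmetric])
        also have "\<dots> = z * Y $$ (i, k) + of_bool (i = k)" unfolding BY using that Y by simp
        finally show ?thesis .
      qed
      show "?h B $$ (i, i) \<noteq> z" if "i < n" for i
        using that w(5) z by auto
    qed
    then have "mat_trace Y = (\<Sum>i<n. 1 / (of_real (B $$ (i, i)) - z))"
      using Y w(5) by (simp add: mat_trace_def)
    moreover have "mat_trace Y = mat_trace X"
      unfolding Y_def using c X PQ by (intro mat_trace_conjugate[of _ n]) auto
    moreover have "mat_trace X = (\<Sum>i<n. G i i)" by (simp add: mat_trace_def X_def)
    ultimately show "(\<Sum>i<n. G i i) = (\<Sum>r\<leftarrow>rs. 1 / (of_real r - z))"
      by (simp add: sum_diag[of "\<lambda>r. 1 / (of_real r - z)"])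
  qed
qed

section \<open>Concentration of quadratic forms\<close>

lemma borel_measurable_cnj [measurable (raw)]:
  "f \<in> borel_measurable N \<Longrightarrow> (\<lambda>x. cnj (f x)) \<in> borel_measurable N"
  by (rule borel_measurable_continuous_on[OF continuous_on_cnj[OF continuous_on_id]])

lemma sigma_sets_vimage_subset:
  assumes "F \<in> measurable (vimage_algebra X Y N) T"
  shows "sigma_sets X {F -` A \<inter> X |A. A \<in> sets T} \<subseteq> sigma_sets X {Y -` A \<inter> X |A. A \<in> sets N}"
proof -
  have "{F -` A \<inter> X |A. A \<in> sets T} \<subseteq> sets (vimage_algebra X Y N)"
    using measurable_sets[OF assms] by auto
  from sets.sigma_sets_subset[OF this] show ?thesis
    by (simp add: sets_vimage_algebra)
qed

lemma measurable_vimage_algebra_imp: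
  assumes Y: "Y \<in> measurable M N" and F: "F \<in> measurable (vimage_algebra (space M) Y N) T"
  shows "F \<in> measurable M T"
proof -
  have "Y \<in> space M \<rightarrow> space N" using measurable_space[OF Y] by auto
  then have "sets (vimage_algebra (space M) Y N) \<subseteq> sets M"
    using measurable_sets[OF Y] by (auto simp: sets_vimage_algebra2)
  then show ?thesis using F by (auto simp: measurable_def)
qed

text \<open>Independence passes to everything measurable with respect to the generated
  sigma-algebras. Resolvent entries can then be treated as functions of a block of variables without
  being written as such a composition.\<close>

lemma (in prob_space) indep_var_vimage_algebra:
  assumes ind: "indep_var S X N Y"
    and H: "H \<in> measurable (vimage_algebra (space M) X S) T1"
    and F: "F \<in> measurable (vimage_algebra (space M) Y N) T2"
  shows "indep_var T1 H T2 F"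
proof -
  let ?s = "\<lambda>X S. sigma_sets (space M) {X -` A \<inter> space M |A. A \<in> sets S}"
  have X: "X \<in> measurable M S" and Y: "Y \<in> measurable M N" and ind': "indep_set (?s X S) (?s Y N)"
    using ind unfolding indep_var_eq by auto
  have "indep_set (?s H T1) (?s F T2)"
    unfolding indep_set_def
    by (rule indep_sets_mono_sets[OF ind'[unfolded indep_set_def]])
       (use sigma_sets_vimage_subset[OF H] sigma_sets_vimage_subset[OF F] in \<open>simp split: bool.split\<close>)
  then show ?thesis
    unfolding indep_var_eq using measurable_vimage_algebra_imp[OF X H] measurable_vimage_algebra_imp[OF Y F] by simp
qed

lemma (in prob_space) orthogonal_sum_second_moment:
  fixes X :: "'p \<Rightarrow> 'a \<Rightarrow> complex"
  assumes fin: "finite P" and [measurable]: "\<And>p. p \<in> P \<Longrightarrow> X p \<in> borel_measurable M"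
    and bd: "\<And>p \<omega>. p \<in> P \<Longrightarrow> cmod (X p \<omega>) \<le> B"
    and orth: "\<And>p q. p \<in> P \<Longrightarrow> q \<in> P \<Longrightarrow> p \<noteq> q \<Longrightarrow> (LINT \<omega>|M. X p \<omega> * cnj (X q \<omega>)) = 0"
  shows "(LINT \<omega>|M. (cmod (\<Sum>p\<in>P. X p \<omega>))\<^sup>2) = (\<Sum>p\<in>P. LINT \<omega>|M. (cmod (X p \<omega>))\<^sup>2)"
proof -
  have int: "integrable M (\<lambda>\<omega>. X p \<omega> * cnj (X q \<omega>))" if "p \<in> P" "q \<in> P" for p q
  proof (rule integrable_const_bound[where B="B * B"])
    have "0 \<le> B" using order.trans[OF norm_ge_zero bd[OF that(1)]] .
    then show "AE \<omega> in M. cmod (X p \<omega> * cnj (X q \<omega>)) \<le> B * B"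
      using bd that by (auto simp: norm_mult intro!: mult_mono)
  qed (use that in measurable)
  have "complex_of_real (LINT \<omega>|M. (cmod (\<Sum>p\<in>P. X p \<omega>))\<^sup>2) = (LINT \<omega>|M. complex_of_real ((cmod (\<Sum>p\<in>P. X p \<omega>))\<^sup>2))"
    by (rule integral_complex_of_real[symmetric])
  also have "\<dots> = (LINT \<omega>|M. (\<Sum>p\<in>P. \<Sum>q\<in>P. X p \<omega> * cnj (X q \<omega>)))"
    by (intro Bochner_Integration.integral_cong refl)
       (simp only: complex_norm_square cnj_sum sum_product)
  also have "\<dots> = (\<Sum>p\<in>P. \<Sum>q\<in>P. LINT \<omega>|M. X p \<omega> * cnj (X q \<omega>))"
    using int by (simp add: Bochner_Integration.integral_sum Bochner_Integration.integrable_sum)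
  also have "\<dots> = (\<Sum>p\<in>P. LINT \<omega>|M. X p \<omega> * cnj (X p \<omega>))"
  proof (intro sum.cong refl)
    fix p assume p: "p \<in> P"
    have "(\<Sum>q\<in>P. LINT \<omega>|M. X p \<omega> * cnj (X q \<omega>)) = (\<Sum>q\<in>{p}. LINT \<omega>|M. X p \<omega> * cnj (X q \<omega>))"
      using fin p orth by (intro sum.mono_neutral_right) auto
    then show "(\<Sum>q\<in>P. LINT \<omega>|M. X p \<omega> * cnj (X q \<omega>)) = (LINT \<omega>|M. X p \<omega> * cnj (X p \<omega>))" by simp
  qed
  also have "\<dots> = (\<Sum>p\<in>P. LINT \<omega>|M. complex_of_real ((cmod (X p \<omega>))\<^sup>2))"
    by (simp only: complex_norm_square)
  also have "\<dots> = complex_of_real (\<Sum>p\<in>P. LINT \<omega>|M. (cmod (X p \<omega>))\<^sup>2)"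
    by (simp only: integral_complex_of_real of_real_sum)
  finally show ?thesis using of_real_eq_iff by blast
qed

lemma sum_square_symmetric:
  fixes f :: "'j::linorder \<Rightarrow> 'j \<Rightarrow> 'b::comm_ring_1"
  assumes "finite J" "\<And>j k. j \<in> J \<Longrightarrow> k \<in> J \<Longrightarrow> f j k = f k j"
  shows "(\<Sum>j\<in>J. \<Sum>k\<in>J. f j k) = (\<Sum>j\<in>J. f j j) + 2 * (\<Sum>(j,k)\<in>{(j,k)\<in>J \<times> J. j < k}. f j k)"
proof -
  let ?P = "{(j,k)\<in>J \<times> J. j < k}" and ?Q = "{(j,k)\<in>J \<times> J. k < j}" and ?D = "(\<lambda>j. (j, j)) ` J"
  have "(\<Sum>j\<in>J. \<Sum>k\<in>J. f j k) = (\<Sum>(j,k)\<in>J \<times> J. f j k)"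
    by (rule sum.cartesian_product)
  also have "J \<times> J = ?D \<union> (?P \<union> ?Q)" by force
  also have "(\<Sum>(j,k)\<in>\<dots>. f j k) = (\<Sum>(j,k)\<in>?D. f j k) + ((\<Sum>(j,k)\<in>?P. f j k) + (\<Sum>(j,k)\<in>?Q. f j k))"
  proof -
    have fin: "finite ?D" "finite ?P" "finite ?Q"
      using assms(1) by (auto intro: finite_subset[of _ "J \<times> J"])
    have "?D \<inter> (?P \<union> ?Q) = {}" "?P \<inter> ?Q = {}" by auto
    then show ?thesis using fin by (simp add: sum.union_disjoint)
  qed
  also have "(\<Sum>(j,k)\<in>?D. f j k) = (\<Sum>j\<in>J. f j j)"
    by (subst sum.reindex) (auto simp: inj_on_def)
  also have "(\<Sum>(j,k)\<in>?Q. f j k) = (\<Sum>(j,k)\<in>?P. f j k)"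
    by (rule sum.reindex_bij_witness[of _ "\<lambda>(j,k). (k,j)" "\<lambda>(j,k). (k,j)"]) (auto simp: assms(2))
  finally show ?thesis by simp
qed

text \<open>The centred form splits into a diagonal part \<open>Y\<close> and an off-diagonal part
  \<open>X\<close> over pairs \<open>j < k\<close>, and both are sums of orthogonal terms.
  \<open>N j\<close> stands for the information that is independent of \<open>b j\<close>;
  independence enters only through \<open>orth1\<close> and \<open>orth2\<close>, which say that
  \<open>b j\<close> and its centred square integrate to zero against it. The factor
  \<open>T^2\<close> is what makes the bound small after truncation.\<close>

lemma (in prob_space) quadratic_form_concentration:
  fixes b :: "'j::linorder \<Rightarrow> 'a \<Rightarrow> real" and G :: "'j \<Rightarrow> 'j \<Rightarrow> 'a \<Rightarrow> complex" and N :: "'j \<Rightarrow> 'a measure"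
  assumes fin: "finite J" and T: "T \<ge> 0" and B: "B \<ge> 0"
    and b[measurable]: "\<And>j. j \<in> J \<Longrightarrow> b j \<in> borel_measurable M"
    and G[measurable]: "\<And>j k. j \<in> J \<Longrightarrow> k \<in> J \<Longrightarrow> G j k \<in> borel_measurable M"
    and bbd: "\<And>j \<omega>. j \<in> J \<Longrightarrow> \<bar>b j \<omega>\<bar> \<le> T"
    and Gbd: "\<And>j \<omega>. j \<in> J \<Longrightarrow> (\<Sum>k\<in>J. (cmod (G j k \<omega>))\<^sup>2) \<le> B\<^sup>2"
    and Gsym: "\<And>j k \<omega>. j \<in> J \<Longrightarrow> k \<in> J \<Longrightarrow> G j k \<omega> = G k j \<omega>"
    and s: "\<And>j. j \<in> J \<Longrightarrow> s j = (LINT \<omega>|M. (b j \<omega>)\<^sup>2)"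
    and bN: "\<And>j k. j \<in> J \<Longrightarrow> k \<in> J \<Longrightarrow> k \<noteq> j \<Longrightarrow> b k \<in> borel_measurable (N j)"
    and GN: "\<And>j k l. j \<in> J \<Longrightarrow> k \<in> J \<Longrightarrow> l \<in> J \<Longrightarrow> G k l \<in> borel_measurable (N j)"
    and orth1: "\<And>j F C. j \<in> J \<Longrightarrow> F \<in> borel_measurable (N j) \<Longrightarrow> (\<And>\<omega>. cmod (F \<omega>) \<le> C) \<Longrightarrow>
       (LINT \<omega>|M. of_real (b j \<omega>) * F \<omega>) = 0"
    and orth2: "\<And>j F C. j \<in> J \<Longrightarrow> F \<in> borel_measurable (N j) \<Longrightarrow> (\<And>\<omega>. cmod (F \<omega>) \<le> C) \<Longrightarrow>
       (LINT \<omega>|M. of_real ((b j \<omega>)\<^sup>2 - s j) * F \<omega>) = 0"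
  shows "(LINT \<omega>|M. (cmod ((\<Sum>j\<in>J. \<Sum>k\<in>J. of_real (b j \<omega>) * of_real (b k \<omega>) * G j k \<omega>)
            - (\<Sum>j\<in>J. of_real (s j) * G j j \<omega>)))\<^sup>2) \<le> 12 * T\<^sup>2 * B\<^sup>2 * (\<Sum>j\<in>J. s j)"
proof -
  have G1: "cmod (G j k \<omega>) \<le> B" if "j \<in> J" "k \<in> J" for j k \<omega>
  proof -
    have "(cmod (G j k \<omega>))\<^sup>2 \<le> (\<Sum>k\<in>J. (cmod (G j k \<omega>))\<^sup>2)"
      using fin that by (intro member_le_sum) auto
    also have "\<dots> \<le> B\<^sup>2" by (rule Gbd[OF that(1)])
    finally show ?thesis using B by (rule power2_le_imp_le)
  qed
  have b2: "(b j \<omega>)\<^sup>2 \<le> T\<^sup>2" if "j \<in> J" for j \<omega>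
    using power_mono[OF bbd[OF that, of \<omega>], of 2] by simp
  have intb: "integrable M (\<lambda>\<omega>. (b j \<omega>)\<^sup>2)" if "j \<in> J" for j
    using that b2 by (intro integrable_const_bound[where B="T\<^sup>2"]) auto
  have intbG: "integrable M (\<lambda>\<omega>. (b j \<omega>)\<^sup>2 * (cmod (G j k \<omega>))\<^sup>2)" if "j \<in> J" "k \<in> J" for j k
  proof (rule integrable_const_bound[where B="T\<^sup>2 * B\<^sup>2"])
    have "(b j \<omega>)\<^sup>2 * (cmod (G j k \<omega>))\<^sup>2 \<le> T\<^sup>2 * B\<^sup>2" for \<omega>
      by (rule mult_mono[OF b2[OF that(1)] power_mono[OF G1[OF that]]]) auto
    then show "AE \<omega> in M. norm ((b j \<omega>)\<^sup>2 * (cmod (G j k \<omega>))\<^sup>2) \<le> T\<^sup>2 * B\<^sup>2" by simp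
  qed (use that in measurable)
  have s01: "0 \<le> s j" "s j \<le> T\<^sup>2" if "j \<in> J" for j
  proof -
    show "0 \<le> s j" unfolding s[OF that] by simp
    show "s j \<le> T\<^sup>2" unfolding s[OF that] by (rule integral_le_const[OF intb[OF that]]) (use b2 that in auto)
  qed
  have var: "\<bar>(b j \<omega>)\<^sup>2 - s j\<bar> \<le> T\<^sup>2" if "j \<in> J" for j \<omega>
    using b2[OF that, of \<omega>] s01[OF that] zero_le_power2[of "b j \<omega>"] unfolding abs_le_iff by linarith
  define P where "P = {(j,k)\<in>J \<times> J. j < k}"
  have finP: "finite P" unfolding P_def using fin by (auto intro: finite_subset[of _ "J \<times> J"])
  define X where "X = (\<lambda>(j,k) \<omega>. complex_of_real (b j \<omega>) * of_real (b k \<omega>) * G j k \<omega>)"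
  define Y where "Y j \<omega> = complex_of_real ((b j \<omega>)\<^sup>2 - s j) * G j j \<omega>" for j \<omega>
  have [measurable]: "X p \<in> borel_measurable M" if "p \<in> P" for p
    using that unfolding X_def P_def by (auto split: prod.split)
  have [measurable]: "Y j \<in> borel_measurable M" if "j \<in> J" for j
    using that unfolding Y_def by measurable
  have Xbd: "cmod (X p \<omega>) \<le> T * T * B" if "p \<in> P" for p \<omega>
    using that T bbd G1 unfolding X_def P_def
    by (auto simp: norm_mult split: prod.split intro!: mult_mono)
  have Ybd: "cmod (Y j \<omega>) \<le> T\<^sup>2 * B" if "j \<in> J" for j \<omega>
    using that var G1 unfolding Y_def by (simp only: norm_mult norm_of_real) (intro mult_mono, auto)
  have split: "(\<Sum>j\<in>J. \<Sum>k\<in>J. of_real (b j \<omega>) * of_real (b k \<omega>) * G j k \<omega>) - (\<Sum>j\<in>J. of_real (s j) * G j j \<omega>)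
     = (\<Sum>j\<in>J. Y j \<omega>) + 2 * (\<Sum>p\<in>P. X p \<omega>)" for \<omega>
  proof -
    have "(\<Sum>j\<in>J. \<Sum>k\<in>J. of_real (b j \<omega>) * of_real (b k \<omega>) * G j k \<omega>) =
      (\<Sum>j\<in>J. of_real (b j \<omega>) * of_real (b j \<omega>) * G j j \<omega>) + 2 * (\<Sum>(j,k)\<in>P. of_real (b j \<omega>) * of_real (b k \<omega>) * G j k \<omega>)"
      unfolding P_def using Gsym by (intro sum_square_symmetric fin) (simp add: mult_ac)
    moreover have "(\<Sum>(j,k)\<in>P. of_real (b j \<omega>) * of_real (b k \<omega>) * G j k \<omega>) = (\<Sum>p\<in>P. X p \<omega>)"
      by (intro sum.cong) (auto simp: X_def)
    ultimately show ?thesis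
      by (simp add: Y_def sum_subtractf algebra_simps power2_eq_square)
  qed
  have X2: "(LINT \<omega>|M. (cmod (\<Sum>p\<in>P. X p \<omega>))\<^sup>2) = (\<Sum>p\<in>P. LINT \<omega>|M. (cmod (X p \<omega>))\<^sup>2)"
  proof (rule orthogonal_sum_second_moment[OF finP _ Xbd])
    fix p q assume pq: "p \<in> P" "q \<in> P" "p \<noteq> q"
    obtain j k l m where [simp]: "p = (j, k)" "q = (l, m)" by (cases p, cases q)
    have J: "j \<in> J" "k \<in> J" "l \<in> J" "m \<in> J" "j < k" "l < m" using pq by (auto simp: P_def)
    \<comment> \<open>two distinct unordered pairs differ, so some index occurs exactly once among \<open>j, k, l, m\<close>\<close>
    have van: "(LINT \<omega>|M. X p \<omega> * cnj (X q \<omega>)) = 0"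
      if eq: "\<And>\<omega>. X p \<omega> * cnj (X q \<omega>) = of_real (b i \<omega>) * (of_real (b i' \<omega>) * of_real (b l \<omega>) * of_real (b m \<omega>) * G j k \<omega> * cnj (G l m \<omega>))"
        and i: "i \<in> J" "i' \<in> J" "i' \<noteq> i" "l \<noteq> i" "m \<noteq> i" for i i'
      unfolding eq
    proof (rule orth1[OF i(1)])
      show "(\<lambda>\<omega>. of_real (b i' \<omega>) * of_real (b l \<omega>) * of_real (b m \<omega>) * G j k \<omega> * cnj (G l m \<omega>)) \<in> borel_measurable (N i)"
      proof -
        have [measurable]: "b i' \<in> borel_measurable (N i)" "b l \<in> borel_measurable (N i)" "b m \<in> borel_measurable (N i)"
          "G j k \<in> borel_measurable (N i)" "G l m \<in> borel_measurable (N i)"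
          using i J by (auto intro: bN GN)
        show ?thesis by measurable
      qed
      show "cmod (of_real (b i' \<omega>) * of_real (b l \<omega>) * of_real (b m \<omega>) * G j k \<omega> * cnj (G l m \<omega>)) \<le> T * T * T * B * B" for \<omega>
        using i J T B bbd G1 by (auto simp: norm_mult intro!: mult_mono)
    qed
    consider "j \<notin> {l, m}" | "k \<notin> {l, m}"
      using pq(3) J by (cases "j = l"; cases "j = m"; cases "k = l"; cases "k = m") auto
    then show "(LINT \<omega>|M. X p \<omega> * cnj (X q \<omega>)) = 0"
    proof cases
      case 1
      then show ?thesis using J by (intro van[of j k]) (auto simp: X_def)
    next
      case 2
      then show ?thesis using J by (intro van[of k j]) (auto simp: X_def mult_ac)
    qed
  qed auto
  \<comment> \<open>Only \<open>b k\<close> is replaced by its bound \<open>T\<close>. Keeping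
    \<open>b j\<close> leaves its variance, and the sum of \<open>(cmod (G j k))^2\<close> over
    \<open>k\<close> is then at most \<open>B^2\<close>, so the number of pairs does not
    enter.\<close>
  also have "\<dots> \<le> (\<Sum>(j,k)\<in>P. T\<^sup>2 * (LINT \<omega>|M. (b j \<omega>)\<^sup>2 * (cmod (G j k \<omega>))\<^sup>2))"
  proof (rule sum_mono)
    fix p assume p: "p \<in> P"
    obtain j k where [simp]: "p = (j, k)" by (cases p)
    have J: "j \<in> J" "k \<in> J" using p by (auto simp: P_def)
    have "(LINT \<omega>|M. (cmod (X p \<omega>))\<^sup>2) \<le> (LINT \<omega>|M. T\<^sup>2 * ((b j \<omega>)\<^sup>2 * (cmod (G j k \<omega>))\<^sup>2))"
    proof (rule integral_mono')
      show "integrable M (\<lambda>\<omega>. T\<^sup>2 * ((b j \<omega>)\<^sup>2 * (cmod (G j k \<omega>))\<^sup>2))"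
        by (intro integrable_mult_right intbG J)
      show "(cmod (X p \<omega>))\<^sup>2 \<le> T\<^sup>2 * ((b j \<omega>)\<^sup>2 * (cmod (G j k \<omega>))\<^sup>2)" for \<omega>
        using mult_right_mono[OF b2[OF J(2), of \<omega>], of "(b j \<omega>)\<^sup>2 * (cmod (G j k \<omega>))\<^sup>2"]
        by (simp add: X_def norm_mult power_mult_distrib mult_ac)
    qed auto
    then show "(LINT \<omega>|M. (cmod (X p \<omega>))\<^sup>2) \<le> (case p of (j, k) \<Rightarrow> T\<^sup>2 * (LINT \<omega>|M. (b j \<omega>)\<^sup>2 * (cmod (G j k \<omega>))\<^sup>2))"
      by simp
  qed
  also have "\<dots> \<le> (\<Sum>(j,k)\<in>J \<times> J. T\<^sup>2 * (LINT \<omega>|M. (b j \<omega>)\<^sup>2 * (cmod (G j k \<omega>))\<^sup>2))"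
    using fin by (intro sum_mono2) (auto simp: P_def intro!: mult_nonneg_nonneg)
  also have "\<dots> = T\<^sup>2 * (\<Sum>j\<in>J. \<Sum>k\<in>J. LINT \<omega>|M. (b j \<omega>)\<^sup>2 * (cmod (G j k \<omega>))\<^sup>2)"
    by (simp add: sum.cartesian_product sum_distrib_left case_prod_unfold)
  also have "\<dots> \<le> T\<^sup>2 * (\<Sum>j\<in>J. B\<^sup>2 * s j)"
  proof (intro mult_left_mono sum_mono)
    fix j assume j: "j \<in> J"
    note int = intbG[OF j]
    have "(\<Sum>k\<in>J. LINT \<omega>|M. (b j \<omega>)\<^sup>2 * (cmod (G j k \<omega>))\<^sup>2) = (LINT \<omega>|M. (b j \<omega>)\<^sup>2 * (\<Sum>k\<in>J. (cmod (G j k \<omega>))\<^sup>2))"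
      using int by (simp add: sum_distrib_left Bochner_Integration.integral_sum)
    also have "\<dots> \<le> (LINT \<omega>|M. B\<^sup>2 * (b j \<omega>)\<^sup>2)"
    proof (rule integral_mono')
      show "integrable M (\<lambda>\<omega>. B\<^sup>2 * (b j \<omega>)\<^sup>2)" using intb[OF j] by simp
      show "(b j \<omega>)\<^sup>2 * (\<Sum>k\<in>J. (cmod (G j k \<omega>))\<^sup>2) \<le> B\<^sup>2 * (b j \<omega>)\<^sup>2" for \<omega>
        using mult_left_mono[OF Gbd[OF j, of \<omega>], of "(b j \<omega>)\<^sup>2"] by (simp add: mult.commute)
    qed auto
    also have "\<dots> = B\<^sup>2 * s j" unfolding s[OF j] by simp
    finally show "(\<Sum>k\<in>J. LINT \<omega>|M. (b j \<omega>)\<^sup>2 * (cmod (G j k \<omega>))\<^sup>2) \<le> B\<^sup>2 * s j" .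
  qed auto
  finally have X3: "(LINT \<omega>|M. (cmod (\<Sum>p\<in>P. X p \<omega>))\<^sup>2) \<le> T\<^sup>2 * B\<^sup>2 * (\<Sum>j\<in>J. s j)"
    by (simp add: sum_distrib_left mult.assoc)
  have Y2: "(LINT \<omega>|M. (cmod (\<Sum>j\<in>J. Y j \<omega>))\<^sup>2) = (\<Sum>j\<in>J. LINT \<omega>|M. (cmod (Y j \<omega>))\<^sup>2)"
  proof (rule orthogonal_sum_second_moment[OF fin _ Ybd])
    fix j k assume jk: "j \<in> J" "k \<in> J" "j \<noteq> k"
    have "(LINT \<omega>|M. Y j \<omega> * cnj (Y k \<omega>)) = (LINT \<omega>|M. of_real ((b j \<omega>)\<^sup>2 - s j) * (G j j \<omega> * cnj (Y k \<omega>)))"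
      by (simp add: Y_def mult_ac)
    also have "\<dots> = 0"
    proof (rule orth2[OF jk(1)])
      have [measurable]: "b k \<in> borel_measurable (N j)" "G j j \<in> borel_measurable (N j)" "G k k \<in> borel_measurable (N j)"
        using jk by (auto intro: bN GN)
      show "(\<lambda>\<omega>. G j j \<omega> * cnj (Y k \<omega>)) \<in> borel_measurable (N j)"
        unfolding Y_def by measurable
      show "cmod (G j j \<omega> * cnj (Y k \<omega>)) \<le> B * (T\<^sup>2 * B)" for \<omega>
        using jk G1 Ybd[OF jk(2), of \<omega>] B by (auto simp: norm_mult intro!: mult_mono)
    qed
    finally show "(LINT \<omega>|M. Y j \<omega> * cnj (Y k \<omega>)) = 0" .
  qed auto
  also have "\<dots> \<le> (\<Sum>j\<in>J. 2 * T\<^sup>2 * B\<^sup>2 * s j)"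
  proof (rule sum_mono)
    fix j assume j: "j \<in> J"
    have "(LINT \<omega>|M. (cmod (Y j \<omega>))\<^sup>2) \<le> (LINT \<omega>|M. T\<^sup>2 * B\<^sup>2 * ((b j \<omega>)\<^sup>2 + s j))"
    proof (rule integral_mono')
      show "integrable M (\<lambda>\<omega>. T\<^sup>2 * B\<^sup>2 * ((b j \<omega>)\<^sup>2 + s j))" using intb[OF j] by simp
      fix \<omega>
      \<comment> \<open>One factor is bounded by \<open>T^2\<close> and the other by
        \<open>(b j)^2 + s j\<close>, whose mean is \<open>2 * s j\<close>; this replaces a fourth
        moment by the variance.\<close>
      have "((b j \<omega>)\<^sup>2 - s j)\<^sup>2 = \<bar>(b j \<omega>)\<^sup>2 - s j\<bar> * \<bar>(b j \<omega>)\<^sup>2 - s j\<bar>"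
        by (simp add: power2_eq_square)
      also have "\<dots> \<le> T\<^sup>2 * ((b j \<omega>)\<^sup>2 + s j)"
      proof (rule mult_mono[OF var[OF j]])
        show "\<bar>(b j \<omega>)\<^sup>2 - s j\<bar> \<le> (b j \<omega>)\<^sup>2 + s j"
          using s01[OF j] zero_le_power2[of "b j \<omega>"] unfolding abs_le_iff by linarith
      qed auto
      finally have v: "((b j \<omega>)\<^sup>2 - s j)\<^sup>2 \<le> T\<^sup>2 * ((b j \<omega>)\<^sup>2 + s j)" .
      have "(cmod (Y j \<omega>))\<^sup>2 = ((b j \<omega>)\<^sup>2 - s j)\<^sup>2 * (cmod (G j j \<omega>))\<^sup>2"
        unfolding Y_def norm_mult norm_of_real power_mult_distrib by simp
      also have "\<dots> \<le> T\<^sup>2 * ((b j \<omega>)\<^sup>2 + s j) * B\<^sup>2"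
        using v G1[OF j j, of \<omega>] s01[OF j] B by (intro mult_mono power_mono) auto
      finally show "(cmod (Y j \<omega>))\<^sup>2 \<le> T\<^sup>2 * B\<^sup>2 * ((b j \<omega>)\<^sup>2 + s j)" by (simp add: mult_ac)
      show "0 \<le> T\<^sup>2 * B\<^sup>2 * ((b j \<omega>)\<^sup>2 + s j)" using s01[OF j] by simp
    qed
    also have "\<dots> = 2 * T\<^sup>2 * B\<^sup>2 * s j"
      using intb[OF j] by (simp add: s[OF j, symmetric] prob_space)
    finally show "(LINT \<omega>|M. (cmod (Y j \<omega>))\<^sup>2) \<le> 2 * T\<^sup>2 * B\<^sup>2 * s j" .
  qed
  finally have Y3: "(LINT \<omega>|M. (cmod (\<Sum>j\<in>J. Y j \<omega>))\<^sup>2) \<le> 2 * T\<^sup>2 * B\<^sup>2 * (\<Sum>j\<in>J. s j)"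
    by (simp add: sum_distrib_left)
  have iX: "integrable M (\<lambda>\<omega>. (cmod (\<Sum>p\<in>P. X p \<omega>))\<^sup>2)"
  proof (rule integrable_const_bound[where B="(\<Sum>p\<in>P. T * T * B)\<^sup>2"])
    show "AE \<omega> in M. norm ((cmod (\<Sum>p\<in>P. X p \<omega>))\<^sup>2) \<le> (\<Sum>p\<in>P. T * T * B)\<^sup>2"
    proof (rule AE_I2)
      fix \<omega>
      have "cmod (\<Sum>p\<in>P. X p \<omega>) \<le> (\<Sum>p\<in>P. T * T * B)" by (rule order.trans[OF norm_sum sum_mono[OF Xbd]])
      from power_mono[OF this, of 2] show "norm ((cmod (\<Sum>p\<in>P. X p \<omega>))\<^sup>2) \<le> (\<Sum>p\<in>P. T * T * B)\<^sup>2" by simp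
    qed
  qed measurable
  have iY: "integrable M (\<lambda>\<omega>. (cmod (\<Sum>j\<in>J. Y j \<omega>))\<^sup>2)"
  proof (rule integrable_const_bound[where B="(\<Sum>j\<in>J. T\<^sup>2 * B)\<^sup>2"])
    show "AE \<omega> in M. norm ((cmod (\<Sum>j\<in>J. Y j \<omega>))\<^sup>2) \<le> (\<Sum>j\<in>J. T\<^sup>2 * B)\<^sup>2"
    proof (rule AE_I2)
      fix \<omega>
      have "cmod (\<Sum>j\<in>J. Y j \<omega>) \<le> (\<Sum>j\<in>J. T\<^sup>2 * B)" by (rule order.trans[OF norm_sum sum_mono[OF Ybd]])
      from power_mono[OF this, of 2] show "norm ((cmod (\<Sum>j\<in>J. Y j \<omega>))\<^sup>2) \<le> (\<Sum>j\<in>J. T\<^sup>2 * B)\<^sup>2" by simp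
    qed
  qed measurable
  have "(LINT \<omega>|M. (cmod ((\<Sum>j\<in>J. Y j \<omega>) + 2 * (\<Sum>p\<in>P. X p \<omega>)))\<^sup>2)
     \<le> (LINT \<omega>|M. 2 * (cmod (\<Sum>j\<in>J. Y j \<omega>))\<^sup>2 + 8 * (cmod (\<Sum>p\<in>P. X p \<omega>))\<^sup>2)"
  proof (rule integral_mono')
    show "integrable M (\<lambda>\<omega>. 2 * (cmod (\<Sum>j\<in>J. Y j \<omega>))\<^sup>2 + 8 * (cmod (\<Sum>p\<in>P. X p \<omega>))\<^sup>2)"
      using iX iY by simp
    \<comment> \<open>The weights 2 and 8 meet bounds with the constants 2 for \<open>Y\<close> and
      1 for \<open>X\<close>, which adds up to 12.\<close>
    have par: "(cmod (u + 2 * v))\<^sup>2 \<le> 2 * (cmod u)\<^sup>2 + 8 * (cmod v)\<^sup>2" for u v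
    proof -
      have "(cmod (u + 2 * v))\<^sup>2 \<le> (cmod u + 2 * cmod v)\<^sup>2"
        using norm_triangle_ineq[of u "2 * v"] by (intro power_mono) (auto simp: norm_mult)
      also have "\<dots> \<le> 2 * (cmod u)\<^sup>2 + 8 * (cmod v)\<^sup>2"
        using zero_le_power2[of "cmod u - 2 * cmod v"] by (simp add: power2_eq_square algebra_simps)
      finally show ?thesis .
    qed
    show "(cmod ((\<Sum>j\<in>J. Y j \<omega>) + 2 * (\<Sum>p\<in>P. X p \<omega>)))\<^sup>2 \<le> 2 * (cmod (\<Sum>j\<in>J. Y j \<omega>))\<^sup>2 + 8 * (cmod (\<Sum>p\<in>P. X p \<omega>))\<^sup>2" for \<omega>
      by (rule par)
  qed auto
  also have "\<dots> = 2 * (LINT \<omega>|M. (cmod (\<Sum>j\<in>J. Y j \<omega>))\<^sup>2) + 8 * (LINT \<omega>|M. (cmod (\<Sum>p\<in>P. X p \<omega>))\<^sup>2)"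
    using iX iY by simp
  also have "\<dots> \<le> 12 * T\<^sup>2 * B\<^sup>2 * (\<Sum>j\<in>J. s j)" using X3 Y3 by simp
  finally show ?thesis unfolding split .
qed

text \<open>The deterministic part of the argument. The difference between the quadratic form and
  \<open>m\<close> is telescoped through \<open>\<Sum> s j * G j j\<close>,
  \<open>\<Sum> s j * R j j\<close> and \<open>m * \<Sum> s j\<close>, with one term of the bound
  for each step. The prefactor comes from the bounds on \<open>R i i\<close> and \<open>m\<close>,
  and it supplies the later contraction.\<close>

lemma diagonal_resolvent_estimate:
  assumes fin: "finite I" and sym: "\<And>i j. A i j = A j i" and i: "i \<in> I"
    and R: "resolvent_on I A z R" and G: "resolvent_on (I - {i}) A z G" and z: "Im z > 0"
    and m: "m * (- z - m) = 1" "cmod m \<le> 1 / Im z"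
    and s: "\<And>j. j \<in> I \<Longrightarrow> 0 \<le> s j" "\<And>j. j \<in> I \<Longrightarrow> s j \<le> t"
  shows "cmod (R i i - m) \<le> (1 / (Im z)\<^sup>2) * (\<bar>A i i\<bar> +
      cmod ((\<Sum>j\<in>I-{i}. \<Sum>k\<in>I-{i}. of_real (A i j) * of_real (A i k) * G j k) - (\<Sum>j\<in>I-{i}. of_real (s j) * G j j))
      + t / Im z + (\<Sum>j\<in>I-{i}. s j * cmod (R j j - m)) + \<bar>(\<Sum>j\<in>I-{i}. s j) - 1\<bar> / Im z)"
proof -
  let ?J = "I - {i}"
  let ?Q = "\<Sum>j\<in>?J. \<Sum>k\<in>?J. of_real (A i j) * of_real (A i k) * G j k"
  let ?S = "\<Sum>j\<in>?J. of_real (s j) * G j j"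
  have R1: "R i i * (of_real (A i i) - z - ?Q) = 1"
    by (rule schur_complement(1)[OF fin sym i R G z])
  have Rne: "R i i \<noteq> 0" using R1 by auto
  have Rb: "cmod (R i i) \<le> 1 / Im z" by (rule resolvent_on_diag_bound[OF fin sym R i z])
  have t0: "0 \<le> t" using s[OF i] by linarith
  have "R i i - m = R i i * (m * (- z - m)) - m * (R i i * (of_real (A i i) - z - ?Q))"
    unfolding R1 m(1) by simp
  also have "\<dots> = R i i * m * (?Q - m - of_real (A i i))" by (simp add: algebra_simps)
  also have "?Q - m - of_real (A i i) = - of_real (A i i) + (?Q - ?S)
      + (\<Sum>j\<in>?J. of_real (s j) * (G j j - R j j)) + (\<Sum>j\<in>?J. of_real (s j) * (R j j - m))
      + m * of_real ((\<Sum>j\<in>?J. s j) - 1)"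
    by (simp add: algebra_simps sum_subtractf sum_distrib_left sum.distrib)
  finally have "cmod (R i i - m) = cmod (R i i) * cmod m * cmod (- of_real (A i i) + (?Q - ?S)
      + (\<Sum>j\<in>?J. of_real (s j) * (G j j - R j j)) + (\<Sum>j\<in>?J. of_real (s j) * (R j j - m))
      + m * of_real ((\<Sum>j\<in>?J. s j) - 1))" (is "_ = _ * _ * cmod ?E") by (simp only: norm_mult)
  also have "\<dots> \<le> (1 / Im z) * (1 / Im z) * (\<bar>A i i\<bar> + cmod (?Q - ?S) + t / Im z
      + (\<Sum>j\<in>?J. s j * cmod (R j j - m)) + \<bar>(\<Sum>j\<in>?J. s j) - 1\<bar> / Im z)"
  proof (intro mult_mono Rb m(2))
    \<comment> \<open>Each difference \<open>R j j - G j j\<close> is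
      \<open>(R j i)^2 / R i i\<close>. The Ward bound on the column is proportional to
      \<open>cmod (R i i)\<close> and so compensates the division.\<close>
    have minor: "cmod (\<Sum>j\<in>?J. of_real (s j) * (G j j - R j j)) \<le> t / Im z"
    proof -
      have "cmod (\<Sum>j\<in>?J. of_real (s j) * (G j j - R j j)) \<le> (\<Sum>j\<in>?J. t * ((cmod (R j i))\<^sup>2 / cmod (R i i)))"
      proof (rule order.trans[OF norm_sum sum_mono])
        fix j assume j: "j \<in> ?J"
        have "R j j - G j j = (R j i)\<^sup>2 / R i i"
          using schur_complement(2)[OF fin sym i R G z j] Rne by (simp add: field_simps)
        then have "cmod (G j j - R j j) = (cmod (R j i))\<^sup>2 / cmod (R i i)"
          by (metis norm_divide norm_minus_commute norm_power)
        then show "cmod (of_real (s j) * (G j j - R j j)) \<le> t * ((cmod (R j i))\<^sup>2 / cmod (R i i))"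
          using s[of j] j unfolding norm_mult by (auto intro!: mult_right_mono divide_right_mono)
      qed
      also have "\<dots> = t * ((\<Sum>j\<in>?J. (cmod (R j i))\<^sup>2) / cmod (R i i))"
        by (simp add: sum_distrib_left sum_divide_distrib)
      also have "\<dots> \<le> t * ((cmod (R i i) / Im z) / cmod (R i i))"
      proof (intro mult_left_mono divide_right_mono t0)
        have "(\<Sum>j\<in>?J. (cmod (R j i))\<^sup>2) \<le> (\<Sum>j\<in>I. (cmod (R j i))\<^sup>2)"
          using fin by (intro sum_mono2) auto
        also have "\<dots> \<le> cmod (R i i) / Im z" by (rule resolvent_on_column_bound[OF fin sym R i z])
        finally show "(\<Sum>j\<in>?J. (cmod (R j i))\<^sup>2) \<le> cmod (R i i) / Im z" .
      qed auto
      also have "\<dots> = t / Im z" using Rne by simp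
      finally show ?thesis .
    qed
    have diag: "cmod (\<Sum>j\<in>?J. of_real (s j) * (R j j - m)) \<le> (\<Sum>j\<in>?J. s j * cmod (R j j - m))"
      using s(1) by (intro order.trans[OF norm_sum] sum_mono) (auto simp: norm_mult)
    have last: "cmod (m * of_real ((\<Sum>j\<in>?J. s j) - 1)) \<le> \<bar>(\<Sum>j\<in>?J. s j) - 1\<bar> / Im z"
      using mult_right_mono[OF m(2), of "\<bar>(\<Sum>j\<in>?J. s j) - 1\<bar>"] unfolding norm_mult norm_of_real by simp
    have tri: "cmod (a + b + c + d + e) \<le> cmod a + cmod b + cmod c + cmod d + cmod e" for a b c d e
      by (meson add_mono norm_triangle_ineq norm_triangle_le order_refl)
    show "cmod ?E \<le> \<bar>A i i\<bar> + cmod (?Q - ?S) + t / Im z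
      + (\<Sum>j\<in>?J. s j * cmod (R j j - m)) + \<bar>(\<Sum>j\<in>?J. s j) - 1\<bar> / Im z"
      by (rule order.trans[OF tri]) (intro add_mono minor diag last, auto)
  qed (use z in auto)
  finally show ?thesis by (simp add: power2_eq_square)
qed

section \<open>The averaged self-consistent equation\<close>

text \<open>Applied with \<open>c = \<tau>\<close>: a small error receives the weight
  \<open>1 / \<tau>\<close> and the bounded factor beside it the weight \<tau>.\<close>

lemma weighted_young_ineq: "0 < c \<Longrightarrow> x * y \<le> (x\<^sup>2 / c + c * y\<^sup>2) / 2" for x y c :: real
  using zero_le_power2[of "x - c * y"] by (simp add: field_simps power2_eq_square)

text \<open>
  \<open>\<xi>\<close> is the upper triangle of the normalized matrix, \<open>\<zeta> p (\<xi> p)\<close> the truncated and recentred entry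
  at position \<open>p\<close>, and \<open>l p\<close> its contribution to the Lindeberg sum.
\<close>

locale indep_symmetric_array = prob_space M for M :: "'a measure" +
  fixes n :: nat and \<xi> :: "nat \<times> nat \<Rightarrow> 'a \<Rightarrow> real" and \<zeta> :: "nat \<times> nat \<Rightarrow> real \<Rightarrow> real"
    and l :: "nat \<times> nat \<Rightarrow> real" and \<tau> K :: real
  assumes indep: "indep_vars (\<lambda>_. borel) \<xi> {(i, j). 1 \<le> i \<and> i \<le> j \<and> j \<le> n}"
    and \<tau>: "0 < \<tau>" "\<tau> \<le> 1"
    and \<zeta>_measurable [measurable]: "\<And>p. \<zeta> p \<in> borel_measurable borel"
    and \<zeta>_bound: "\<And>p x. \<bar>\<zeta> p x\<bar> \<le> 2 * \<tau>"
    and square_integrable: "\<And>i j. 1 \<le> i \<Longrightarrow> i \<le> j \<Longrightarrow> j \<le> n \<Longrightarrow> integrable M (\<lambda>\<omega>. (\<xi> (i, j) \<omega>)\<^sup>2)"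
    and \<zeta>_mean: "\<And>i j. 1 \<le> i \<Longrightarrow> i \<le> j \<Longrightarrow> j \<le> n \<Longrightarrow> expectation (\<lambda>\<omega>. \<zeta> (i, j) (\<xi> (i, j) \<omega>)) = 0"
    and \<zeta>_variance: "\<And>i j. 1 \<le> i \<Longrightarrow> i \<le> j \<Longrightarrow> j \<le> n \<Longrightarrow>
        expectation (\<lambda>\<omega>. (\<zeta> (i, j) (\<xi> (i, j) \<omega>))\<^sup>2) \<le> expectation (\<lambda>\<omega>. (\<xi> (i, j) \<omega>)\<^sup>2)"
      "\<And>i j. 1 \<le> i \<Longrightarrow> i \<le> j \<Longrightarrow> j \<le> n \<Longrightarrow> expectation (\<lambda>\<omega>. (\<xi> (i, j) \<omega>)\<^sup>2)
        \<le> expectation (\<lambda>\<omega>. (\<zeta> (i, j) (\<xi> (i, j) \<omega>))\<^sup>2) + 2 * l (i, j)"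
    and \<zeta>_error: "\<And>i j. 1 \<le> i \<Longrightarrow> i \<le> j \<Longrightarrow> j \<le> n \<Longrightarrow>
        expectation (\<lambda>\<omega>. (\<xi> (i, j) \<omega> - \<zeta> (i, j) (\<xi> (i, j) \<omega>))\<^sup>2) \<le> l (i, j)"
    and row_variance: "\<And>i. i \<in> {1..n} \<Longrightarrow>
        (\<Sum>j\<in>{1..n}. expectation (\<lambda>\<omega>. (\<xi> (min i j, max i j) \<omega>)\<^sup>2)) \<le> K"
begin

abbreviation "E \<equiv> {(i, j). 1 \<le> i \<and> i \<le> j \<and> j \<le> n}"
abbreviation "I \<equiv> {1..n}"

text \<open>\<open>min\<close> and \<open>max\<close> extend the upper triangle to an array that is
  symmetric at all indices, as the resolvent lemmas require, also outside the index range.\<close>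

definition A :: "'a \<Rightarrow> nat \<Rightarrow> nat \<Rightarrow> real" where "A \<omega> i j = \<xi> (min i j, max i j) \<omega>"
definition b :: "'a \<Rightarrow> nat \<Rightarrow> nat \<Rightarrow> real" where "b \<omega> i j = \<zeta> (min i j, max i j) (A \<omega> i j)"

definition v :: "nat \<Rightarrow> nat \<Rightarrow> real" where "v i j = expectation (\<lambda>\<omega>. (A \<omega> i j)\<^sup>2)"
definition s :: "nat \<Rightarrow> nat \<Rightarrow> real" where "s i j = expectation (\<lambda>\<omega>. (b \<omega> i j)\<^sup>2)"
definition L :: "nat \<Rightarrow> real" where "L i = (\<Sum>j\<in>I. l (min i j, max i j))"

lemma E_mem: "i \<in> I \<Longrightarrow> j \<in> I \<Longrightarrow> (min i j, max i j) \<in> E"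
  by auto

lemma A_sym: "A \<omega> i j = A \<omega> j i" and v_sym: "v i j = v j i"
  by (simp_all add: A_def v_def min.commute max.commute)

lemma \<xi>_measurable: "p \<in> E \<Longrightarrow> \<xi> p \<in> borel_measurable M"
  using indep unfolding indep_vars_def by auto

lemma A_measurable [measurable]: "i \<in> I \<Longrightarrow> j \<in> I \<Longrightarrow> (\<lambda>\<omega>. A \<omega> i j) \<in> borel_measurable M"
  unfolding A_def by (rule \<xi>_measurable[OF E_mem])

lemma b_measurable [measurable]: "i \<in> I \<Longrightarrow> j \<in> I \<Longrightarrow> (\<lambda>\<omega>. b \<omega> i j) \<in> borel_measurable M"
  unfolding b_def by measurable

lemma b_bound: "\<bar>b \<omega> i j\<bar> \<le> 2 * \<tau>"
  unfolding b_def by (rule \<zeta>_bound)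

lemma b_square_bound: "(b \<omega> i j)\<^sup>2 \<le> 4 * \<tau>\<^sup>2"
  using power_mono[OF b_bound, of \<omega> i j 2] by (simp add: power_mult_distrib)

lemma A_square_integrable: "i \<in> I \<Longrightarrow> j \<in> I \<Longrightarrow> integrable M (\<lambda>\<omega>. (A \<omega> i j)\<^sup>2)"
  unfolding A_def by (rule square_integrable) auto

lemma b_square_integrable: "i \<in> I \<Longrightarrow> j \<in> I \<Longrightarrow> integrable M (\<lambda>\<omega>. (b \<omega> i j)\<^sup>2)"
  using b_square_bound by (intro integrable_const_bound[where B="4 * \<tau>\<^sup>2"]) auto

lemma error_square_integrable:
  assumes "i \<in> I" "j \<in> I"
  shows "integrable M (\<lambda>\<omega>. (A \<omega> i j - b \<omega> i j)\<^sup>2)"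
proof (rule Bochner_Integration.integrable_bound)
  show "integrable M (\<lambda>\<omega>. 2 * (A \<omega> i j)\<^sup>2 + 2 * (b \<omega> i j)\<^sup>2)"
    using A_square_integrable[OF assms] b_square_integrable[OF assms] by simp
  have "(x - y)\<^sup>2 \<le> 2 * x\<^sup>2 + 2 * y\<^sup>2" for x y :: real
    using zero_le_power2[of "x + y"] by (simp add: power2_eq_square algebra_simps)
  then show "AE \<omega> in M. norm ((A \<omega> i j - b \<omega> i j)\<^sup>2) \<le> norm (2 * (A \<omega> i j)\<^sup>2 + 2 * (b \<omega> i j)\<^sup>2)"
    by simp
qed (use assms in measurable)

lemma s_le_v: "i \<in> I \<Longrightarrow> j \<in> I \<Longrightarrow> s i j \<le> v i j"
  and v_le_s: "i \<in> I \<Longrightarrow> j \<in> I \<Longrightarrow> v i j \<le> s i j + 2 * l (min i j, max i j)"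
  and error_le: "i \<in> I \<Longrightarrow> j \<in> I \<Longrightarrow> expectation (\<lambda>\<omega>. (A \<omega> i j - b \<omega> i j)\<^sup>2) \<le> l (min i j, max i j)"
  unfolding s_def v_def b_def A_def
  by (rule \<zeta>_variance \<zeta>_error; auto)+

lemma s_bounds: "i \<in> I \<Longrightarrow> j \<in> I \<Longrightarrow> 0 \<le> s i j" "i \<in> I \<Longrightarrow> j \<in> I \<Longrightarrow> s i j \<le> 4 * \<tau>\<^sup>2"
  unfolding s_def using b_square_bound b_square_integrable
  by (auto intro!: integral_le_const)

lemma l_nonneg: "i \<in> I \<Longrightarrow> j \<in> I \<Longrightarrow> 0 \<le> l (min i j, max i j)"
  by (rule order.trans[OF _ error_le]) auto

lemma row_sum_v: "i \<in> I \<Longrightarrow> (\<Sum>j\<in>I. v i j) \<le> K"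
  unfolding v_def A_def by (rule row_variance)

text \<open>The information carried by all entries except the one at position \<open>p\<close>.\<close>

definition complement_algebra :: "nat \<times> nat \<Rightarrow> 'a measure" where
  "complement_algebra p =
     vimage_algebra (space M) (\<lambda>\<omega>. \<lambda>q\<in>E - {p}. \<xi> q \<omega>) (PiM (E - {p}) (\<lambda>_. borel))"

lemma complement_algebra_measurable:
  assumes q: "q \<in> E" "q \<noteq> p"
  shows "\<xi> q \<in> borel_measurable (complement_algebra p)"
proof -
  have "(\<lambda>\<omega>. \<lambda>q\<in>E - {p}. \<xi> q \<omega>) \<in> measurable (complement_algebra p) (PiM (E - {p}) (\<lambda>_. borel))"
    unfolding complement_algebra_def by (rule measurable_vimage_algebra1) (auto simp: space_PiM)
  from measurable_compose[OF this measurable_component_singleton[of q]]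
  show ?thesis using q by simp
qed

text \<open>The family is split into the blocks \<open>{p}\<close> and \<open>E - {p}\<close>.
  \<open>F\<close> enters only through measurability for the second block, which covers resolvent
  entries of minors.\<close>

lemma expectation_mult_complement:
  fixes h :: "real \<Rightarrow> complex"
  assumes p: "p \<in> E" and [measurable]: "h \<in> borel_measurable borel"
    and F: "F \<in> borel_measurable (complement_algebra p)"
    and hb: "\<And>x. cmod (h x) \<le> B" and Fb: "\<And>\<omega>. cmod (F \<omega>) \<le> C"
  shows "expectation (\<lambda>\<omega>. h (\<xi> p \<omega>) * F \<omega>) = expectation (\<lambda>\<omega>. h (\<xi> p \<omega>)) * expectation F"
proof -
  have "indep_var (PiM {p} (\<lambda>_. borel)) (\<lambda>\<omega>. \<lambda>q\<in>{p}. \<xi> q \<omega>)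
      (PiM (E - {p}) (\<lambda>_. borel)) (\<lambda>\<omega>. \<lambda>q\<in>E - {p}. \<xi> q \<omega>)"
    using p by (intro indep_var_restrict[OF indep]) auto
  then have ind: "indep_var borel (\<lambda>\<omega>. h (\<xi> p \<omega>)) borel F"
  proof (rule indep_var_vimage_algebra[OF _ _ F[unfolded complement_algebra_def]])
    have "(\<lambda>\<omega>. \<lambda>q\<in>{p}. \<xi> q \<omega>) \<in> measurable (vimage_algebra (space M) (\<lambda>\<omega>. \<lambda>q\<in>{p}. \<xi> q \<omega>) (PiM {p} (\<lambda>_. borel))) (PiM {p} (\<lambda>_. borel))"
      by (rule measurable_vimage_algebra1) (auto simp: space_PiM)
    from measurable_compose[OF this measurable_component_singleton[of p]]
    have [measurable]: "\<xi> p \<in> borel_measurable (vimage_algebra (space M) (\<lambda>\<omega>. \<lambda>q\<in>{p}. \<xi> q \<omega>) (PiM {p} (\<lambda>_. borel)))"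
      by simp
    show "(\<lambda>\<omega>. h (\<xi> p \<omega>)) \<in> borel_measurable (vimage_algebra (space M) (\<lambda>\<omega>. \<lambda>q\<in>{p}. \<xi> q \<omega>) (PiM {p} (\<lambda>_. borel)))"
      by measurable
  qed
  have "F \<in> borel_measurable M" "\<xi> p \<in> borel_measurable M"
    using ind \<xi>_measurable[OF p] unfolding indep_var_eq by auto
  then have "integrable M F" "integrable M (\<lambda>\<omega>. h (\<xi> p \<omega>))"
    using hb Fb by (auto intro!: integrable_const_bound)
  then show ?thesis by (intro indep_var_lebesgue_integral[OF ind])
qed

section \<open>Fluctuation of the quadratic form of a truncated row\<close>

definition W :: "nat \<Rightarrow> complex \<Rightarrow> 'a \<Rightarrow> complex" where
  "W i z \<omega> = (\<Sum>j\<in>I-{i}. \<Sum>k\<in>I-{i}. of_real (b \<omega> i j) * of_real (b \<omega> i k) * resolvent (I - {i}) (A \<omega>) z j k)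
     - (\<Sum>j\<in>I-{i}. of_real (s i j) * resolvent (I - {i}) (A \<omega>) z j j)"

lemma resolvent_on_A:
  assumes "J \<subseteq> I" "Im z > 0"
  shows "resolvent_on J (A \<omega>) z (resolvent J (A \<omega>) z)"
  using assms by (intro resolvent_on_resolvent A_sym) (auto intro: finite_subset)

lemma resolvent_A_measurable:
  assumes "J \<subseteq> I" "j \<in> J" "k \<in> J"
  shows "(\<lambda>\<omega>. resolvent J (A \<omega>) z j k) \<in> borel_measurable M"
  using assms by (intro measurable_resolvent A_measurable) (auto intro: finite_subset)

lemma W_measurable: "i \<in> I \<Longrightarrow> W i z \<in> borel_measurable M"
proof -
  assume i: "i \<in> I"
  have [measurable]: "(\<lambda>\<omega>. resolvent (I - {i}) (A \<omega>) z j k) \<in> borel_measurable M"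
    if "j \<in> I - {i}" "k \<in> I - {i}" for j k using that by (intro resolvent_A_measurable) auto
  have [measurable]: "(\<lambda>\<omega>. b \<omega> i j) \<in> borel_measurable M" if "j \<in> I - {i}" for j
    using i that by auto
  show ?thesis unfolding W_def by measurable
qed

text \<open>Every position in row \<open>i\<close> involves the index \<open>i\<close> and no
  position in the minor does, so the minor is measurable without any given entry of the row. The
  concentration bound with \<open>T = 2 * \<tau>\<close> and \<open>B = 1 / Im z\<close> has the
  constant \<open>12 * 4 = 48\<close>.\<close>

lemma W_second_moment:
  assumes i: "i \<in> I" and z: "Im z > 0"
  shows "expectation (\<lambda>\<omega>. (cmod (W i z \<omega>))\<^sup>2) \<le> 48 * \<tau>\<^sup>2 * K / (Im z)\<^sup>2"
proof -
  let ?J = "I - {i}" and ?G = "\<lambda>j k \<omega>. resolvent (I - {i}) (A \<omega>) z j k"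
  let ?N = "\<lambda>j. complement_algebra (min i j, max i j)"
  have fin: "finite ?J" by simp
  note G = resolvent_on_A[of ?J z, OF Diff_subset z]
  have pE: "(min i j, max i j) \<in> E" if "j \<in> ?J" for j using i that by auto
  have pne: "(min i k, max i k) \<noteq> (min i j, max i j)" if "j \<in> ?J" "k \<in> ?J" "j \<noteq> k" for j k
    using that by (auto simp: min_def max_def split: if_splits)
  have qne: "(min k l, max k l) \<noteq> (min i j, max i j)" if "k \<in> ?J" "l \<in> ?J" for j k l
    using that by (auto simp: min_def max_def split: if_splits)
  have meanb: "expectation (\<lambda>\<omega>. b \<omega> i j) = 0" if "j \<in> ?J" for j
    unfolding b_def A_def by (rule \<zeta>_mean) (use pE[OF that] in auto)
  have "expectation (\<lambda>\<omega>. (cmod ((\<Sum>j\<in>?J. \<Sum>k\<in>?J. of_real (b \<omega> i j) * of_real (b \<omega> i k) * ?G j k \<omega>)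
            - (\<Sum>j\<in>?J. of_real (s i j) * ?G j j \<omega>)))\<^sup>2) \<le> 12 * (2 * \<tau>)\<^sup>2 * (1 / Im z)\<^sup>2 * (\<Sum>j\<in>?J. s i j)"
  proof (rule quadratic_form_concentration[where N = ?N, OF fin])
    show "(\<lambda>\<omega>. b \<omega> i j) \<in> borel_measurable M" if "j \<in> ?J" for j using i that by auto
    show "?G j k \<in> borel_measurable M" if "j \<in> ?J" "k \<in> ?J" for j k
      using that by (intro resolvent_A_measurable) auto
    show "?G j k \<omega> = ?G k j \<omega>" if "j \<in> ?J" "k \<in> ?J" for j k \<omega>
      by (rule resolvent_on_sym[OF fin A_sym G that])
    show "(\<Sum>k\<in>?J. (cmod (?G j k \<omega>))\<^sup>2) \<le> (1 / Im z)\<^sup>2" if j: "j \<in> ?J" for j \<omega>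
    proof -
      have "(\<Sum>k\<in>?J. (cmod (?G j k \<omega>))\<^sup>2) = (\<Sum>k\<in>?J. (cmod (?G k j \<omega>))\<^sup>2)"
        using resolvent_on_sym[OF fin A_sym G j] by (intro sum.cong) auto
      also have "\<dots> \<le> 1 / (Im z)\<^sup>2" by (rule resolvent_on_column_bound'[OF fin A_sym G j z])
      finally show ?thesis by (simp add: power_divide)
    qed
    show "(\<lambda>\<omega>. b \<omega> i k) \<in> borel_measurable (?N j)" if "j \<in> ?J" "k \<in> ?J" "k \<noteq> j" for j k
    proof -
      have [measurable]: "\<xi> (min i k, max i k) \<in> borel_measurable (?N j)"
        using that by (intro complement_algebra_measurable pE pne) auto
      show ?thesis unfolding b_def A_def by measurable
    qed
    show "?G k l \<in> borel_measurable (?N j)" if "j \<in> ?J" "k \<in> ?J" "l \<in> ?J" for j k l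
    proof (rule measurable_resolvent[OF fin _ that(2,3)])
      fix k l assume kl: "k \<in> ?J" "l \<in> ?J"
      then show "(\<lambda>\<omega>. A \<omega> k l) \<in> borel_measurable (?N j)"
        unfolding A_def by (intro complement_algebra_measurable qne E_mem) auto
    qed
    fix j F and C :: real assume j: "j \<in> ?J" and F: "F \<in> borel_measurable (?N j)" and C: "\<And>\<omega>. cmod (F \<omega>) \<le> C"
    let ?p = "(min i j, max i j)"
    have "expectation (\<lambda>\<omega>. of_real (\<zeta> ?p (\<xi> ?p \<omega>)) * F \<omega>) = expectation (\<lambda>\<omega>. complex_of_real (\<zeta> ?p (\<xi> ?p \<omega>))) * expectation F"
      using \<zeta>_bound by (intro expectation_mult_complement[where h="\<lambda>x. of_real (\<zeta> ?p x)", OF pE[OF j] _ F _ C]) auto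
    then show "expectation (\<lambda>\<omega>. of_real (b \<omega> i j) * F \<omega>) = 0"
      using meanb[OF j] by (simp add: b_def A_def)
    have "expectation (\<lambda>\<omega>. of_real ((\<zeta> ?p (\<xi> ?p \<omega>))\<^sup>2 - s i j) * F \<omega>)
        = expectation (\<lambda>\<omega>. complex_of_real ((\<zeta> ?p (\<xi> ?p \<omega>))\<^sup>2 - s i j)) * expectation F"
    proof (rule expectation_mult_complement[where h="\<lambda>x. of_real ((\<zeta> ?p x)\<^sup>2 - s i j)", OF pE[OF j] _ F _ C])
      show "cmod (complex_of_real ((\<zeta> ?p x)\<^sup>2 - s i j)) \<le> 4 * \<tau>\<^sup>2 + \<bar>s i j\<bar>" for x
      proof -
        have "(\<zeta> ?p x)\<^sup>2 \<le> 4 * \<tau>\<^sup>2"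
          using power_mono[OF \<zeta>_bound[of ?p x], of 2] by (simp add: power_mult_distrib)
        then show ?thesis unfolding norm_of_real using zero_le_power2[of "\<zeta> ?p x"] by linarith
      qed
    qed auto
    moreover have "expectation (\<lambda>\<omega>. complex_of_real ((b \<omega> i j)\<^sup>2 - s i j)) = of_real (expectation (\<lambda>\<omega>. (b \<omega> i j)\<^sup>2 - s i j))"
      by (rule integral_complex_of_real)
    moreover have "expectation (\<lambda>\<omega>. (b \<omega> i j)\<^sup>2 - s i j) = 0"
    proof -
      have "expectation (\<lambda>\<omega>. (b \<omega> i j)\<^sup>2 - s i j) = expectation (\<lambda>\<omega>. (b \<omega> i j)\<^sup>2) - expectation (\<lambda>_. s i j)"
        using i j by (intro Bochner_Integration.integral_diff b_square_integrable) auto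
      then show ?thesis by (simp add: prob_space s_def)
    qed
    ultimately show "expectation (\<lambda>\<omega>. of_real ((b \<omega> i j)\<^sup>2 - s i j) * F \<omega>) = 0"
      by (simp add: b_def A_def)
  qed (use \<tau> z b_bound in \<open>auto simp: s_def\<close>)
  also have "\<dots> = 48 * \<tau>\<^sup>2 / (Im z)\<^sup>2 * (\<Sum>j\<in>?J. s i j)" by (simp add: power_mult_distrib power_divide)
  also have "\<dots> \<le> 48 * \<tau>\<^sup>2 / (Im z)\<^sup>2 * K"
  proof (intro mult_left_mono)
    have "(\<Sum>j\<in>?J. s i j) \<le> (\<Sum>j\<in>I. s i j)" using i s_bounds by (intro sum_mono2) auto
    also have "\<dots> \<le> (\<Sum>j\<in>I. v i j)" using i by (intro sum_mono s_le_v)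
    also have "\<dots> \<le> K" by (rule row_sum_v[OF i])
    finally show "(\<Sum>j\<in>?J. s i j) \<le> K" .
  qed auto
  finally show ?thesis by (simp add: W_def)
qed

definition D :: "complex \<Rightarrow> complex \<Rightarrow> nat \<Rightarrow> real" where
  "D z m i = expectation (\<lambda>\<omega>. cmod (resolvent I (A \<omega>) z i i - m))"

lemma D_integrable:
  assumes z: "Im z > 0" and i: "i \<in> I"
  shows "integrable M (\<lambda>\<omega>. cmod (resolvent I (A \<omega>) z i i - m))"
proof (rule integrable_const_bound[where B="1 / Im z + cmod m"])
  have [measurable]: "(\<lambda>\<omega>. resolvent I (A \<omega>) z i i) \<in> borel_measurable M"
    using i by (intro resolvent_A_measurable) auto
  show "(\<lambda>\<omega>. cmod (resolvent I (A \<omega>) z i i - m)) \<in> borel_measurable M" by measurable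
  have "cmod (resolvent I (A \<omega>) z i i - m) \<le> 1 / Im z + cmod m" for \<omega>
    using resolvent_on_diag_bound[OF _ A_sym resolvent_on_A i z, of \<omega>] z
    by (intro order.trans[OF norm_triangle_ineq4] add_mono) auto
  then show "AE \<omega> in M. norm (cmod (resolvent I (A \<omega>) z i i - m)) \<le> 1 / Im z + cmod m" by simp
qed

text \<open>With \<open>d = a - b\<close>, the identity \<open>F a a - F b b = F d a + F b d\<close>
  makes every truncation term linear in \<open>d\<close>. For \<open>Im z \<ge> 1\<close> the form
  is bounded by the product of Euclidean norms, and the weighted Young inequality gives
  \<open>d\<close> the weight \<open>1 / \<tau>\<close> and its partner the weight \<tau>.\<close>

lemma quadratic_form_truncation:
  assumes i: "i \<in> I" and z: "Im z \<ge> 1"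
  defines "J \<equiv> I - {i}"
  shows "cmod ((\<Sum>j\<in>J. \<Sum>k\<in>J. of_real (A \<omega> i j) * of_real (A \<omega> i k) * resolvent J (A \<omega>) z j k)
      - (\<Sum>j\<in>J. of_real (s i j) * resolvent J (A \<omega>) z j j))
    \<le> (\<Sum>j\<in>J. (A \<omega> i j - b \<omega> i j)\<^sup>2) / \<tau> + \<tau> * ((\<Sum>j\<in>J. (A \<omega> i j)\<^sup>2) + (\<Sum>j\<in>J. (b \<omega> i j)\<^sup>2)) / 2
      + ((cmod (W i z \<omega>))\<^sup>2 / \<tau> + \<tau>) / 2"
proof -
  let ?G = "resolvent J (A \<omega>) z"
  define F where "F x y = (\<Sum>j\<in>J. \<Sum>k\<in>J. of_real (x j) * of_real (y k) * ?G j k)" for x y :: "nat \<Rightarrow> real"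
  have z0: "Im z > 0" using z by simp
  have Jf: "finite J" and JI: "J \<subseteq> I" by (auto simp: J_def)
  have Fb: "cmod (F x y) \<le> sqrt (\<Sum>j\<in>J. (x j)\<^sup>2) * sqrt (\<Sum>j\<in>J. (y j)\<^sup>2)" for x y
  proof -
    have "cmod (F x y) \<le> sqrt (\<Sum>j\<in>J. (x j)\<^sup>2) * sqrt (\<Sum>j\<in>J. (y j)\<^sup>2) / Im z"
      unfolding F_def by (rule resolvent_on_bilinear_bound[OF Jf A_sym resolvent_on_A[OF JI z0] z0])
    also have "\<dots> \<le> sqrt (\<Sum>j\<in>J. (x j)\<^sup>2) * sqrt (\<Sum>j\<in>J. (y j)\<^sup>2)"
      using z mult_left_mono[OF z, of "sqrt (\<Sum>j\<in>J. (x j)\<^sup>2) * sqrt (\<Sum>j\<in>J. (y j)\<^sup>2)"]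
      by (simp add: divide_le_eq sum_nonneg)
    finally show ?thesis .
  qed
  let ?a = "A \<omega> i" and ?b = "b \<omega> i" and ?d = "\<lambda>j. A \<omega> i j - b \<omega> i j"
  have "F ?a ?a - F ?b ?b = F ?d ?a + F ?b ?d"
    unfolding F_def by (simp add: sum.distrib[symmetric] sum_subtractf[symmetric] algebra_simps)
  moreover have "F ?b ?b - (\<Sum>j\<in>J. of_real (s i j) * ?G j j) = W i z \<omega>"
    by (simp add: F_def W_def J_def)
  ultimately have "F ?a ?a - (\<Sum>j\<in>J. of_real (s i j) * ?G j j) = F ?d ?a + F ?b ?d + W i z \<omega>"
    by (simp add: algebra_simps)
  then have "cmod (F ?a ?a - (\<Sum>j\<in>J. of_real (s i j) * ?G j j)) \<le> cmod (F ?d ?a) + cmod (F ?b ?d) + cmod (W i z \<omega>)"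
    using norm_triangle_ineq[of "F ?d ?a + F ?b ?d" "W i z \<omega>"] norm_triangle_ineq[of "F ?d ?a" "F ?b ?d"] by simp
  moreover have "cmod (F ?d ?a) \<le> ((\<Sum>j\<in>J. (?d j)\<^sup>2) / \<tau> + \<tau> * (\<Sum>j\<in>J. (?a j)\<^sup>2)) / 2"
    using order.trans[OF Fb weighted_young_ineq[OF \<tau>(1)], of ?d ?a] by (simp add: sum_nonneg)
  moreover have "cmod (F ?b ?d) \<le> ((\<Sum>j\<in>J. (?d j)\<^sup>2) / \<tau> + \<tau> * (\<Sum>j\<in>J. (?b j)\<^sup>2)) / 2"
    using order.trans[OF Fb[of ?b ?d, unfolded mult.commute[of "sqrt (\<Sum>j\<in>J. (?b j)\<^sup>2)"]] weighted_young_ineq[OF \<tau>(1)]] by (simp add: sum_nonneg)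
  moreover have "cmod (W i z \<omega>) \<le> ((cmod (W i z \<omega>))\<^sup>2 / \<tau> + \<tau>) / 2"
    using weighted_young_ineq[OF \<tau>(1), of "cmod (W i z \<omega>)" 1] by simp
  ultimately show ?thesis unfolding F_def by (simp add: field_simps)
qed

text \<open>Expectation of the deterministic estimate. The weights \<open>s i j\<close> are enlarged
  to \<open>v i j\<close>, whose row sums are the ones bounded by \<open>K\<close>, and the errors
  are brought to the common form of \<tau>, \<open>L i / \<tau>\<close> and the deviation of the row
  sum from 1.\<close>

lemma row_estimate:
  assumes i: "i \<in> I" and z: "Im z \<ge> 1" and m: "m * (- z - m) = 1" "cmod m \<le> 1 / Im z"
  shows "D z m i \<le> (1 / (Im z)\<^sup>2) * ((12 + 25 * K) * \<tau> + 4 * L i / \<tau> + \<bar>(\<Sum>j\<in>I. v i j) - 1\<bar>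
           + (\<Sum>j\<in>I. v i j * D z m j))"
proof -
  let ?J = "I - {i}" and ?R = "\<lambda>\<omega>. resolvent I (A \<omega>) z"
  have z0: "Im z > 0" using z by simp
  have I: "insert i ?J = I" "finite ?J" "i \<notin> ?J" using i by auto
  have ins: "(\<Sum>j\<in>I. f j) = f i + (\<Sum>j\<in>?J. f j)" for f :: "nat \<Rightarrow> real"
    using i by (simp add: sum.remove)
  have \<tau>2: "\<tau>\<^sup>2 \<le> \<tau>" using \<tau> by (simp add: power2_eq_square mult_left_le)
  define X1 where "X1 \<omega> = (\<Sum>j\<in>I. (A \<omega> i j - b \<omega> i j)\<^sup>2)" for \<omega>
  define X2 where "X2 \<omega> = (\<Sum>j\<in>I. (A \<omega> i j)\<^sup>2) + (\<Sum>j\<in>I. (b \<omega> i j)\<^sup>2)" for \<omega>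
  define X3 where "X3 \<omega> = (\<Sum>j\<in>I. v i j * cmod (?R \<omega> j j - m))" for \<omega>
  \<comment> \<open>Truncation lowers the row sum of variances by at most \<open>2 * L i\<close>,
    and leaving out the index \<open>i\<close> removes
    \<open>s i i \<le> 4 * \<tau>\<close>.\<close>
  define c where "c = \<bar>(\<Sum>j\<in>I. v i j) - 1\<bar> + 2 * L i + 4 * \<tau>"
  have s0: "0 \<le> s i i" "s i i \<le> 4 * \<tau>" using s_bounds[OF i i] \<tau>2 by auto
  have v0: "0 \<le> v i j" for j by (simp add: v_def)
  have cs: "\<bar>(\<Sum>j\<in>?J. s i j) - 1\<bar> / Im z \<le> c"
  proof -
    have "(\<Sum>j\<in>I. v i j) - 2 * L i \<le> (\<Sum>j\<in>I. s i j)"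
      using sum_mono[of I "v i" "\<lambda>j. s i j + 2 * l (min i j, max i j)"] v_le_s[OF i]
      by (simp add: sum.distrib L_def sum_distrib_left[symmetric])
    moreover have "(\<Sum>j\<in>I. s i j) \<le> (\<Sum>j\<in>I. v i j)" by (intro sum_mono s_le_v i)
    moreover have "0 \<le> L i" unfolding L_def by (intro sum_nonneg l_nonneg i)
    ultimately have "\<bar>(\<Sum>j\<in>?J. s i j) - 1\<bar> \<le> c"
      using s0 ins[of "s i"] unfolding c_def by linarith
    moreover have "\<bar>(\<Sum>j\<in>?J. s i j) - 1\<bar> / Im z \<le> \<bar>(\<Sum>j\<in>?J. s i j) - 1\<bar>"
      using z by (simp add: divide_le_eq mult_le_cancel_left1)
    ultimately show ?thesis by linarith
  qed
  have tz: "4 * \<tau>\<^sup>2 / Im z \<le> 4 * \<tau>"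
  proof -
    have "4 * \<tau>\<^sup>2 / Im z \<le> 4 * \<tau>\<^sup>2" using z by (simp add: divide_le_eq mult_le_cancel_left1)
    then show ?thesis using \<tau>2 by linarith
  qed
  \<comment> \<open>The constant 7 collects \<open>5 / 2\<close> from the diagonal entry,
    \<open>1 / 2\<close> from the Young inequality for \<open>W\<close>, and 4 from the passage from
    the minor to the full resolvent. The factor \<open>3 / 2\<close> of \<open>X1\<close> is
    \<open>1 / 2\<close> from the diagonal entry and 1 from the quadratic form.\<close>
  have pointwise: "cmod (?R \<omega> i i - m) \<le> (1 / (Im z)\<^sup>2) *
      (7 * \<tau> + X1 \<omega> / \<tau> * (3 / 2) + \<tau> * X2 \<omega> / 2 + (cmod (W i z \<omega>))\<^sup>2 / (2 * \<tau>) + X3 \<omega> + c)" for \<omega>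
  proof -
    let ?G = "resolvent ?J (A \<omega>) z"
    have "cmod (?R \<omega> i i - m) \<le> (1 / (Im z)\<^sup>2) * (\<bar>A \<omega> i i\<bar> +
      cmod ((\<Sum>j\<in>?J. \<Sum>k\<in>?J. of_real (A \<omega> i j) * of_real (A \<omega> i k) * ?G j k) - (\<Sum>j\<in>?J. of_real (s i j) * ?G j j))
      + 4 * \<tau>\<^sup>2 / Im z + (\<Sum>j\<in>?J. s i j * cmod (?R \<omega> j j - m)) + \<bar>(\<Sum>j\<in>?J. s i j) - 1\<bar> / Im z)"
      using i z0 by (intro diagonal_resolvent_estimate[OF _ A_sym i _ _ z0 m] resolvent_on_A s_bounds) auto
    also have "\<dots> \<le> (1 / (Im z)\<^sup>2) *
      (7 * \<tau> + X1 \<omega> / \<tau> * (3 / 2) + \<tau> * X2 \<omega> / 2 + (cmod (W i z \<omega>))\<^sup>2 / (2 * \<tau>) + X3 \<omega> + c)"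
    proof (rule mult_left_mono)
      have lin: "x \<le> 2 * \<tau> + (u + \<tau>) / 2" if "x \<le> y + w" "y \<le> 2 * \<tau>" "w \<le> (t + \<tau>) / 2" "t \<le> u" for x y w t u :: real
        using that by argo
      have "\<bar>A \<omega> i i\<bar> \<le> \<bar>b \<omega> i i\<bar> + \<bar>A \<omega> i i - b \<omega> i i\<bar>" by linarith
      moreover note b_bound[of \<omega> i i]
      moreover have "\<bar>A \<omega> i i - b \<omega> i i\<bar> \<le> ((A \<omega> i i - b \<omega> i i)\<^sup>2 / \<tau> + \<tau>) / 2"
        using weighted_young_ineq[OF \<tau>(1), of "\<bar>A \<omega> i i - b \<omega> i i\<bar>" 1] by simp
      moreover have "(A \<omega> i i - b \<omega> i i)\<^sup>2 / \<tau> \<le> X1 \<omega> / \<tau>"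
        unfolding X1_def using \<tau> i by (intro divide_right_mono member_le_sum) auto
      ultimately have 1: "\<bar>A \<omega> i i\<bar> \<le> 2 * \<tau> + (X1 \<omega> / \<tau> + \<tau>) / 2" by (rule lin)
      have "(\<Sum>j\<in>?J. (A \<omega> i j - b \<omega> i j)\<^sup>2) / \<tau> \<le> X1 \<omega> / \<tau>"
        unfolding X1_def using \<tau> by (intro divide_right_mono sum_mono2) auto
      moreover have "\<tau> * ((\<Sum>j\<in>?J. (A \<omega> i j)\<^sup>2) + (\<Sum>j\<in>?J. (b \<omega> i j)\<^sup>2)) / 2 \<le> \<tau> * X2 \<omega> / 2"
        unfolding X2_def using \<tau> by (intro divide_right_mono mult_left_mono add_mono sum_mono2) auto
      ultimately have 2: "cmod ((\<Sum>j\<in>?J. \<Sum>k\<in>?J. of_real (A \<omega> i j) * of_real (A \<omega> i k) * ?G j k) - (\<Sum>j\<in>?J. of_real (s i j) * ?G j j))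
         \<le> X1 \<omega> / \<tau> + \<tau> * X2 \<omega> / 2 + ((cmod (W i z \<omega>))\<^sup>2 / \<tau> + \<tau>) / 2"
        using quadratic_form_truncation[OF i z, of \<omega>] by linarith
      have 3: "(\<Sum>j\<in>?J. s i j * cmod (?R \<omega> j j - m)) \<le> X3 \<omega>"
      proof -
        have "(\<Sum>j\<in>?J. s i j * cmod (?R \<omega> j j - m)) \<le> (\<Sum>j\<in>?J. v i j * cmod (?R \<omega> j j - m))"
          using i s_le_v by (intro sum_mono mult_right_mono) auto
        also have "\<dots> \<le> X3 \<omega>" unfolding X3_def using v0 by (intro sum_mono2) auto
        finally show ?thesis .
      qed
      show "\<bar>A \<omega> i i\<bar> +
        cmod ((\<Sum>j\<in>?J. \<Sum>k\<in>?J. of_real (A \<omega> i j) * of_real (A \<omega> i k) * ?G j k) - (\<Sum>j\<in>?J. of_real (s i j) * ?G j j))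
        + 4 * \<tau>\<^sup>2 / Im z + (\<Sum>j\<in>?J. s i j * cmod (?R \<omega> j j - m)) + \<bar>(\<Sum>j\<in>?J. s i j) - 1\<bar> / Im z
        \<le> 7 * \<tau> + X1 \<omega> / \<tau> * (3 / 2) + \<tau> * X2 \<omega> / 2 + (cmod (W i z \<omega>))\<^sup>2 / (2 * \<tau>) + X3 \<omega> + c"
      proof -
        have "((cmod (W i z \<omega>))\<^sup>2 / \<tau> + \<tau>) / 2 = (cmod (W i z \<omega>))\<^sup>2 / (2 * \<tau>) + \<tau> / 2"
          by (simp add: add_divide_distrib)
        then show ?thesis using 1 2 3 tz cs by argo
      qed
    qed auto
    finally show ?thesis .
  qed
  have int1: "integrable M X1" unfolding X1_def by (intro Bochner_Integration.integrable_sum error_square_integrable i)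
  have int2: "integrable M X2" unfolding X2_def
    by (intro Bochner_Integration.integrable_add Bochner_Integration.integrable_sum A_square_integrable b_square_integrable i)
  have int3: "integrable M X3" unfolding X3_def
    by (intro Bochner_Integration.integrable_sum integrable_mult_right D_integrable z0)
  have intW: "integrable M (\<lambda>\<omega>. (cmod (W i z \<omega>))\<^sup>2)"
  proof (rule integrable_const_bound[where B="((\<Sum>j\<in>?J. \<Sum>k\<in>?J. (2 * \<tau>) * (2 * \<tau>) * (1 / Im z)) + (\<Sum>j\<in>?J. 4 * \<tau>\<^sup>2 * (1 / Im z)))\<^sup>2"])
    note [measurable] = W_measurable[OF i]
    show "(\<lambda>\<omega>. (cmod (W i z \<omega>))\<^sup>2) \<in> borel_measurable M" by measurable
    have G1: "cmod (resolvent ?J (A \<omega>) z j k) \<le> 1 / Im z" if "j \<in> ?J" "k \<in> ?J" for j k \<omega>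
      using that by (intro resolvent_on_entry_bound[OF I(2) A_sym resolvent_on_A[OF _ z0] _ _ z0]) auto
    have "cmod (W i z \<omega>) \<le> (\<Sum>j\<in>?J. \<Sum>k\<in>?J. (2 * \<tau>) * (2 * \<tau>) * (1 / Im z)) + (\<Sum>j\<in>?J. 4 * \<tau>\<^sup>2 * (1 / Im z))" for \<omega>
      unfolding W_def
    proof (rule order.trans[OF norm_triangle_ineq4], rule add_mono)
      show "cmod (\<Sum>j\<in>?J. \<Sum>k\<in>?J. of_real (b \<omega> i j) * of_real (b \<omega> i k) * resolvent ?J (A \<omega>) z j k)
        \<le> (\<Sum>j\<in>?J. \<Sum>k\<in>?J. (2 * \<tau>) * (2 * \<tau>) * (1 / Im z))"
        using b_bound \<tau> by (intro order.trans[OF norm_sum] sum_mono) (simp only: norm_mult norm_of_real, intro mult_mono G1, auto)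
      show "cmod (\<Sum>j\<in>?J. of_real (s i j) * resolvent ?J (A \<omega>) z j j) \<le> (\<Sum>j\<in>?J. 4 * \<tau>\<^sup>2 * (1 / Im z))"
      proof (intro order.trans[OF norm_sum] sum_mono)
        fix j assume j: "j \<in> ?J"
        show "cmod (of_real (s i j) * resolvent ?J (A \<omega>) z j j) \<le> 4 * \<tau>\<^sup>2 * (1 / Im z)"
          unfolding norm_mult norm_of_real using s_bounds[OF i, of j] j by (intro mult_mono G1) auto
      qed
    qed
    then show "AE \<omega> in M. norm ((cmod (W i z \<omega>))\<^sup>2)
       \<le> ((\<Sum>j\<in>?J. \<Sum>k\<in>?J. (2 * \<tau>) * (2 * \<tau>) * (1 / Im z)) + (\<Sum>j\<in>?J. 4 * \<tau>\<^sup>2 * (1 / Im z)))\<^sup>2"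
      by (intro AE_I2) (simp only: real_norm_def abs_power2 abs_ge_zero, intro power_mono, auto)
  qed
  have "D z m i \<le> expectation (\<lambda>\<omega>. (1 / (Im z)\<^sup>2) *
      (7 * \<tau> + X1 \<omega> / \<tau> * (3 / 2) + \<tau> * X2 \<omega> / 2 + (cmod (W i z \<omega>))\<^sup>2 / (2 * \<tau>) + X3 \<omega> + c))"
    unfolding D_def using int1 int2 int3 intW by (intro integral_mono D_integrable[OF z0 i] pointwise) auto
  also have "\<dots> = (1 / (Im z)\<^sup>2) * (7 * \<tau> + expectation X1 / \<tau> * (3 / 2) + \<tau> * expectation X2 / 2
      + expectation (\<lambda>\<omega>. (cmod (W i z \<omega>))\<^sup>2) / (2 * \<tau>) + expectation X3 + c)"
    using int1 int2 int3 intW by (simp add: prob_space)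
  also have "\<dots> \<le> (1 / (Im z)\<^sup>2) * ((12 + 25 * K) * \<tau> + 4 * L i / \<tau> + \<bar>(\<Sum>j\<in>I. v i j) - 1\<bar>
           + (\<Sum>j\<in>I. v i j * D z m j))"
  proof (rule mult_left_mono)
    have "expectation X1 = (\<Sum>j\<in>I. expectation (\<lambda>\<omega>. (A \<omega> i j - b \<omega> i j)\<^sup>2))"
      unfolding X1_def by (intro Bochner_Integration.integral_sum error_square_integrable i)
    also have "\<dots> \<le> L i" unfolding L_def by (intro sum_mono error_le i)
    finally have e1: "expectation X1 / \<tau> \<le> L i / \<tau>" using \<tau> by (intro divide_right_mono) auto
    have "expectation X2 = (\<Sum>j\<in>I. v i j) + (\<Sum>j\<in>I. s i j)"
      unfolding X2_def v_def s_def using A_square_integrable[OF i] b_square_integrable[OF i]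
      by (subst Bochner_Integration.integral_add)
         (auto simp: Bochner_Integration.integral_sum intro!: Bochner_Integration.integrable_sum)
    also have "\<dots> \<le> K + K"
      using row_sum_v[OF i] sum_mono[of I "s i" "v i"] s_le_v[OF i] by fastforce
    finally have e2: "\<tau> * expectation X2 / 2 \<le> \<tau> * K" using \<tau> by simp
    have K0: "0 \<le> K" using row_sum_v[OF i] sum_nonneg[of I "v i"] v0 by fastforce
    have "expectation (\<lambda>\<omega>. (cmod (W i z \<omega>))\<^sup>2) \<le> 48 * \<tau>\<^sup>2 * K / (Im z)\<^sup>2" by (rule W_second_moment[OF i z0])
    also have "\<dots> \<le> 48 * \<tau>\<^sup>2 * K / 1"
      using z K0 by (intro divide_left_mono) auto
    finally have "expectation (\<lambda>\<omega>. (cmod (W i z \<omega>))\<^sup>2) / (2 * \<tau>) \<le> 48 * \<tau>\<^sup>2 * K / (2 * \<tau>)"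
      using \<tau> by (intro divide_right_mono) auto
    then have e3: "expectation (\<lambda>\<omega>. (cmod (W i z \<omega>))\<^sup>2) / (2 * \<tau>) \<le> 24 * \<tau> * K"
      using \<tau> by (simp add: power2_eq_square mult_ac)
    have e4: "expectation X3 = (\<Sum>j\<in>I. v i j * D z m j)"
      unfolding X3_def D_def using D_integrable[OF z0]
      by (subst Bochner_Integration.integral_sum) auto
    have "0 \<le> L i" unfolding L_def by (intro sum_nonneg l_nonneg i)
    then have e5: "L i \<le> L i / \<tau>" using \<tau> by (simp add: le_divide_eq mult_left_le)
    have q0: "0 \<le> L i / \<tau>" using \<tau> \<open>0 \<le> L i\<close> by simp
    \<comment> \<open>The bounds add up to \<open>11 * \<tau>\<close> and
      \<open>7 / 2 * L i / \<tau>\<close>, rounded up to 12 and 4;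
      \<open>L i \<le> L i / \<tau>\<close> uses \<open>\<tau> \<le> 1\<close>. The 25 is 1 from
      \<open>X2\<close> plus 24 from \<open>W\<close>.\<close>
    have lin: "7 * t + x1 * (3 / 2) + x2 + w + x3 + (d + 2 * l + 4 * t) \<le> P + 4 * q + d + x3"
      if "x1 \<le> q" "l \<le> q" "0 \<le> q" "x2 \<le> k" "w \<le> 24 * k" "P = 12 * t + 25 * k" "0 \<le> t"
      for t x1 x2 x3 w d l P q k :: real
      using that by linarith
    have "7 * \<tau> + expectation X1 / \<tau> * (3 / 2) + \<tau> * expectation X2 / 2
      + expectation (\<lambda>\<omega>. (cmod (W i z \<omega>))\<^sup>2) / (2 * \<tau>) + expectation X3 + c
      \<le> (12 + 25 * K) * \<tau> + 4 * (L i / \<tau>) + \<bar>(\<Sum>j\<in>I. v i j) - 1\<bar> + expectation X3"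
      unfolding c_def
      by (rule lin[OF e1 e5 q0 e2]) (use e3 \<tau> in \<open>simp_all add: algebra_simps\<close>)
    then show "7 * \<tau> + expectation X1 / \<tau> * (3 / 2) + \<tau> * expectation X2 / 2
      + expectation (\<lambda>\<omega>. (cmod (W i z \<omega>))\<^sup>2) / (2 * \<tau>) + expectation X3 + c
      \<le> (12 + 25 * K) * \<tau> + 4 * L i / \<tau> + \<bar>(\<Sum>j\<in>I. v i j) - 1\<bar> + (\<Sum>j\<in>I. v i j * D z m j)"
      unfolding e4 by simp
  qed auto
  finally show ?thesis .
qed

text \<open>Symmetry of \<open>v\<close> turns the weight collected by \<open>D z m j\<close> under
  summation over \<open>i\<close> into a row sum, at most \<open>K\<close>. As
  \<open>2 * K \<le> (Im z)^2\<close>, half of the left side absorbs that term, which accounts for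
  the factor 2; \<open>Im z \<ge> 1\<close> then removes the remaining power.\<close>

lemma average_estimate:
  assumes z: "Im z \<ge> 1" "2 * K \<le> (Im z)\<^sup>2" and m: "m * (- z - m) = 1" "cmod m \<le> 1 / Im z"
  shows "(\<Sum>i\<in>I. D z m i) \<le> 2 * (n * ((12 + 25 * K) * \<tau>) + 4 * (\<Sum>i\<in>I. L i) / \<tau> + (\<Sum>i\<in>I. \<bar>(\<Sum>j\<in>I. v i j) - 1\<bar>))"
proof -
  define P where "P i = (12 + 25 * K) * \<tau> + 4 * L i / \<tau> + \<bar>(\<Sum>j\<in>I. v i j) - 1\<bar>" for i
  let ?S = "\<Sum>i\<in>I. D z m i"
  have D0: "0 \<le> D z m i" for i by (simp add: D_def)
  have "?S \<le> (\<Sum>i\<in>I. (1 / (Im z)\<^sup>2) * (P i + (\<Sum>j\<in>I. v i j * D z m j)))"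
    unfolding P_def by (intro sum_mono row_estimate z m)
  also have "\<dots> = (1 / (Im z)\<^sup>2) * ((\<Sum>i\<in>I. P i) + (\<Sum>i\<in>I. \<Sum>j\<in>I. v i j * D z m j))"
    by (simp only: sum_distrib_left[symmetric] sum.distrib)
  also have "(\<Sum>i\<in>I. \<Sum>j\<in>I. v i j * D z m j) = (\<Sum>j\<in>I. (\<Sum>i\<in>I. v j i) * D z m j)"
    by (subst sum.swap) (simp add: sum_distrib_right v_sym)
  also have "(1 / (Im z)\<^sup>2) * ((\<Sum>i\<in>I. P i) + (\<Sum>j\<in>I. (\<Sum>i\<in>I. v j i) * D z m j)) \<le> (1 / (Im z)\<^sup>2) * ((\<Sum>i\<in>I. P i) + K * ?S)"
    unfolding sum_distrib_left
    by (intro mult_left_mono add_left_mono sum_mono mult_right_mono row_sum_v D0) auto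
  finally have "(Im z)\<^sup>2 * ?S \<le> (\<Sum>i\<in>I. P i) + K * ?S"
    using z by (simp add: field_simps)
  moreover have "K * ?S \<le> (Im z)\<^sup>2 / 2 * ?S" using z D0 by (intro mult_right_mono sum_nonneg) auto
  ultimately have "(Im z)\<^sup>2 * ?S \<le> 2 * (\<Sum>i\<in>I. P i)" by linarith
  moreover have "?S \<le> (Im z)\<^sup>2 * ?S"
    using mult_right_mono[OF one_le_power[OF z(1), of 2] sum_nonneg[of I "D z m"]] D0 by simp
  ultimately have "?S \<le> 2 * (\<Sum>i\<in>I. P i)" by linarith
  also have "(\<Sum>i\<in>I. P i) = n * ((12 + 25 * K) * \<tau>) + 4 * (\<Sum>i\<in>I. L i) / \<tau> + (\<Sum>i\<in>I. \<bar>(\<Sum>j\<in>I. v i j) - 1\<bar>)"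
    unfolding P_def by (simp add: sum.distrib sum_distrib_left sum_divide_distrib)
  finally show ?thesis .
qed

end

section \<open>Eigenvalues as random variables\<close>

lemma mat_pow_entry_measurable:
  fixes A :: "'a \<Rightarrow> nat \<Rightarrow> nat \<Rightarrow> real"
  assumes [measurable]: "\<And>i j. i < n \<Longrightarrow> j < n \<Longrightarrow> (\<lambda>\<omega>. A \<omega> i j) \<in> borel_measurable N"
  shows "i < n \<Longrightarrow> j < n \<Longrightarrow> (\<lambda>\<omega>. (Matrix.mat n n (\<lambda>(i, j). A \<omega> i j) ^\<^sub>m k) $$ (i, j)) \<in> borel_measurable N"
proof (induction k arbitrary: i j)
  case 0
  then show ?case by simp
next
  case (Suc k)
  let ?M = "\<lambda>\<omega>. Matrix.mat n n (\<lambda>(i, j). A \<omega> i j)"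
  have [measurable]: "(\<lambda>\<omega>. (?M \<omega> ^\<^sub>m k) $$ (i, l)) \<in> borel_measurable N" if "l < n" for l
    using Suc that by auto
  have [measurable]: "(\<lambda>\<omega>. ?M \<omega> $$ (l, j)) \<in> borel_measurable N" if "l < n" for l
    using Suc.prems that by simp
  have eq: "(?M \<omega> ^\<^sub>m Suc k) $$ (i, j) = (\<Sum>l<n. (?M \<omega> ^\<^sub>m k) $$ (i, l) * ?M \<omega> $$ (l, j))" for \<omega>
    unfolding pow_mat.simps by (rule index_mult_mat_sum) (use Suc.prems in auto)
  show ?case unfolding eq by measurable
qed

lemma
  fixes A :: "nat \<Rightarrow> nat \<Rightarrow> real" and n :: nat
  assumes sym: "\<And>i j. A i j = A j i"
  defines "M \<equiv> Matrix.mat n n (\<lambda>(i, j). A i j)"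
  shows eig_val_mono: "1 \<le> i \<Longrightarrow> i \<le> j \<Longrightarrow> j \<le> n \<Longrightarrow> eig_val M i \<le> eig_val M j"
    and eig_val_power_sum: "(\<Sum>i=1..n. eig_val M i ^ k) = mat_trace (M ^\<^sub>m k)"
    and eig_val_resolvent_trace: "resolvent_on {..<n} A z G \<Longrightarrow> Im z \<noteq> 0 \<Longrightarrow>
       (\<Sum>i=1..n. 1 / (of_real (eig_val M i) - z)) = (\<Sum>i<n. G i i)"
proof -
  obtain rs where rs: "length rs = n" "proots (char_poly M) = mset rs"
    "\<And>k. mat_trace (M ^\<^sub>m k) = (\<Sum>r\<leftarrow>rs. r ^ k)"
    "\<And>z G. resolvent_on {..<n} A z G \<Longrightarrow> Im z \<noteq> 0 \<Longrightarrow>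
       (\<Sum>i<n. G i i) = (\<Sum>r\<leftarrow>rs. 1 / (of_real r - z))"
    unfolding M_def by (rule spectral_traces[of A n, OF sym]; blast)
  have ev: "eig_val M i = sort rs ! (i - 1)" for i
    by (simp add: eig_val_def rs(2))
  have sum_eig: "(\<Sum>i=1..n. f (eig_val M i)) = (\<Sum>r\<leftarrow>rs. f r)" for f :: "real \<Rightarrow> 'c::comm_monoid_add"
  proof -
    have "(\<Sum>i=1..n. f (eig_val M i)) = (\<Sum>i<n. f (sort rs ! i))"
      by (simp add: sum.atLeast1_atMost_eq ev)
    also have "\<dots> = sum_list (map f (sort rs))"
      using rs(1) by (simp add: sum_list_sum_nth atLeast0LessThan)
    also have "\<dots> = sum_mset (mset (map f (sort rs)))" by (simp only: sum_mset_sum_list)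
    also have "\<dots> = sum_mset (mset (map f rs))" by simp
    also have "\<dots> = sum_list (map f rs)" by (simp only: sum_mset_sum_list)
    finally show ?thesis .
  qed
  show "eig_val M i \<le> eig_val M j" if "1 \<le> i" "i \<le> j" "j \<le> n"
    unfolding ev using that rs(1) by (intro sorted_nth_mono) auto
  show "(\<Sum>i=1..n. eig_val M i ^ k) = mat_trace (M ^\<^sub>m k)"
    using sum_eig[of "\<lambda>r. r ^ k"] rs(3) by simp
  show "(\<Sum>i=1..n. 1 / (of_real (eig_val M i) - z)) = (\<Sum>i<n. G i i)" if "resolvent_on {..<n} A z G" "Im z \<noteq> 0"
    using sum_eig[of "\<lambda>r. 1 / (of_real r - z)"] rs(4)[OF that] by simp
qed

lemma eig_val_square_sum:
  fixes A :: "nat \<Rightarrow> nat \<Rightarrow> real"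
  assumes sym: "\<And>i j. A i j = A j i"
  shows "(\<Sum>i=1..n. (eig_val (Matrix.mat n n (\<lambda>(i, j). A i j)) i)\<^sup>2) = (\<Sum>i<n. \<Sum>j<n. (A i j)\<^sup>2)"
proof -
  let ?M = "Matrix.mat n n (\<lambda>(i, j). A i j)"
  have M: "?M \<in> carrier_mat n n" by simp
  have "?M ^\<^sub>m 2 = ?M * ?M" by (simp add: numeral_2_eq_2)
  moreover have "mat_trace (?M * ?M) = (\<Sum>i<n. \<Sum>j<n. ?M $$ (i, j) * ?M $$ (j, i))"
    unfolding mat_trace_def
  proof (rule sum.cong)
    fix i assume "i \<in> {..<n}"
    then show "(?M * ?M) $$ (i, i) = (\<Sum>j<n. ?M $$ (i, j) * ?M $$ (j, i))"
      by (intro index_mult_mat_sum[OF M M]) auto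
  qed simp
  moreover have "\<dots> = (\<Sum>i<n. \<Sum>j<n. (A i j)\<^sup>2)"
    by (intro sum.cong refl) (auto simp: power2_eq_square sym)
  ultimately show ?thesis using eig_val_power_sum[OF sym, where n = n and k = 2] by simp
qed

text \<open>For positive \<open>k\<close> the ramp \<open>c k\<close> falls from 1 at
  \<open>x\<close> to 0 at \<open>x + 1 / k\<close>; placing it to the right of \<open>x\<close>
  gives the limit 1 at the jump itself. Stone-Weierstrass is used on the growing intervals
  \<open>{-k..k}\<close>, so the convergence is pointwise on the whole line.\<close>

lemma step_function_polynomial_limit:
  fixes x :: real
  obtains p :: "nat \<Rightarrow> real \<Rightarrow> real" where "\<And>k. real_polynomial_function (p k)"
    "\<And>t. (\<lambda>k. p k t) \<longlonglongrightarrow> of_bool (t \<le> x)"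
proof -
  define c where "c k t = max 0 (min 1 (1 - real k * (t - x)))" for k t
  have cont: "continuous_on {- real k..real k} (c k)" for k
    unfolding c_def by (intro continuous_intros)
  have "\<exists>p. real_polynomial_function p \<and> (\<forall>t\<in>{- real k..real k}. \<bar>c k t - p t\<bar> < inverse (real (Suc k)))" for k
    by (rule Stone_Weierstrass_real_polynomial_function[OF _ cont, of k "inverse (real (Suc k))"]) auto
  then obtain p where p: "\<And>k. real_polynomial_function (p k)"
    "\<And>k t. t \<in> {- real k..real k} \<Longrightarrow> \<bar>c k t - p k t\<bar> < inverse (real (Suc k))"
    by metis
  have "(\<lambda>k. p k t) \<longlonglongrightarrow> of_bool (t \<le> x)" for t
  proof -
    obtain k0 :: nat where k0: "\<bar>t\<bar> \<le> real k0" using real_arch_simple by blast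
    have "(\<lambda>k. c k t - p k t) \<longlonglongrightarrow> 0"
    proof (rule Lim_null_comparison[OF _ LIMSEQ_inverse_real_of_nat])
      show "\<forall>\<^sub>F k in sequentially. norm (c k t - p k t) \<le> inverse (real (Suc k))"
      proof (rule eventually_sequentiallyI[of k0])
        fix k assume "k0 \<le> k"
        then have "t \<in> {- real k..real k}" using k0 by auto
        then show "norm (c k t - p k t) \<le> inverse (real (Suc k))"
          using p(2) less_imp_le unfolding real_norm_def by blast
      qed
    qed
    moreover have "(\<lambda>k. c k t) \<longlonglongrightarrow> of_bool (t \<le> x)"
    proof (cases "t \<le> x")
      case True
      then have "real k * (t - x) \<le> 0" for k by (simp add: mult_nonneg_nonpos)
      then have "c k t = 1" for k
        unfolding c_def by (smt (verit, best))
      then show ?thesis using True by simp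
    next
      case False
      obtain k1 :: nat where k1: "1 < real k1 * (t - x)" using reals_Archimedean3[of "t - x"] False by auto
      have "c k t = 0" if "k \<ge> k1" for k
      proof -
        have "real k1 * (t - x) \<le> real k * (t - x)" using that False by (intro mult_right_mono) auto
        then show ?thesis unfolding c_def using k1 by simp
      qed
      then have "\<forall>\<^sub>F k in sequentially. 0 = c k t" by (intro eventually_sequentiallyI[of k1]) auto
      then show ?thesis using False by (intro Lim_transform_eventually[OF tendsto_const]) auto
    qed
    ultimately have "(\<lambda>k. c k t - (c k t - p k t)) \<longlonglongrightarrow> of_bool (t \<le> x) - 0" by (rule tendsto_diff[rotated])
    then show ?thesis by simp
  qed
  with p(1) show thesis using that by blast
qed

text \<open>Power sums of the eigenvalues are traces, hence measurable; polynomials follow by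
  linearity, and the number of eigenvalues up to \<open>x\<close> as a pointwise limit. The
  \<open>i\<close>-th smallest eigenvalue is at most \<open>x\<close> exactly when this number is at
  least \<open>i\<close>.\<close>

lemma eig_val_measurable:
  fixes A :: "'a \<Rightarrow> nat \<Rightarrow> nat \<Rightarrow> real"
  assumes sym: "\<And>\<omega> i j. A \<omega> i j = A \<omega> j i"
    and A: "\<And>i j. i < n \<Longrightarrow> j < n \<Longrightarrow> (\<lambda>\<omega>. A \<omega> i j) \<in> borel_measurable N"
    and i: "i \<in> {1..n}"
  shows "(\<lambda>\<omega>. eig_val (Matrix.mat n n (\<lambda>(i, j). A \<omega> i j)) i) \<in> borel_measurable N"
proof -
  let ?e = "\<lambda>\<omega>. eig_val (Matrix.mat n n (\<lambda>(i, j). A \<omega> i j))"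
  have pow: "(\<lambda>\<omega>. \<Sum>j=1..n. ?e \<omega> j ^ k) \<in> borel_measurable N" for k
  proof -
    have "(\<lambda>\<omega>. \<Sum>i<n. (Matrix.mat n n (\<lambda>(i, j). A \<omega> i j) ^\<^sub>m k) $$ (i, i)) \<in> borel_measurable N"
      by (intro borel_measurable_sum mat_pow_entry_measurable A) auto
    moreover have "dim_row (Matrix.mat n n (\<lambda>(i, j). A \<omega> i j) ^\<^sub>m k) = n" for \<omega>
      by (rule carrier_matD(1)[of _ _ n]) (intro pow_carrier_mat, simp)
    ultimately show ?thesis
      unfolding eig_val_power_sum[OF sym] mat_trace_def by simp
  qed
  have poly: "(\<lambda>\<omega>. \<Sum>j=1..n. p (?e \<omega> j)) \<in> borel_measurable N" if p: "real_polynomial_function p" for p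
  proof -
    obtain a d where "p = (\<lambda>x. \<Sum>k\<le>d. a k * x ^ k)"
      using p real_polynomial_function_iff_sum by blast
    then have "(\<Sum>j=1..n. p (?e \<omega> j)) = (\<Sum>k\<le>d. a k * (\<Sum>j=1..n. ?e \<omega> j ^ k))" for \<omega>
      by (simp only: sum_distrib_left) (rule sum.swap)
    then show ?thesis using pow by simp
  qed
  have count: "(\<lambda>\<omega>. \<Sum>j=1..n. of_bool (?e \<omega> j \<le> x) :: real) \<in> borel_measurable N" for x
  proof -
    obtain p where p: "\<And>k. real_polynomial_function (p k)" "\<And>t. (\<lambda>k. p k t) \<longlonglongrightarrow> of_bool (t \<le> x)"
      using step_function_polynomial_limit by blast
    show ?thesis
    proof (rule borel_measurable_LIMSEQ_real)
      show "(\<lambda>k. \<Sum>j=1..n. p k (?e \<omega> j)) \<longlonglongrightarrow> (\<Sum>j=1..n. of_bool (?e \<omega> j \<le> x))" for \<omega>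
        by (intro tendsto_sum p(2))
    qed (rule poly[OF p(1)])
  qed
  have iff: "?e \<omega> i \<le> x \<longleftrightarrow> real i \<le> (\<Sum>j=1..n. of_bool (?e \<omega> j \<le> x))" for \<omega> x
  proof
    assume le: "?e \<omega> i \<le> x"
    have "real i = (\<Sum>j=1..i. 1)" by simp
    also have "\<dots> = (\<Sum>j=1..i. of_bool (?e \<omega> j \<le> x))"
    proof (rule sum.cong)
      fix j assume "j \<in> {1..i}"
      then have "?e \<omega> j \<le> ?e \<omega> i" using i by (intro eig_val_mono sym) auto
      then show "1 = of_bool (?e \<omega> j \<le> x)" using le by simp
    qed simp
    also have "\<dots> \<le> (\<Sum>j=1..n. of_bool (?e \<omega> j \<le> x))" using i by (intro sum_mono2) auto
    finally show "real i \<le> (\<Sum>j=1..n. of_bool (?e \<omega> j \<le> x))" .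
  next
    assume le: "real i \<le> (\<Sum>j=1..n. of_bool (?e \<omega> j \<le> x))"
    show "?e \<omega> i \<le> x"
    proof (rule ccontr)
      assume gt: "\<not> ?e \<omega> i \<le> x"
      have "(\<Sum>j=1..n. of_bool (?e \<omega> j \<le> x) :: real) = (\<Sum>j\<in>{1..<i}. of_bool (?e \<omega> j \<le> x))"
      proof (intro sum.mono_neutral_right ballI)
        fix j assume "j \<in> {1..n} - {1..<i}"
        then have "?e \<omega> i \<le> ?e \<omega> j" using i by (intro eig_val_mono sym) auto
        then show "of_bool (?e \<omega> j \<le> x) = (0::real)" using gt by simp
      qed (use i in auto)
      also have "\<dots> \<le> (\<Sum>j\<in>{1..<i}. 1)" by (intro sum_mono) auto
      also have "\<dots> < real i" using i by simp
      finally show False using le by simp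
    qed
  qed
  show ?thesis
    unfolding borel_measurable_iff_le iff
  proof
    fix x
    note [measurable] = count[of x]
    show "{\<omega> \<in> space N. real i \<le> (\<Sum>j=1..n. of_bool (?e \<omega> j \<le> x))} \<in> sets N"
      by measurable
  qed
qed

text \<open>An index drawn uniformly and independently of \<open>\<omega>\<close> turns the average
  of the laws of \<open>Y i\<close> into a single distribution, and Fubini gives its
  integrals.\<close>

lemma
  fixes Y :: "'i \<Rightarrow> 'a \<Rightarrow> real" and f :: "real \<Rightarrow> 'b::{banach, second_countable_topology}"
  assumes M: "prob_space M" and S: "finite S" "S \<noteq> {}"
    and Y: "\<And>i. i \<in> S \<Longrightarrow> Y i \<in> borel_measurable M"
  defines "\<mu> \<equiv> distr (uniform_count_measure S \<Otimes>\<^sub>M M) borel (\<lambda>(i, \<omega>). Y i \<omega>)"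
  shows real_distribution_uniform_mixture: "real_distribution \<mu>"
    and integrable_uniform_mixture: "f \<in> borel_measurable borel \<Longrightarrow>
      (\<And>i. i \<in> S \<Longrightarrow> integrable M (\<lambda>\<omega>. f (Y i \<omega>))) \<Longrightarrow> integrable \<mu> f"
    and integral_uniform_mixture: "f \<in> borel_measurable borel \<Longrightarrow>
      (\<And>i. i \<in> S \<Longrightarrow> integrable M (\<lambda>\<omega>. f (Y i \<omega>))) \<Longrightarrow>
      integral\<^sup>L \<mu> f = (1 / real (card S)) *\<^sub>R (\<Sum>i\<in>S. LINT \<omega>|M. f (Y i \<omega>))"
proof -
  interpret M: prob_space M by fact
  interpret U: prob_space "uniform_count_measure S"
    by (rule prob_space_uniform_count_measure[OF S])
  interpret P: pair_prob_space "uniform_count_measure S" M ..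
  have Y'[measurable]: "(\<lambda>(i, \<omega>). Y i \<omega>) \<in> borel_measurable (uniform_count_measure S \<Otimes>\<^sub>M M)"
  proof -
    have "(\<lambda>(i, \<omega>). Y i \<omega>) \<in> borel_measurable (count_space S \<Otimes>\<^sub>M M)"
      using S Y by (intro measurable_pair_measure_countable1) (auto intro: countable_finite)
    then show ?thesis by (simp cong: measurable_cong_sets add: sets_pair_measure_cong[OF sets_uniform_count_measure_count_space refl])
  qed
  show "real_distribution \<mu>"
    unfolding \<mu>_def by (rule P.real_distribution_distr) simp
  assume f[measurable]: "f \<in> borel_measurable borel"
    and int: "\<And>i. i \<in> S \<Longrightarrow> integrable M (\<lambda>\<omega>. f (Y i \<omega>))"
  have fY: "(\<lambda>x. f ((\<lambda>(i, \<omega>). Y i \<omega>) x)) \<in> borel_measurable (uniform_count_measure S \<Otimes>\<^sub>M M)"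
    by measurable
  have I: "integrable (uniform_count_measure S \<Otimes>\<^sub>M M) (\<lambda>x. f ((\<lambda>(i, \<omega>). Y i \<omega>) x))"
  proof (rule P.Fubini_integrable[OF fY])
    show "AE i in uniform_count_measure S. integrable M (\<lambda>\<omega>. f ((\<lambda>(i, \<omega>). Y i \<omega>) (i, \<omega>)))"
      by (rule AE_I2) (simp add: space_uniform_count_measure int)
  qed (simp add: uniform_count_measure_def integrable_point_measure_finite[OF S(1)])
  show "integrable \<mu> f" unfolding \<mu>_def using I by (subst integrable_distr_eq) auto
  have "integral\<^sup>L \<mu> f = integral\<^sup>L (uniform_count_measure S \<Otimes>\<^sub>M M) (\<lambda>x. f ((\<lambda>(i, \<omega>). Y i \<omega>) x))"
    unfolding \<mu>_def by (subst integral_distr) auto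
  also have "\<dots> = (LINT i|uniform_count_measure S. LINT \<omega>|M. f (Y i \<omega>))"
    using P.integral_fst'[OF I] by simp
  also have "\<dots> = (\<Sum>i\<in>S. (1 / real (card S)) *\<^sub>R (LINT \<omega>|M. f (Y i \<omega>)))"
    using S by (simp add: uniform_count_measure_def lebesgue_integral_point_measure_finite)
  finally show "integral\<^sup>L \<mu> f = (1 / real (card S)) *\<^sub>R (\<Sum>i\<in>S. LINT \<omega>|M. f (Y i \<omega>))"
    by (simp add: scaleR_sum_right)
qed

text \<open>Write \<open>x = u + w\<close> with the small part \<open>u\<close> and the large part
  \<open>w\<close>, which have disjoint supports. Since \<open>x\<close> is centred,
  \<open>c\<close> is the mean of \<open>u\<close> and minus the mean of \<open>w\<close>, so
  \<open>c^2 \<le> l\<close> because a variance is nonnegative. Squares add, hence the variance loss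
  is \<open>l + c^2\<close>, and the truncation error \<open>w + c\<close> is \<open>w\<close> minus
  its mean.\<close>

lemma (in prob_space) truncation:
  fixes x :: "'a \<Rightarrow> real"
  assumes x[measurable]: "x \<in> borel_measurable M" and sq: "integrable M (\<lambda>\<omega>. (x \<omega>)\<^sup>2)"
    and mean: "expectation x = 0" and \<tau>: "\<tau> > 0"
  defines "c \<equiv> expectation (\<lambda>\<omega>. x \<omega> * of_bool (\<bar>x \<omega>\<bar> < \<tau>))"
  defines "\<zeta> \<equiv> \<lambda>y. y * of_bool (\<bar>y\<bar> < \<tau>) - c"
  defines "l \<equiv> expectation (\<lambda>\<omega>. (x \<omega>)\<^sup>2 * of_bool (\<bar>x \<omega>\<bar> \<ge> \<tau>))"
  shows "\<zeta> \<in> borel_measurable borel"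
    and "\<bar>\<zeta> y\<bar> \<le> 2 * \<tau>"
    and "expectation (\<lambda>\<omega>. \<zeta> (x \<omega>)) = 0"
    and "expectation (\<lambda>\<omega>. (\<zeta> (x \<omega>))\<^sup>2) \<le> expectation (\<lambda>\<omega>. (x \<omega>)\<^sup>2)"
      "expectation (\<lambda>\<omega>. (x \<omega>)\<^sup>2) \<le> expectation (\<lambda>\<omega>. (\<zeta> (x \<omega>))\<^sup>2) + 2 * l"
    and "expectation (\<lambda>\<omega>. (x \<omega> - \<zeta> (x \<omega>))\<^sup>2) \<le> l"
proof -
  define u where "u \<omega> = x \<omega> * of_bool (\<bar>x \<omega>\<bar> < \<tau>)" for \<omega>
  define w where "w \<omega> = x \<omega> * of_bool (\<bar>x \<omega>\<bar> \<ge> \<tau>)" for \<omega>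
  have [measurable]: "u \<in> borel_measurable M" "w \<in> borel_measurable M"
    unfolding u_def w_def by measurable
  show "\<zeta> \<in> borel_measurable borel" unfolding \<zeta>_def by measurable
  have ub: "\<bar>u \<omega>\<bar> \<le> \<tau>" for \<omega> using \<tau> by (auto simp: u_def)
  have xuw: "x \<omega> = u \<omega> + w \<omega>" "(x \<omega>)\<^sup>2 = (u \<omega>)\<^sup>2 + (w \<omega>)\<^sup>2" for \<omega> by (auto simp: u_def w_def)
  have iu: "integrable M u" using ub by (intro integrable_const_bound[where B=\<tau>]) auto
  have iu2: "integrable M (\<lambda>\<omega>. (u \<omega>)\<^sup>2)"
    by (rule Bochner_Integration.integrable_bound[OF sq]) (auto simp: u_def)
  have iw2: "integrable M (\<lambda>\<omega>. (w \<omega>)\<^sup>2)"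
    by (rule Bochner_Integration.integrable_bound[OF sq]) (auto simp: w_def)
  have iw: "integrable M w" by (rule square_integrable_imp_integrable[OF _ iw2]) simp
  have c: "expectation u = c" unfolding c_def u_def ..
  have cw: "expectation w = - c"
    using mean Bochner_Integration.integral_add[OF iu iw] c by (simp add: xuw(1)[symmetric])
  have l: "expectation (\<lambda>\<omega>. (w \<omega>)\<^sup>2) = l"
    unfolding l_def w_def by (intro Bochner_Integration.integral_cong) auto
  have "variance w = l - c\<^sup>2" using variance_eq[OF iw iw2] l cw by simp
  then have cl: "c\<^sup>2 \<le> l" using variance_positive[of w] by simp
  have \<zeta>: "\<zeta> (x \<omega>) = u \<omega> - c" for \<omega> by (simp add: \<zeta>_def u_def)
  have "\<bar>c\<bar> \<le> \<tau>"
  proof -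
    have "\<bar>c\<bar> \<le> expectation (\<lambda>\<omega>. \<bar>u \<omega>\<bar>)" unfolding c[symmetric] by (rule integral_abs_bound)
    also have "\<dots> \<le> \<tau>" using iu ub by (intro integral_le_const) auto
    finally show ?thesis .
  qed
  moreover have "\<bar>y * of_bool (\<bar>y\<bar> < \<tau>)\<bar> \<le> \<tau>" using \<tau> by auto
  ultimately show "\<bar>\<zeta> y\<bar> \<le> 2 * \<tau>" unfolding \<zeta>_def by linarith
  show "expectation (\<lambda>\<omega>. \<zeta> (x \<omega>)) = 0" unfolding \<zeta> using iu c by (simp add: prob_space)
  have vu: "expectation (\<lambda>\<omega>. (\<zeta> (x \<omega>))\<^sup>2) = expectation (\<lambda>\<omega>. (u \<omega>)\<^sup>2) - c\<^sup>2"
    unfolding \<zeta> using variance_eq[OF iu iu2] c by simp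
  have x2: "expectation (\<lambda>\<omega>. (x \<omega>)\<^sup>2) = expectation (\<lambda>\<omega>. (u \<omega>)\<^sup>2) + l"
    unfolding xuw(2) using iu2 iw2 l by simp
  show "expectation (\<lambda>\<omega>. (\<zeta> (x \<omega>))\<^sup>2) \<le> expectation (\<lambda>\<omega>. (x \<omega>)\<^sup>2)"
    "expectation (\<lambda>\<omega>. (x \<omega>)\<^sup>2) \<le> expectation (\<lambda>\<omega>. (\<zeta> (x \<omega>))\<^sup>2) + 2 * l"
    unfolding vu x2 using cl zero_le_power2[of c] by linarith+
  have "x \<omega> - \<zeta> (x \<omega>) = w \<omega> - (- c)" for \<omega>
    using \<zeta>[of \<omega>] xuw(1)[of \<omega>] by simp
  then have "expectation (\<lambda>\<omega>. (x \<omega> - \<zeta> (x \<omega>))\<^sup>2) = expectation (\<lambda>\<omega>. (w \<omega> - (- c))\<^sup>2)"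
    by (simp only:)
  also have "\<dots> = l - c\<^sup>2" using variance_eq[OF iw iw2] l cw by simp
  also have "\<dots> \<le> l" by simp
  finally show "expectation (\<lambda>\<omega>. (x \<omega> - \<zeta> (x \<omega>))\<^sup>2) \<le> l" .
qed

section \<open>Convergence to the semicircle law\<close>

locale wigner_array = prob_space M for M :: "'a measure" +
  fixes X :: "nat \<Rightarrow> nat \<Rightarrow> 'a \<Rightarrow> real" and \<sigma> :: "nat \<Rightarrow> nat \<Rightarrow> real"
  assumes X_measurable: "\<And>i j. 1 \<le> i \<Longrightarrow> i \<le> j \<Longrightarrow> X i j \<in> borel_measurable M"
    and X_square_integrable: "\<And>i j. 1 \<le> i \<Longrightarrow> i \<le> j \<Longrightarrow> integrable M (\<lambda>\<omega>. (X i j \<omega>)\<^sup>2)"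
    and X_mean: "\<And>i j. 1 \<le> i \<Longrightarrow> i \<le> j \<Longrightarrow> expectation (X i j) = 0"
    and X_variance: "\<And>i j. 1 \<le> i \<Longrightarrow> i \<le> j \<Longrightarrow> expectation (\<lambda>\<omega>. (X i j \<omega>)\<^sup>2) = (\<sigma> i j)\<^sup>2"
    and X_sym: "\<And>i j \<omega>. 1 \<le> i \<Longrightarrow> i < j \<Longrightarrow> \<omega> \<in> space M \<Longrightarrow> X j i \<omega> = X i j \<omega>"
    and \<sigma>_sym: "\<And>i j. 1 \<le> i \<Longrightarrow> i < j \<Longrightarrow> \<sigma> j i = \<sigma> i j"
    and X_indep: "\<And>n. indep_vars (\<lambda>_. borel) (\<lambda>(i, j). X i j) {(i, j). 1 \<le> i \<and> i \<le> j \<and> j \<le> n}"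
begin

text \<open>The given symmetry of \<open>X\<close> holds only on \<open>space M\<close> and for
  positive indices; \<open>min\<close> and \<open>max\<close> make it unconditional.\<close>

definition entry :: "nat \<Rightarrow> 'a \<Rightarrow> nat \<Rightarrow> nat \<Rightarrow> real" where
  "entry n \<omega> i j = X (min i j) (max i j) \<omega> / sqrt (real n)"

definition eigen :: "nat \<Rightarrow> nat \<Rightarrow> 'a \<Rightarrow> real" where
  "eigen n i \<omega> = eig_val (Matrix.mat n n (\<lambda>(i, j). entry n \<omega> (Suc i) (Suc j))) i"

text \<open>The mean of the empirical spectral measures, realized as the law of an eigenvalue with a
  uniformly drawn index.\<close>

definition spectral_measure :: "nat \<Rightarrow> real measure" where
  "spectral_measure n = distr (uniform_count_measure {1..n} \<Otimes>\<^sub>M M) borel (\<lambda>(i, \<omega>). eigen n i \<omega>)"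

lemma X_min_max: "1 \<le> i \<Longrightarrow> 1 \<le> j \<Longrightarrow> \<omega> \<in> space M \<Longrightarrow> X (min i j) (max i j) \<omega> = X i j \<omega>"
  using X_sym[of j i \<omega>] by (cases "i \<le> j") (auto simp: min_def max_def)

lemma \<sigma>_min_max: "1 \<le> i \<Longrightarrow> 1 \<le> j \<Longrightarrow> \<sigma> (min i j) (max i j) = \<sigma> i j"
  using \<sigma>_sym[of j i] by (cases "i \<le> j") (auto simp: min_def max_def)

lemma entry_sym: "entry n \<omega> i j = entry n \<omega> j i"
  by (simp add: entry_def min.commute max.commute)

lemma entry_measurable: "1 \<le> i \<Longrightarrow> 1 \<le> j \<Longrightarrow> (\<lambda>\<omega>. entry n \<omega> i j) \<in> borel_measurable M"
  using X_measurable[of "min i j" "max i j"] unfolding entry_def by auto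

lemma normalized_matrix_eq:
  assumes "\<omega> \<in> space M"
  shows "(1 / sqrt (real n)) \<cdot>\<^sub>m random_matrix X n \<omega> = Matrix.mat n n (\<lambda>(i, j). entry n \<omega> (Suc i) (Suc j))"
  by (rule eq_matI) (auto simp: random_matrix_def entry_def X_min_max[OF _ _ assms] simp del: min_Suc_Suc max_Suc_Suc)

lemma eigen_measurable: "i \<in> {1..n} \<Longrightarrow> eigen n i \<in> borel_measurable M"
  unfolding eigen_def
  by (rule eig_val_measurable) (auto simp: entry_sym intro!: entry_measurable)

lemma real_distribution_spectral_measure: "n \<ge> 1 \<Longrightarrow> real_distribution (spectral_measure n)"
  unfolding spectral_measure_def
  by (intro real_distribution_uniform_mixture eigen_measurable prob_space_axioms) auto

lemma integral_spectral_measure: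
  fixes f :: "real \<Rightarrow> 'b::{banach, second_countable_topology}"
  assumes "n \<ge> 1" "f \<in> borel_measurable borel" "\<And>i. i \<in> {1..n} \<Longrightarrow> integrable M (\<lambda>\<omega>. f (eigen n i \<omega>))"
  shows "integral\<^sup>L (spectral_measure n) f = (1 / real n) *\<^sub>R (\<Sum>i=1..n. expectation (\<lambda>\<omega>. f (eigen n i \<omega>)))"
  unfolding spectral_measure_def
  using integral_uniform_mixture[OF prob_space_axioms _ _ eigen_measurable assms(2,3), of "{1..n}"] assms(1) by simp

lemma cdf_spectral_measure:
  assumes n: "n \<ge> 1"
  shows "cdf (spectral_measure n) x = expected_spectral_cdf M X n x"
proof -
  interpret S: real_distribution "spectral_measure n" by (rule real_distribution_spectral_measure[OF n])
  note [measurable] = eigen_measurable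
  have int: "integrable M (\<lambda>\<omega>. indicator {..x} (eigen n i \<omega>) :: real)" if "i \<in> {1..n}" for i
    using that by (intro integrable_const_bound[where B=1]) (auto simp: indicator_def)
  have "cdf (spectral_measure n) x = integral\<^sup>L (spectral_measure n) (indicator {..x})"
    by (simp add: cdf_def)
  also have "\<dots> = (1 / real n) *\<^sub>R (\<Sum>i=1..n. expectation (\<lambda>\<omega>. indicator {..x} (eigen n i \<omega>)))"
    by (intro integral_spectral_measure n int) auto
  also have "\<dots> = expectation (\<lambda>\<omega>. (1 / real n) * (\<Sum>i=1..n. indicator {..x} (eigen n i \<omega>)))"
    using int by (simp add: Bochner_Integration.integral_sum)
  also have "\<dots> = expected_spectral_cdf M X n x"
    unfolding expected_spectral_cdf_def empirical_spectral_cdf_def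
    by (intro Bochner_Integration.integral_cong refl)
       (simp add: normalized_matrix_eq eigen_def indicator_def of_bool_def)
  finally show ?thesis .
qed

lemma entry_variance:
  assumes "1 \<le> i" "1 \<le> j"
  shows "integrable M (\<lambda>\<omega>. (entry n \<omega> i j)\<^sup>2)" "expectation (\<lambda>\<omega>. (entry n \<omega> i j)\<^sup>2) = (\<sigma> i j)\<^sup>2 / real n"
  using X_square_integrable[of "min i j" "max i j"] X_variance[of "min i j" "max i j"] assms
  by (simp_all add: entry_def power_divide \<sigma>_min_max)

lemma row_variance_eq:
  assumes "1 \<le> i"
  shows "(\<Sum>j=1..n. expectation (\<lambda>\<omega>. (entry n \<omega> i j)\<^sup>2)) = (row_scale \<sigma> n i)\<^sup>2"
proof -
  have "(\<Sum>j=1..n. expectation (\<lambda>\<omega>. (entry n \<omega> i j)\<^sup>2)) = (\<Sum>j=1..n. (\<sigma> i j)\<^sup>2 / real n)"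
    using assms by (intro sum.cong refl entry_variance) auto
  also have "\<dots> = (row_scale \<sigma> n i)\<^sup>2"
    unfolding row_scale_def by (simp add: sum_nonneg sum_divide_distrib)
  finally show ?thesis .
qed

text \<open>The trace of the squared matrix is the sum of its squared entries, so the second moment
  is the average of the row variances. The same sum dominates each single squared eigenvalue, which
  gives integrability.\<close>

lemma second_moment_spectral_measure:
  assumes n: "n \<ge> 1" and K: "\<And>i. i \<in> {1..n} \<Longrightarrow> (row_scale \<sigma> n i)\<^sup>2 \<le> K"
  shows "integrable (spectral_measure n) (\<lambda>x. x\<^sup>2)" "(LINT x|spectral_measure n. x\<^sup>2) \<le> K"
proof -
  note [measurable] = eigen_measurable
  let ?T = "\<lambda>\<omega>. \<Sum>i<n. \<Sum>j<n. (entry n \<omega> (Suc i) (Suc j))\<^sup>2"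
  have sum: "(\<Sum>i=1..n. (eigen n i \<omega>)\<^sup>2) = ?T \<omega>" for \<omega>
    unfolding eigen_def by (rule eig_val_square_sum) (rule entry_sym)
  have intT: "integrable M ?T"
    by (intro Bochner_Integration.integrable_sum entry_variance) auto
  have int: "integrable M (\<lambda>\<omega>. (eigen n i \<omega>)\<^sup>2)" if i: "i \<in> {1..n}" for i
  proof (rule Bochner_Integration.integrable_bound[OF intT])
    have "(eigen n i \<omega>)\<^sup>2 \<le> ?T \<omega>" for \<omega>
      unfolding sum[symmetric] using i by (intro member_le_sum) auto
    then show "AE \<omega> in M. norm ((eigen n i \<omega>)\<^sup>2) \<le> norm (?T \<omega>)"
      by (auto simp: sum_nonneg)
  qed (use i in measurable)
  show "integrable (spectral_measure n) (\<lambda>x. x\<^sup>2)"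
    unfolding spectral_measure_def
    using n int by (intro integrable_uniform_mixture prob_space_axioms eigen_measurable) auto
  have "(LINT x|spectral_measure n. x\<^sup>2) = (1 / real n) *\<^sub>R (\<Sum>i=1..n. expectation (\<lambda>\<omega>. (eigen n i \<omega>)\<^sup>2))"
    by (intro integral_spectral_measure n int) auto
  also have "(\<Sum>i=1..n. expectation (\<lambda>\<omega>. (eigen n i \<omega>)\<^sup>2)) = expectation ?T"
    unfolding sum[symmetric] by (rule Bochner_Integration.integral_sum[OF int, symmetric])
  also have "\<dots> = (\<Sum>i<n. \<Sum>j<n. expectation (\<lambda>\<omega>. (entry n \<omega> (Suc i) (Suc j))\<^sup>2))"
    by (simp add: Bochner_Integration.integral_sum Bochner_Integration.integrable_sum entry_variance(1))
  also have "\<dots> = (\<Sum>i<n. (row_scale \<sigma> n (Suc i))\<^sup>2)"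
    by (intro sum.cong refl) (simp add: row_variance_eq[symmetric] sum.atLeast1_atMost_eq)
  also have "\<dots> = (\<Sum>i=1..n. (row_scale \<sigma> n i)\<^sup>2)" by (simp add: sum.atLeast1_atMost_eq)
  also have "\<dots> \<le> (\<Sum>i=1..n. K)" by (intro sum_mono K)
  finally show "(LINT x|spectral_measure n. x\<^sup>2) \<le> K"
    using n by (simp add: divide_le_eq mult.commute)
qed

lemma stieltjes_spectral_measure:
  assumes n: "n \<ge> 1" and z: "Im z > 0"
  shows "(LINT x|spectral_measure n. 1 / (of_real x - z))
    = (1 / real n) *\<^sub>R (\<Sum>i=1..n. expectation (\<lambda>\<omega>. resolvent {1..n} (entry n \<omega>) z i i))"
proof -
  note [measurable] = eigen_measurable
  let ?R = "\<lambda>\<omega>. resolvent {1..n} (entry n \<omega>) z"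
  have R: "resolvent_on {1..n} (entry n \<omega>) z (?R \<omega>)" for \<omega>
    by (rule resolvent_on_resolvent[OF _ entry_sym z]) simp
  have trace: "(\<Sum>i=1..n. 1 / (of_real (eigen n i \<omega>) - z)) = (\<Sum>i=1..n. ?R \<omega> i i)" for \<omega>
  proof -
    have "resolvent_on {..<n} (\<lambda>i j. entry n \<omega> (Suc i) (Suc j)) z (\<lambda>i j. ?R \<omega> (Suc i) (Suc j))"
      unfolding resolvent_on_def
      using resolvent_onD[OF R[of \<omega>]] by (simp add: sum.atLeast1_atMost_eq)
    from eig_val_resolvent_trace[OF entry_sym this] z show ?thesis
      by (simp add: eigen_def sum.atLeast1_atMost_eq)
  qed
  have int: "integrable M (\<lambda>\<omega>. 1 / (complex_of_real (eigen n i \<omega>) - z))" if "i \<in> {1..n}" for i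
  proof (rule integrable_const_bound[where B="1 / Im z"])
    show "AE \<omega> in M. cmod (1 / (of_real (eigen n i \<omega>) - z)) \<le> 1 / Im z"
      using cauchy_kernel_bound(1)[OF z] by simp
  qed (use that in measurable)
  have intR: "integrable M (\<lambda>\<omega>. ?R \<omega> i i)" if i: "i \<in> {1..n}" for i
  proof (rule integrable_const_bound[where B="1 / Im z"])
    show "AE \<omega> in M. cmod (?R \<omega> i i) \<le> 1 / Im z"
      using resolvent_on_diag_bound[OF _ entry_sym R i z] by simp
    show "(\<lambda>\<omega>. ?R \<omega> i i) \<in> borel_measurable M"
      using i by (intro measurable_resolvent entry_measurable) auto
  qed
  have "(LINT x|spectral_measure n. 1 / (of_real x - z))
      = (1 / real n) *\<^sub>R (\<Sum>i=1..n. expectation (\<lambda>\<omega>. 1 / (complex_of_real (eigen n i \<omega>) - z)))"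
    by (intro integral_spectral_measure n int) auto
  also have "(\<Sum>i=1..n. expectation (\<lambda>\<omega>. 1 / (complex_of_real (eigen n i \<omega>) - z)))
      = expectation (\<lambda>\<omega>. \<Sum>i=1..n. 1 / (complex_of_real (eigen n i \<omega>) - z))"
    by (rule Bochner_Integration.integral_sum[OF int, symmetric])
  also have "\<dots> = (\<Sum>i=1..n. expectation (\<lambda>\<omega>. ?R \<omega> i i))"
    unfolding trace by (rule Bochner_Integration.integral_sum[OF intR])
  finally show ?thesis .
qed

text \<open>The averaged errors \<open>T.D\<close> bound the error of the transform, since the
  modulus of a mean is at most the mean of the modulus. The bound separates \<tau> from
  \<open>n\<close>: only the Lindeberg sum and the row deviations depend on
  \<open>n\<close>.\<close>

lemma stieltjes_error:
  assumes n: "n \<ge> 1" and K: "\<And>i. i \<in> {1..n} \<Longrightarrow> (row_scale \<sigma> n i)\<^sup>2 \<le> K"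
    and \<tau>: "0 < \<tau>" "\<tau> \<le> 1" and z: "Im z \<ge> 1" "2 * K \<le> (Im z)\<^sup>2"
    and m: "m * (- z - m) = 1" "cmod m \<le> 1 / Im z"
  shows "cmod ((LINT x|spectral_measure n. 1 / (of_real x - z)) - m) \<le>
     2 * ((12 + 25 * K) * \<tau> + 4 * lindeberg_sum M X n \<tau> / \<tau> + (1 / real n) * (\<Sum>i=1..n. \<bar>(row_scale \<sigma> n i)\<^sup>2 - 1\<bar>))"
proof -
  define \<xi> where "\<xi> = (\<lambda>(i, j) \<omega>. X i j \<omega> / sqrt (real n))"
  let ?E = "{(i, j). 1 \<le> i \<and> i \<le> j \<and> j \<le> n}"
  define c where "c p = expectation (\<lambda>\<omega>. \<xi> p \<omega> * of_bool (\<bar>\<xi> p \<omega>\<bar> < \<tau>))" for p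
  \<comment> \<open>Outside the upper triangle the truncation is set to 0, because the locale asks
    for measurability and the bound \<open>2 * \<tau>\<close> at every position.\<close>
  define \<zeta> where "\<zeta> p y = (if p \<in> ?E then y * of_bool (\<bar>y\<bar> < \<tau>) - c p else 0)" for p y
  define l where "l p = expectation (\<lambda>\<omega>. (\<xi> p \<omega>)\<^sup>2 * of_bool (\<bar>\<xi> p \<omega>\<bar> \<ge> \<tau>))" for p
  have \<xi>m: "\<xi> p \<in> borel_measurable M" if "p \<in> ?E" for p
    using that X_measurable by (auto simp: \<xi>_def)
  have \<xi>sq: "integrable M (\<lambda>\<omega>. (\<xi> p \<omega>)\<^sup>2)" if "p \<in> ?E" for p
    using that X_square_integrable by (auto simp: \<xi>_def power_divide)
  have \<xi>mean: "expectation (\<xi> p) = 0" if "p \<in> ?E" for p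
    using that X_mean by (auto simp: \<xi>_def)
  note tr = truncation[OF \<xi>m \<xi>sq \<xi>mean \<tau>(1), folded c_def l_def]
  have \<zeta>E: "\<zeta> p = (\<lambda>y. y * of_bool (\<bar>y\<bar> < \<tau>) - c p)" if "p \<in> ?E" for p
    using that by (auto simp: \<zeta>_def)
  have entry: "\<xi> (min i j, max i j) \<omega> = entry n \<omega> i j" for i j \<omega>
    by (simp add: \<xi>_def entry_def)
  interpret T: indep_symmetric_array M n \<xi> \<zeta> l \<tau> K
  proof unfold_locales
    have "indep_vars (\<lambda>_. borel) (\<lambda>p \<omega>. (\<lambda>y. y / sqrt (real n)) ((\<lambda>(i, j). X i j) p \<omega>)) ?E"
      by (rule indep_vars_compose2[OF X_indep]) auto
    then show "indep_vars (\<lambda>_. borel) \<xi> ?E"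
      by (simp add: \<xi>_def case_prod_unfold)
    show "\<zeta> p \<in> borel_measurable borel" for p
    proof (cases "p \<in> ?E")
      case True
      then show ?thesis unfolding \<zeta>E[OF True] by (rule tr(1)) (use True in simp_all)
    qed (simp add: \<zeta>_def[abs_def])
    show "\<bar>\<zeta> p y\<bar> \<le> 2 * \<tau>" for p y
    proof (cases "p \<in> ?E")
      case True
      then show ?thesis unfolding \<zeta>E[OF True] by (rule tr(2)) (use True in simp_all)
    qed (use \<tau> in \<open>simp add: \<zeta>_def\<close>)
    fix i j assume ij: "1 \<le> i" "i \<le> j" "j \<le> n"
    then have p: "(i, j) \<in> ?E" by simp
    show "integrable M (\<lambda>\<omega>. (\<xi> (i, j) \<omega>)\<^sup>2)" by (rule \<xi>sq[OF p])
    show "expectation (\<lambda>\<omega>. \<zeta> (i, j) (\<xi> (i, j) \<omega>)) = 0" unfolding \<zeta>E[OF p] by (rule tr(3)[OF p p p])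
    show "expectation (\<lambda>\<omega>. (\<zeta> (i, j) (\<xi> (i, j) \<omega>))\<^sup>2) \<le> expectation (\<lambda>\<omega>. (\<xi> (i, j) \<omega>)\<^sup>2)"
      unfolding \<zeta>E[OF p] by (rule tr(4)[OF p p p])
    show "expectation (\<lambda>\<omega>. (\<xi> (i, j) \<omega>)\<^sup>2) \<le> expectation (\<lambda>\<omega>. (\<zeta> (i, j) (\<xi> (i, j) \<omega>))\<^sup>2) + 2 * l (i, j)"
      unfolding \<zeta>E[OF p] by (rule tr(5)[OF p p p])
    show "expectation (\<lambda>\<omega>. (\<xi> (i, j) \<omega> - \<zeta> (i, j) (\<xi> (i, j) \<omega>))\<^sup>2) \<le> l (i, j)"
      unfolding \<zeta>E[OF p] by (rule tr(6)[OF p p p])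
  next
    fix i assume "i \<in> {1..n}"
    then show "(\<Sum>j\<in>{1..n}. expectation (\<lambda>\<omega>. (\<xi> (min i j, max i j) \<omega>)\<^sup>2)) \<le> K"
      unfolding entry using K[of i] row_variance_eq[of i n] by simp
  qed (use \<tau> in auto)
  have A: "T.A \<omega> = entry n \<omega>" for \<omega> by (auto simp: T.A_def entry fun_eq_iff)
  have v: "(\<Sum>j=1..n. T.v i j) = (row_scale \<sigma> n i)\<^sup>2" if "i \<in> {1..n}" for i
    unfolding T.v_def A using that by (intro row_variance_eq) auto
  \<comment> \<open>The threshold \<tau> for \<open>X / sqrt n\<close> is
    \<open>\<tau> * sqrt n\<close> for \<open>X\<close>. Squaring contributes one factor
    \<open>1 / n\<close>, so against the \<open>1 / n^2\<close> of the Lindeberg sum a factor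
    \<open>n\<close> remains.\<close>
  have L: "(\<Sum>i=1..n. T.L i) = real n * lindeberg_sum M X n \<tau>"
  proof -
    have "l (min i j, max i j) = (1 / real n) * (LINT \<omega>|M. \<bar>X i j \<omega>\<bar>\<^sup>2 * of_bool (\<bar>X i j \<omega>\<bar> \<ge> \<tau> * sqrt (real n)))"
      if ij: "i \<in> {1..n}" "j \<in> {1..n}" for i j
    proof -
      have "l (min i j, max i j) = (LINT \<omega>|M. (1 / real n) * (\<bar>X i j \<omega>\<bar>\<^sup>2 * of_bool (\<bar>X i j \<omega>\<bar> \<ge> \<tau> * sqrt (real n))))"
        unfolding l_def entry
      proof (intro Bochner_Integration.integral_cong refl)
        fix \<omega> assume "\<omega> \<in> space M"
        then have "entry n \<omega> i j = X i j \<omega> / sqrt (real n)"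
          using ij by (simp add: entry_def X_min_max)
        then show "(entry n \<omega> i j)\<^sup>2 * of_bool (\<tau> \<le> \<bar>entry n \<omega> i j\<bar>)
          = (1 / real n) * (\<bar>X i j \<omega>\<bar>\<^sup>2 * of_bool (\<tau> * sqrt (real n) \<le> \<bar>X i j \<omega>\<bar>))"
          using n by (simp add: power_divide le_divide_eq)
      qed
      then show ?thesis by simp
    qed
    then have "(\<Sum>i=1..n. T.L i) = (\<Sum>i=1..n. \<Sum>j=1..n.
        (1 / real n) * (LINT \<omega>|M. \<bar>X i j \<omega>\<bar>\<^sup>2 * of_bool (\<bar>X i j \<omega>\<bar> \<ge> \<tau> * sqrt (real n))))"
      unfolding T.L_def by (intro sum.cong refl) auto
    also have "\<dots> = real n * lindeberg_sum M X n \<tau>"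
      using n by (simp add: lindeberg_sum_def sum_distrib_left[symmetric] sum_divide_distrib[symmetric] power2_eq_square)
    finally show ?thesis .
  qed
  have z0: "Im z > 0" using z by simp
  let ?R = "\<lambda>\<omega>. resolvent {1..n} (entry n \<omega>) z"
  have intR: "integrable M (\<lambda>\<omega>. ?R \<omega> i i)" if i: "i \<in> {1..n}" for i
  proof (rule integrable_const_bound[where B="1 / Im z"])
    show "AE \<omega> in M. cmod (?R \<omega> i i) \<le> 1 / Im z"
      using resolvent_on_diag_bound[OF _ entry_sym resolvent_on_resolvent[OF _ entry_sym z0] i z0] by simp
    show "(\<lambda>\<omega>. ?R \<omega> i i) \<in> borel_measurable M"
      using i by (intro measurable_resolvent entry_measurable) auto
  qed
  have "(LINT x|spectral_measure n. 1 / (of_real x - z)) - m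
      = (1 / real n) *\<^sub>R ((\<Sum>i=1..n. expectation (\<lambda>\<omega>. ?R \<omega> i i)) - (\<Sum>i=1..n. m))"
    unfolding stieltjes_spectral_measure[OF n z0] using n by (simp add: scaleR_diff_right scaleR_conv_of_real diff_divide_distrib)
  also have "(\<Sum>i=1..n. expectation (\<lambda>\<omega>. ?R \<omega> i i)) - (\<Sum>i=1..n. m) = (\<Sum>i=1..n. expectation (\<lambda>\<omega>. ?R \<omega> i i - m))"
    unfolding sum_subtractf[symmetric] using intR by (intro sum.cong refl) (simp add: prob_space)
  finally have "cmod ((LINT x|spectral_measure n. 1 / (of_real x - z)) - m)
      = (1 / real n) * cmod (\<Sum>i=1..n. expectation (\<lambda>\<omega>. ?R \<omega> i i - m))" by simp
  also have "\<dots> \<le> (1 / real n) * (\<Sum>i=1..n. T.D z m i)"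
  proof (intro mult_left_mono order.trans[OF norm_sum] sum_mono)
    show "cmod (expectation (\<lambda>\<omega>. ?R \<omega> i i - m)) \<le> T.D z m i" for i
      unfolding T.D_def A by (rule integral_norm_bound)
  qed auto
  also have "\<dots> \<le> (1 / real n) * (2 * (real n * ((12 + 25 * K) * \<tau>) + 4 * (\<Sum>i=1..n. T.L i) / \<tau>
      + (\<Sum>i=1..n. \<bar>(\<Sum>j=1..n. T.v i j) - 1\<bar>)))"
    by (intro mult_left_mono T.average_estimate z m) auto
  also have "(\<Sum>i=1..n. \<bar>(\<Sum>j=1..n. T.v i j) - 1\<bar>) = (\<Sum>i=1..n. \<bar>(row_scale \<sigma> n i)\<^sup>2 - 1\<bar>)"
    by (intro sum.cong refl) (simp only: v)
  also have "(1 / real n) * (2 * (real n * ((12 + 25 * K) * \<tau>) + 4 * (\<Sum>i=1..n. T.L i) / \<tau>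
      + (\<Sum>i=1..n. \<bar>(row_scale \<sigma> n i)\<^sup>2 - 1\<bar>)))
      = 2 * ((12 + 25 * K) * \<tau> + 4 * lindeberg_sum M X n \<tau> / \<tau> + (1 / real n) * (\<Sum>i=1..n. \<bar>(row_scale \<sigma> n i)\<^sup>2 - 1\<bar>))"
    unfolding L using n \<tau> by (simp add: field_simps)
  finally show ?thesis .
qed

end

lemma isCont_semicircle_cdf: "isCont (cdf semicircle_measure) x"
proof -
  interpret real_distribution semicircle_measure by (rule real_distribution_semicircle)
  have "emeasure semicircle_measure {x} = (\<integral>\<^sup>+u. ennreal (semicircle_density u) * indicator {x} u \<partial>lborel)"
    unfolding semicircle_measure_def by (rule emeasure_density) auto
  also have "\<dots> = 0" by simp
  finally show ?thesis by (simp add: isCont_cdf measure_def)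
qed

theorem theorem1p2:
  fixes M :: "'a measure"
    and X :: "nat \<Rightarrow> nat \<Rightarrow> 'a \<Rightarrow> real"
    and \<sigma> :: "nat \<Rightarrow> nat \<Rightarrow> real"
  assumes "prob_space M"
    and "\<And>i j. 1 \<le> i \<Longrightarrow> i \<le> j \<Longrightarrow> X i j \<in> borel_measurable M"
    and "\<And>i j. 1 \<le> i \<Longrightarrow> i \<le> j \<Longrightarrow> integrable M (\<lambda>\<omega>. (X i j \<omega>)\<^sup>2)"
    and "\<And>i j. 1 \<le> i \<Longrightarrow> i \<le> j \<Longrightarrow> (LINT \<omega>|M. X i j \<omega>) = 0"
    and "\<And>i j. 1 \<le> i \<Longrightarrow> i \<le> j \<Longrightarrow> (LINT \<omega>|M. (X i j \<omega>)\<^sup>2) = (\<sigma> i j)\<^sup>2"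
    and "\<And>i j \<omega>. 1 \<le> i \<Longrightarrow> i < j \<Longrightarrow> \<omega> \<in> space M \<Longrightarrow> X j i \<omega> = X i j \<omega>"
    and "\<And>i j. 1 \<le> i \<Longrightarrow> i < j \<Longrightarrow> \<sigma> j i = \<sigma> i j"
    and "\<And>n. prob_space.indep_vars M (\<lambda>_. borel) (\<lambda>(i, j). X i j)
               {(i, j). 1 \<le> i \<and> i \<le> j \<and> j \<le> n}"
    and "\<And>\<tau>. \<tau> > 0 \<Longrightarrow> (\<lambda>n. lindeberg_sum M X n \<tau>) \<longlonglongrightarrow> 0"
    and "(\<lambda>n. (1 / real n) * (\<Sum>i = 1..n. \<bar>(row_scale \<sigma> n i)\<^sup>2 - 1\<bar>)) \<longlonglongrightarrow> 0"
    and "\<exists>C. \<forall>n\<ge>1. (MAX i\<in>{1..n}. row_scale \<sigma> n i) \<le> C"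
  shows "(\<lambda>n. SUP x. \<bar>expected_spectral_cdf M X n x - semicircle_cdf x\<bar>) \<longlonglongrightarrow> 0"
proof -
  interpret wigner_array M X \<sigma>
    by (rule wigner_array.intro[OF assms(1)], unfold_locales) (rule assms; assumption)+
  obtain C where C: "\<And>n. n \<ge> 1 \<Longrightarrow> (MAX i\<in>{1..n}. row_scale \<sigma> n i) \<le> C" using assms(11) by blast
  define K where "K = C\<^sup>2"
  have K: "(row_scale \<sigma> n i)\<^sup>2 \<le> K" if "n \<ge> 1" "i \<in> {1..n}" for n i
  proof -
    have "row_scale \<sigma> n i \<le> (MAX i\<in>{1..n}. row_scale \<sigma> n i)" using that by (intro Max_ge) auto
    also have "\<dots> \<le> C" by (rule C[OF that(1)])
    finally show ?thesis unfolding K_def by (intro power_mono) (auto simp: row_scale_def sum_nonneg)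
  qed
  have K0: "K \<ge> 0" by (simp add: K_def)
  \<comment> \<open>The shift avoids \<open>n = 0\<close>, for which there is no eigenvalue and no
    spectral probability measure.\<close>
  let ?\<mu> = "\<lambda>n. spectral_measure (Suc n)"
  interpret S: real_distribution semicircle_measure by (rule real_distribution_semicircle)
  have \<mu>: "real_distribution (?\<mu> n)" for n by (rule real_distribution_spectral_measure) simp
  have "weak_conv_m ?\<mu> semicircle_measure"
  \<comment> \<open>The choice of \<open>c\<close> ensures both \<open>Im z \<ge> 1\<close> and
    \<open>2 * K \<le> Im z \<le> (Im z)^2\<close>, the two conditions of the contraction.\<close>
  proof (rule stieltjes_criterion[OF \<mu> real_distribution_semicircle, where C = K and c = "1 + 2 * K"])
    show "integrable (?\<mu> n) (\<lambda>x. x\<^sup>2)" "(LINT x|?\<mu> n. x\<^sup>2) \<le> K" for n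
      using second_moment_spectral_measure[of "Suc n" K] K by auto
    fix z :: complex assume z: "Im z > 1 + 2 * K"
    have z1: "Im z \<ge> 1" "Im z > 0" using z K0 by auto
    have z2: "2 * K \<le> (Im z)\<^sup>2"
    proof -
      have "2 * K \<le> Im z" using z by simp
      also have "\<dots> \<le> Im z * Im z" using z1 by (simp add: mult_le_cancel_left1)
      finally show ?thesis by (simp add: power2_eq_square)
    qed
    define m where "m = (LINT x|semicircle_measure. 1 / (of_real x - z))"
    have m1: "m * (- z - m) = 1" unfolding m_def by (rule stieltjes_semicircle[OF z1(2)])
    have m2: "cmod m \<le> 1 / Im z"
    proof -
      have bd: "cmod (1 / (of_real x - z)) \<le> 1 / Im z" for x by (rule cauchy_kernel_bound(1)[OF z1(2)])
      have "cmod m \<le> (LINT x|semicircle_measure. cmod (1 / (of_real x - z)))"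
        unfolding m_def by (rule integral_norm_bound)
      also have "\<dots> \<le> 1 / Im z"
        using bd by (intro S.integral_le_const S.integrable_const_bound[where B="1 / Im z"]) auto
      finally show ?thesis .
    qed
    have "(\<lambda>n. LINT x|spectral_measure n. 1 / (of_real x - z)) \<longlonglongrightarrow> m"
    proof (rule LIMSEQ_I)
      fix \<epsilon> :: real assume e: "\<epsilon> > 0"
      \<comment> \<open>Makes the term with \<tau> alone at most \<open>\<epsilon> / 2\<close>; with
        \<tau> now fixed, the remaining terms tend to 0 in \<open>n\<close> and take the other
        half.\<close>
      define \<tau> where "\<tau> = min 1 (\<epsilon> / (4 * (12 + 25 * K)))"
      have \<tau>: "0 < \<tau>" "\<tau> \<le> 1" using e K0 by (auto simp: \<tau>_def)
      have "(12 + 25 * K) * \<tau> \<le> (12 + 25 * K) * (\<epsilon> / (4 * (12 + 25 * K)))"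
        using K0 by (intro mult_left_mono) (auto simp: \<tau>_def)
      also have "\<dots> = \<epsilon> / 4" using K0 by (simp add: field_simps)
      finally have \<tau>': "2 * ((12 + 25 * K) * \<tau>) \<le> \<epsilon> / 2" by simp
      have "(\<lambda>n. 2 * (4 * lindeberg_sum M X n \<tau> / \<tau> + (1 / real n) * (\<Sum>i = 1..n. \<bar>(row_scale \<sigma> n i)\<^sup>2 - 1\<bar>)))
          \<longlonglongrightarrow> 2 * (4 * 0 / \<tau> + 0)"
        using \<tau> by (intro tendsto_intros assms(9,10)) auto
      then have "\<forall>\<^sub>F n in sequentially. 2 * (4 * lindeberg_sum M X n \<tau> / \<tau>
          + (1 / real n) * (\<Sum>i = 1..n. \<bar>(row_scale \<sigma> n i)\<^sup>2 - 1\<bar>)) < \<epsilon> / 2"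
        by (rule order_tendstoD) (use e in simp)
      then obtain N where N: "\<And>n. n \<ge> N \<Longrightarrow> 2 * (4 * lindeberg_sum M X n \<tau> / \<tau>
          + (1 / real n) * (\<Sum>i = 1..n. \<bar>(row_scale \<sigma> n i)\<^sup>2 - 1\<bar>)) < \<epsilon> / 2"
        unfolding eventually_sequentially by blast
      show "\<exists>no. \<forall>n\<ge>no. cmod ((LINT x|spectral_measure n. 1 / (of_real x - z)) - m) < \<epsilon>"
      proof (intro exI[of _ "max 1 N"] allI impI)
        fix n assume "max 1 N \<le> n"
        then have n: "n \<ge> 1" "n \<ge> N" by auto
        have "cmod ((LINT x|spectral_measure n. 1 / (of_real x - z)) - m) \<le>
           2 * ((12 + 25 * K) * \<tau> + 4 * lindeberg_sum M X n \<tau> / \<tau> + (1 / real n) * (\<Sum>i=1..n. \<bar>(row_scale \<sigma> n i)\<^sup>2 - 1\<bar>))"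
          by (rule stieltjes_error[OF n(1) K[OF n(1)] \<tau> z1(1) z2 m1 m2])
        also have "\<dots> = 2 * ((12 + 25 * K) * \<tau>) + 2 * (4 * lindeberg_sum M X n \<tau> / \<tau> + (1 / real n) * (\<Sum>i=1..n. \<bar>(row_scale \<sigma> n i)\<^sup>2 - 1\<bar>))"
          by (simp only: distrib_left add.assoc)
        also have "\<dots> < \<epsilon>" using add_le_less_mono[OF \<tau>' N[OF n(2)]] by simp
        finally show "cmod ((LINT x|spectral_measure n. 1 / (of_real x - z)) - m) < \<epsilon>" .
      qed
    qed
    then show "(\<lambda>n. LINT x|?\<mu> n. 1 / (of_real x - z)) \<longlonglongrightarrow> (LINT x|semicircle_measure. 1 / (of_real x - z))"
      unfolding m_def by (rule LIMSEQ_Suc)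
  qed (use K0 in auto)
  from Polya_uniform_cdf[OF \<mu> real_distribution_semicircle this isCont_semicircle_cdf]
  have "(\<lambda>n. SUP x. \<bar>expected_spectral_cdf M X (Suc n) x - semicircle_cdf x\<bar>) \<longlonglongrightarrow> 0"
    by (simp add: cdf_spectral_measure cdf_semicircle)
  then show ?thesis by (rule LIMSEQ_imp_Suc)
qed

end
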